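(* Let $X$ be a non-empty finite set and let $\mathcal{P}$ be a partition of $X$ such that $\mathcal{P}$ has exactly $m_i \ge 2$ blocks of size $n_i \ge 2$ for $i=1,\dots,p$ (the $n_i$ pairwise distinct), exactly one block of each of the sizes $l_1,\dots,l_q$ where each $l_i\ge 2$ (these sizes distinct from each other and from the $n_i$), and $t$ singleton blocks, and no other blocks (where $p,q,t$ may be $0$). If $|S(X,\mathcal{P})|\ge 3$, then $$\operatorname{rank} T(X,\mathcal{P}) = \max\{2,\,2p+q+g(t)\}+\binom{p+q}{2}+2p+q+g'(t)-1+l+h(p,q,t),$$ where $g(0)=g(1)=0$ and $g(t)=1$ for $t\ge 2$; $g'(0)=0$ and $g'(t)=1$ for $t\ge 1$; $l$ is the number of values $s\ge 2$ such that $\mathcal{P}$ has a block of size $s$ but no block of size $s-1$; and $h(p,q,0)=0$, $h(p,q,1)=p+q$, $h(p,q,t)=p+q+1$ for $t\ge 2$.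
   Context: Transformations of $X$ are written on the right of their arguments and composed left to right. For a partition $\mathcal{P}$ of $X$, $T(X,\mathcal{P})$ is the semigroup of all maps $f:X\to X$ such that for every block $P\in\mathcal{P}$ there is a block $Q\in\mathcal{P}$ with $Pf\subseteq Q$. $S(X,\mathcal{P})$ denotes the group of units of $T(X,\mathcal{P})$, i.e. the set of bijections of $X$ lying in $T(X,\mathcal{P})$. The rank of a semigroup $S$, $\operatorname{rank} S$, is the least cardinality of a subset $U\subseteq S$ such that every element of $S$ is a product of elements of $U$. *)

theory Defs
  imports Main "HOL-Library.Disjoint_Sets"
begin

text \<open>Transformations of X are represented as functions that are the identity outside X.
  Composition "f then g" (right actions, left to right) is g o f.\<close>

definition TP :: "'a set \<Rightarrow> 'a set set \<Rightarrow> ('a \<Rightarrow> 'a) set" where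
  "TP X P = {f. (\<forall>x. x \<notin> X \<longrightarrow> f x = x) \<and> f ` X \<subseteq> X \<and>
                (\<forall>B\<in>P. \<exists>C\<in>P. f ` B \<subseteq> C)}"

definition SP :: "'a set \<Rightarrow> 'a set set \<Rightarrow> ('a \<Rightarrow> 'a) set" where
  "SP X P = {f \<in> TP X P. bij_betw f X X}"

inductive_set sgen :: "('a \<Rightarrow> 'a) set \<Rightarrow> ('a \<Rightarrow> 'a) set" for U where
  base: "u \<in> U \<Longrightarrow> u \<in> sgen U"
| prod: "f \<in> sgen U \<Longrightarrow> g \<in> sgen U \<Longrightarrow> (g \<circ> f) \<in> sgen U"

definition srank :: "('a \<Rightarrow> 'a) set \<Rightarrow> nat" where
  "srank S = (LEAST k. \<exists>U. U \<subseteq> S \<and> finite U \<and> card U = k \<and> sgen U = S)"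

definition gfun :: "nat \<Rightarrow> nat" where
  "gfun t = (if t \<ge> 2 then 1 else 0)"

definition gfun' :: "nat \<Rightarrow> nat" where
  "gfun' t = (if t \<ge> 1 then 1 else 0)"

definition hfun :: "nat \<Rightarrow> nat \<Rightarrow> nat \<Rightarrow> nat" where
  "hfun p q t = (if t = 0 then 0 else if t = 1 then p + q else p + q + 1)"

definition lcount :: "'a set set \<Rightarrow> nat" where
  "lcount P = card {s::nat. s \<ge> 2 \<and> (\<exists>B\<in>P. card B = s) \<and> \<not> (\<exists>B\<in>P. card B = s - 1)}"

end

theory Submission
  imports Defs "HOL-Combinatorics.Cycles"
begin

text \<open>The group of units \<open>SP X P\<close> is a direct product of wreath products and symmetric groups, and a
  product of maps is a unit only if all factors are, so the rank is the rank of the group of units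
  plus the number of non-units that must be added to a generating set of units.

  Units: the signs of a unit on the points, and on the blocks, of each block size map the group
  onto an elementary abelian 2-group whose rank is the number of sizes at least 2 plus the number of
  sizes occurring at least twice. Conversely this many generators (but at least 2) suffice: an
  involution times a commuting element of odd order generates both, which lets generators be merged.

  Non-units: three kinds of maps are unavoidable, because the complement of each kind is closed
  under composition. They are: merging two blocks of given sizes \<open>s \<le> s'\<close> injectively; exchanging two
  blocks of consecutive sizes, losing as little as possible; and identifying two points of a block of
  size \<open>s\<close>, when no block has size \<open>s - 1\<close>. One map for each kind and choice of sizes is enough: maps permuting the blocks are
  reduced to size-preserving ones by exchanges, and for the others a missing block of maximal
  size is brought into the image, or replaced by a larger missing block.\<close>

section \<open>Semigroups of maps and symmetric groups\<close>

text \<open>Inverses come for free, since units have finite order, so one representative of each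
  type can be conjugated to every choice of blocks. For this to be exact, each block is enumerated
  once and the standard maps move points between equal indices. The obstacle for units is the count:
  a symmetric factor needs a transposition and a long cycle, but may cost only one generator. A
  cycle of odd length can be attached to an involution with another support and split off again by
  powers. The obstacle for non-units is that a repair applied after a map also acts on points that
  are already in place. Images are therefore redirected to a missing block, where a repair disturbs
  nothing else. A group of units with a single generator turns out to have order at most 2; this
  explains the hypothesis on the number of units and the 2 in the maximum.\<close>

definition comp_closed :: "('a \<Rightarrow> 'a) set \<Rightarrow> bool" where
  "comp_closed H \<longleftrightarrow> (\<forall>f\<in>H. \<forall>g\<in>H. g \<circ> f \<in> H)"

lemma comp_closedD: "comp_closed H \<Longrightarrow> g \<in> H \<Longrightarrow> f \<in> H \<Longrightarrow> g \<circ> f \<in> H"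
  by (auto simp: comp_closed_def)

lemma comp_closed_sgen: "comp_closed (sgen U)"
  by (auto simp: comp_closed_def intro: sgen.prod)

lemma sgen_least:
  assumes "comp_closed H" "U \<subseteq> H"
  shows "sgen U \<subseteq> H"
proof
  fix f assume "f \<in> sgen U"
  then show "f \<in> H"
    by induction (use assms comp_closedD in blast)+
qed

lemma funpow_in:
  assumes "comp_closed H" "f \<in> H" "n > 0"
  shows "f ^^ n \<in> H"
  using assms(3)
proof (induction n)
  case (Suc n)
  then show ?case using assms(1,2) by (cases "n = 0") (simp, metis comp_closedD funpow.simps(2) neq0_conv)
qed simp

text \<open>A permutation of a finite set has finite order, so its inverse and the identity are
  powers of it; closure under composition alone suffices.\<close>

lemma comp_closed_inv:
  assumes "comp_closed H" "f \<in> H" "f permutes S" "finite S"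
  shows "inv f \<in> H" and "id \<in> H"
proof -
  have "permutation f" using assms(3,4) by (auto simp: permutation_permutes)
  then obtain n where n: "f ^^ n = id" "n > 0" by (rule permutation_is_nilpotent)
  show "id \<in> H" using funpow_in[OF assms(1,2) n(2)] n(1) by simp
  obtain k where k: "n = Suc k" using n(2) by (cases n) auto
  have "f \<circ> f ^^ k = id" "f ^^ k \<circ> f = id" using n(1) unfolding k by (simp, metis funpow_Suc_right)
  then have "inv f = f ^^ k" by (intro inv_unique_comp)
  then show "inv f \<in> H"
    using \<open>id \<in> H\<close> funpow_in[OF assms(1,2), of k] by (cases "k = 0") auto
qed

text \<open>Conjugation is stated as an intertwining relation, so that no inverse has to be computed
  when it is applied. Only \<open>f\<close> is a permutation, hence non-units \<open>g\<close> can
  be transported too.\<close>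

lemma comp_closed_conj:
  assumes "comp_closed H" "f \<in> H" "g \<in> H" "f permutes S" "finite S" "f \<circ> g = g' \<circ> f"
  shows "g' \<in> H"
proof -
  have "f \<circ> g \<circ> inv f \<in> H"
    using assms comp_closed_inv[OF assms(1,2,4,5)] by (intro comp_closedD)
  also have "f \<circ> g \<circ> inv f = g'"
    using assms(6) permutes_inv_o(1)[OF assms(4)] by (simp add: comp_assoc)
  finally show ?thesis .
qed

lemma transpose_image_in:
  assumes "comp_closed H" "f \<in> H" "f permutes S" "finite S" "transpose a b \<in> H"
  shows "transpose (f a) (f b) \<in> H"
proof (rule comp_closed_conj[OF assms(1,2,5,3,4)])
  have "inj f" using assms(3) by (rule permutes_inj)
  then show "f \<circ> transpose a b = transpose (f a) (f b) \<circ> f"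
    by (auto simp: fun_eq_iff transpose_def inj_eq)
qed

lemma transpose_trans_in:
  assumes "comp_closed H" "id \<in> H" "transpose a b \<in> H" "transpose b c \<in> H"
  shows "transpose a c \<in> H"
proof (cases "a = c \<or> b = c")
  case False
  then have "transpose a c = transpose a b \<circ> transpose b c \<circ> transpose a b"
    by (simp add: transpose_comp_triple)
  then show ?thesis using assms by (auto intro!: comp_closedD)
qed (use assms in auto)

text \<open>Composing with the transposition of \<open>x\<close> and \<open>\<phi> x\<close> fixes
  \<open>x\<close> and moves no new point, so the number of moved points drops. The former preimage
  of \<open>x\<close> now goes to \<open>\<phi> x\<close>, which is where transitivity of
  \<open>E\<close> enters. It is applied to points and to blocks.\<close>

lemma permutes_class_induct:
  assumes "finite A" "\<phi> permutes A"
    and E: "\<And>x. x \<in> A \<Longrightarrow> E x (\<phi> x)"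
    and sym: "\<And>x y. E x y \<Longrightarrow> E y x" and trans: "\<And>x y z. E x y \<Longrightarrow> E y z \<Longrightarrow> E x z"
    and id: "Q id"
    and step: "\<And>a b \<psi>. a \<in> A \<Longrightarrow> b \<in> A \<Longrightarrow> a \<noteq> b \<Longrightarrow> E a b \<Longrightarrow> \<psi> permutes A \<Longrightarrow>
      (\<And>x. x \<in> A \<Longrightarrow> E x (\<psi> x)) \<Longrightarrow> Q \<psi> \<Longrightarrow> Q (transpose a b \<circ> \<psi>)"
  shows "Q \<phi>"
  using assms(2,3)
proof (induction "card {x\<in>A. \<phi> x \<noteq> x}" arbitrary: \<phi> rule: less_induct)
  case less
  show ?case
  proof (cases "\<phi> = id")
    case False
    then obtain x where x: "\<phi> x \<noteq> x" by (auto simp: fun_eq_iff)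
    then have xA: "x \<in> A" using less.prems(1) by (auto simp: permutes_def)
    let ?t = "transpose x (\<phi> x)" and ?\<psi> = "transpose x (\<phi> x) \<circ> \<phi>"
    have pA: "\<phi> x \<in> A" using permutes_in_image[OF less.prems(1)] xA by simp
    have inj: "inj \<phi>" using less.prems(1) by (rule permutes_inj)
    have perm: "?\<psi> permutes A"
      using less.prems(1) xA pA by (intro permutes_compose permutes_swap_id)
    have E': "E z (?\<psi> z)" if z: "z \<in> A" for z
    proof (cases "\<phi> z = x")
      case True
      then have "?\<psi> z = \<phi> x" by simp
      then show ?thesis using less.prems(2)[OF z] less.prems(2)[OF xA] True trans by metis
    next
      case False
      show ?thesis
      proof (cases "z = x")
        case True
        then show ?thesis using less.prems(2)[OF xA] sym trans by (metis comp_apply transpose_apply_second)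
      next
        case zx: False
        then have "?\<psi> z = \<phi> z" using False inj by (auto simp: transpose_def inj_eq)
        then show ?thesis using less.prems(2)[OF z] by simp
      qed
    qed
    have "{z\<in>A. ?\<psi> z \<noteq> z} \<subset> {z\<in>A. \<phi> z \<noteq> z}"
      using x xA inj by (auto simp: transpose_def inj_eq split: if_splits)
    then have "card {z\<in>A. ?\<psi> z \<noteq> z} < card {z\<in>A. \<phi> z \<noteq> z}"
      using assms(1) by (intro psubset_card_mono) auto
    then have "Q ?\<psi>" using less.hyps perm E' by blast
    then have "Q (?t \<circ> ?\<psi>)"
      using step xA pA x less.prems(2)[OF xA] perm E' by (metis)
    then show ?thesis by (simp add: o_assoc)
  qed (simp add: id)
qed

corollary comp_closed_permutes:
  assumes "comp_closed H" "id \<in> H" "finite A" "\<phi> permutes A"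
    "\<And>x. x \<in> A \<Longrightarrow> transpose x (\<phi> x) \<in> H"
  shows "\<phi> \<in> H"
proof (rule permutes_class_induct[OF assms(3,4), where E = "\<lambda>x y. transpose x y \<in> H"])
  show "transpose a b \<circ> \<psi> \<in> H" if "transpose a b \<in> H" "\<psi> \<in> H" for a b \<psi>
    using that assms(1) by (rule comp_closedD[rotated])
qed (use assms transpose_trans_in[OF assms(1,2)] in \<open>metis transpose_commute\<close>)+

text \<open>The two factors commute, so the odd power is \<open>\<tau> ^^ N\<close> times
  \<open>c ^^ N\<close>. One generator \<open>\<tau> \<circ> c\<close> thus yields
  \<open>\<tau>\<close>, and after cancelling it also \<open>c\<close>.\<close>

lemma odd_funpow_involution:
  assumes "\<tau> \<circ> \<tau> = id" "c ^^ N = id" "odd N" "\<tau> \<circ> c = c \<circ> \<tau>"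
  shows "(\<tau> \<circ> c) ^^ N = \<tau>"
proof -
  have comm: "c ^^ k \<circ> \<tau> = \<tau> \<circ> c ^^ k" for k
  proof (induction k)
    case (Suc k)
    have "c ^^ Suc k \<circ> \<tau> = c \<circ> (c ^^ k \<circ> \<tau>)" by (simp add: comp_assoc)
    also have "\<dots> = (c \<circ> \<tau>) \<circ> c ^^ k" by (simp only: Suc comp_assoc)
    also have "\<dots> = \<tau> \<circ> c ^^ Suc k" by (simp add: assms(4)[symmetric] comp_assoc)
    finally show ?case .
  qed simp
  have *: "(\<tau> \<circ> c) ^^ k = \<tau> ^^ k \<circ> c ^^ k" for k
  proof (induction k)
    case (Suc k)
    have "(\<tau> \<circ> c) ^^ Suc k = (\<tau> \<circ> c) ^^ k \<circ> (\<tau> \<circ> c)" by (metis funpow_Suc_right)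
    also have "\<dots> = \<tau> ^^ k \<circ> (c ^^ k \<circ> \<tau>) \<circ> c" by (simp only: Suc comp_assoc)
    also have "\<dots> = (\<tau> ^^ k \<circ> \<tau>) \<circ> (c ^^ k \<circ> c)" by (simp only: comm comp_assoc)
    also have "\<dots> = \<tau> ^^ Suc k \<circ> c ^^ Suc k" by (metis funpow_Suc_right)
    finally show ?case .
  qed simp
  have "\<tau> ^^ (2 * k) = id" for k using assms(1) by (induction k) auto
  then have "\<tau> ^^ N = \<tau>" using assms(3) by (auto elim!: oddE)
  then show ?thesis using * assms(2) by simp
qed

text \<open>With \<open>E x y\<close> read as: the transposition of \<open>x\<close> and \<open>y\<close> is generated, this says that \<open>c\<close> and the
  transposition of \<open>a\<close> and \<open>b\<close> generate the symmetric group on \<open>Y\<close>.\<close>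

definition cycle_connects :: "('a \<Rightarrow> 'a) \<Rightarrow> 'a \<Rightarrow> 'a \<Rightarrow> 'a set \<Rightarrow> bool" where
  "cycle_connects c a b Y \<longleftrightarrow> (\<forall>E. symp E \<longrightarrow> transp E \<longrightarrow>
     (\<forall>x\<in>Y. \<forall>y\<in>Y. E x y \<longrightarrow> E (c x) (c y)) \<longrightarrow> E a b \<longrightarrow> (\<forall>x\<in>Y. \<forall>y\<in>Y. E x y))"

text \<open>For odd degree take a full cycle and a transposition of neighbours, whose shifts link
  consecutive points. For even degree the last point is left out, which keeps the order odd; the
  transposition ties it to the cycle, and its shifts link it to every other point.\<close>

lemma odd_cycle_exists:
  assumes "finite Y" "card Y \<ge> 2"
  obtains a b c N where "a \<in> Y" "b \<in> Y" "a \<noteq> b" "c permutes Y" "odd N" "c ^^ N = id"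
    "cycle_connects c a b Y"
proof -
  define n where "n = card Y"
  have n2: "n \<ge> 2" using assms by (simp add: n_def)
  obtain e where e: "bij_betw e {..<n} Y"
    using ex_bij_betw_nat_finite[OF assms(1)] by (auto simp: n_def atLeast0LessThan)
  define N where "N = (if odd n then n else n - 1)"
  have Nodd: "odd N" and N: "0 < N" "N \<le> n" using n2 by (auto simp: N_def)
  define a where "a = e 0"
  define b where "b = e (if odd n then 1 else n - 1)"
  define i where "i = inv_into {..<n} e"
  have ie: "i (e k) = k" if "k < n" for k
    using that e by (auto simp: i_def bij_betw_def inv_into_f_f)
  have eY: "e k \<in> Y" if "k < n" for k using that e by (auto simp: bij_betw_def)
  have ei: "i y < n" "e (i y) = y" if "y \<in> Y" for y
    using that e by (auto simp: i_def bij_betw_def f_inv_into_f inv_into_into dest: inv_into_into)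
  have einj: "e j = e k \<longleftrightarrow> j = k" if "j < n" "k < n" for j k using that ie by metis
  define c where "c x = (if x \<in> Y \<and> i x < N then e ((i x + 1) mod N) else x)" for x
  have cpow: "(c ^^ k) x = (if x \<in> Y \<and> i x < N then e ((i x + k) mod N) else x)" for k x
  proof (induction k)
    case 0
    then show ?case by (auto simp: ei)
  next
    case (Suc k)
    have "(i x + k) mod N < n" using N by (meson mod_less_divisor order_less_le_trans)
    then show ?case using Suc N by (auto simp: c_def ie eY mod_simps)
  qed
  have cN: "c ^^ N = id" by (auto simp: fun_eq_iff cpow ei)
  have "bij_betw c Y Y"
  proof (rule bij_betw_byWitness[where f' = "c ^^ (N - 1)"])
    have "Suc (N - 1) = N" using N by simp
    then have 1: "c ^^ (N - 1) \<circ> c = id" and 2: "c \<circ> c ^^ (N - 1) = id"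
      using cN by (metis funpow_Suc_right, metis funpow.simps(2))
    show "\<forall>y\<in>Y. (c ^^ (N - 1)) (c y) = y" using 1 by (metis comp_apply id_apply)
    show "\<forall>y\<in>Y. c ((c ^^ (N - 1)) y) = y" using 2 by (metis comp_apply id_apply)
    have "k mod N < n" for k using N by (meson mod_less_divisor order_less_le_trans)
    then show "c ` Y \<subseteq> Y" "(c ^^ (N - 1)) ` Y \<subseteq> Y" by (auto simp: c_def cpow eY)
  qed
  then have cp: "c permutes Y" by (intro bij_imp_permutes) (auto simp: c_def)
  have ce: "c (e k) = e ((k + 1) mod N)" if "k < N" for k
    using that N by (auto simp: c_def ie eY)
  have "a \<in> Y" "b \<in> Y" using n2 by (auto simp: a_def b_def eY)
  moreover have "a \<noteq> b" using n2 by (auto simp: a_def b_def einj)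
  moreover have "E x y"
    if E: "symp E" "transp E" and cE: "\<forall>x\<in>Y. \<forall>y\<in>Y. E x y \<longrightarrow> E (c x) (c y)" and ab: "E a b"
      and xy: "x \<in> Y" "y \<in> Y" for E x y
  proof -
    note sym = sympD[OF E(1)] and trans = transpD[OF E(2)]
    have cE: "E (c x) (c y)" if "x \<in> Y" "y \<in> Y" "E x y" for x y using cE that by blast
    have "E (e 0) (e k)" if "k < n" for k
    proof (cases "odd n")
      case True
      then have Nn: "N = n" "n \<ge> 3" using n2 by (auto simp: N_def) presburger
      have st: "Suc k < n \<Longrightarrow> E (e k) (e (Suc k))" for k
      proof (induction k)
        case 0
        then show ?case using ab True by (simp add: a_def b_def)
      next
        case (Suc k)
        then have "E (c (e k)) (c (e (Suc k)))" by (intro cE eY) auto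
        then show ?case using Suc.prems Nn by (simp add: ce)
      qed
      show ?thesis using that
      proof (induction k)
        case 0
        then show ?case using ab trans sym a_def by metis
      next
        case (Suc k)
        then show ?case using st[of k] trans by auto
      qed
    next
      case False
      then have Nn: "N = n - 1" by (simp add: N_def)
      let ?l = "e (n - 1)"
      have cl: "c ?l = ?l" using Nn n2 by (simp add: c_def ie)
      have st: "k < N \<Longrightarrow> E (e k) ?l" for k
      proof (induction k)
        case 0
        then show ?case using ab False by (simp add: a_def b_def)
      next
        case (Suc k)
        then have "E (c (e k)) (c ?l)" using N n2 by (intro cE eY) auto
        then show ?case using Suc.prems cl by (simp add: ce)
      qed
      show ?thesis
      proof (cases "k < N")
        case True
        then show ?thesis using st[of 0] st[of k] N trans sym by metis
      next
        case False
        then have "k = n - 1" using that Nn by simp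
        then show ?thesis using st[of 0] N by simp
      qed
    qed
    then have "E (e 0) x" "E (e 0) y" using ei xy by metis+
    then show "E x y" using trans sym by metis
  qed
  ultimately show thesis
    using that[of a b c N] cp Nodd cN unfolding cycle_connects_def by blast
qed

text \<open>The element \<open>h\<close> has to agree with the cycle \<open>c\<close> only on
  \<open>Y\<close> and may act arbitrarily elsewhere. This allows one generator to carry cycles of
  several factors.\<close>

lemma comp_closed_symmetric:
  assumes "comp_closed H" "h \<in> H" "h permutes S" "finite S" "\<And>x. x \<in> Y \<Longrightarrow> h x = c x"
    and "transpose a b \<in> H"
    and gen: "cycle_connects c a b Y"
    and "x \<in> Y" "y \<in> Y"
  shows "transpose x y \<in> H"
proof -
  define E where "E = (\<lambda>x y. transpose x y \<in> H)"
  have id: "id \<in> H" using comp_closed_inv assms(1-4) by blast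
  have "symp E" by (auto simp: symp_def E_def transpose_commute)
  moreover have "transp E"
    using transpose_trans_in[OF assms(1) id] unfolding transp_def E_def by blast
  moreover have "E (c x) (c y)" if "x \<in> Y" "y \<in> Y" "E x y" for x y
    using transpose_image_in[OF assms(1-4)] assms(5) that by (metis E_def)
  moreover have "E a b" using assms(6) by (simp add: E_def)
  ultimately have "E x y" using gen assms(8,9) unfolding cycle_connects_def by blast
  then show ?thesis by (simp add: E_def)
qed

section \<open>Blocks of a partition\<close>

locale partitioned =
  fixes X :: "'a set" and P :: "'a set set"
  assumes finX: "finite X" and part: "partition_on X P"
begin

abbreviation "T \<equiv> TP X P"
abbreviation "G \<equiv> SP X P"

lemma finP: "finite P"
  using finite_elements[OF finX part] .

lemma block_subset: "B \<in> P \<Longrightarrow> B \<subseteq> X"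
  using part by (auto simp: partition_on_def)

lemma block_finite: "B \<in> P \<Longrightarrow> finite B"
  using block_subset finX finite_subset by blast

lemma block_nonempty: "B \<in> P \<Longrightarrow> B \<noteq> {}"
  using part by (auto simp: partition_on_def)

lemma block_card_pos: "B \<in> P \<Longrightarrow> card B > 0"
  using block_finite block_nonempty by (simp add: card_gt_0_iff)

lemma block_card_ge_2:
  assumes "B \<in> P" "x \<in> B" "y \<in> B" "x \<noteq> y" shows "card B \<ge> 2"
  using card_mono[OF block_finite[OF assms(1)], of "{x, y}"] assms by simp

lemma block_disjoint: "B \<in> P \<Longrightarrow> C \<in> P \<Longrightarrow> x \<in> B \<Longrightarrow> x \<in> C \<Longrightarrow> B = C"
  using part by (auto simp: partition_on_def disjoint_def)

section \<open>Blocks and indices of points\<close>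

definition blk :: "'a \<Rightarrow> 'a set" where
  "blk x = (THE B. B \<in> P \<and> x \<in> B)"

lemma blk_eq: "B \<in> P \<Longrightarrow> x \<in> B \<Longrightarrow> blk x = B"
  unfolding blk_def by (rule the_equality) (auto dest: block_disjoint)

lemma blk_in: "x \<in> X \<Longrightarrow> blk x \<in> P" and in_blk: "x \<in> X \<Longrightarrow> x \<in> blk x"
  using part blk_eq by (auto simp: partition_on_def)

text \<open>An arbitrary enumeration of each block gives every point an index in its block.\<close>

definition pt :: "'a set \<Rightarrow> nat \<Rightarrow> 'a" where
  "pt B = (SOME e. bij_betw e {..<card B} B)"

definition idx :: "'a \<Rightarrow> nat" where
  "idx x = inv_into {..<card (blk x)} (pt (blk x)) x"

lemma pt_bij: "B \<in> P \<Longrightarrow> bij_betw (pt B) {..<card B} B"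
  using ex_bij_betw_nat_finite[OF block_finite, of B] unfolding pt_def atLeast0LessThan
  by (rule someI_ex)

lemma pt_in: "B \<in> P \<Longrightarrow> k < card B \<Longrightarrow> pt B k \<in> B"
  using pt_bij by (auto simp: bij_betw_def)

lemma pt_in_X: "B \<in> P \<Longrightarrow> k < card B \<Longrightarrow> pt B k \<in> X"
  using pt_in block_subset by blast

lemma blk_pt: "B \<in> P \<Longrightarrow> k < card B \<Longrightarrow> blk (pt B k) = B"
  using pt_in blk_eq by blast

lemma idx_pt: "B \<in> P \<Longrightarrow> k < card B \<Longrightarrow> idx (pt B k) = k"
  using pt_bij by (auto simp: idx_def blk_pt bij_betw_def inv_into_f_f)

lemma pt_inject: "B \<in> P \<Longrightarrow> j < card B \<Longrightarrow> k < card B \<Longrightarrow> pt B j = pt B k \<longleftrightarrow> j = k"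
  by (metis idx_pt)

lemma idx_less: "B \<in> P \<Longrightarrow> x \<in> B \<Longrightarrow> idx x < card B"
  and pt_idx: "B \<in> P \<Longrightarrow> x \<in> B \<Longrightarrow> pt B (idx x) = x"
  using pt_bij[of B] blk_eq[of B x]
    inv_into_into[of x "pt B" "{..<card B}"]
  by (auto simp: idx_def bij_betw_def f_inv_into_f)

lemma block_ptE:
  assumes "B \<in> P" "x \<in> B"
  obtains k where "k < card B" "x = pt B k"
  using idx_less[OF assms] pt_idx[OF assms] that by metis

text \<open>The induced map on blocks, meaningful for \<open>f \<in> T\<close> and \<open>B \<in> P\<close> only.\<close>

definition bm :: "('a \<Rightarrow> 'a) \<Rightarrow> 'a set \<Rightarrow> 'a set" where
  "bm f B = blk (f (pt B 0))"

lemma TI: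
  assumes "\<And>x. x \<notin> X \<Longrightarrow> f x = x" "\<And>B. B \<in> P \<Longrightarrow> \<exists>C\<in>P. f ` B \<subseteq> C"
  shows "f \<in> T"
proof -
  have "f x \<in> X" if "x \<in> X" for x
    using assms(2)[OF blk_in[OF that]] in_blk[OF that] block_subset by blast
  then show ?thesis using assms by (auto simp: TP_def)
qed

lemma T_outside: "f \<in> T \<Longrightarrow> x \<notin> X \<Longrightarrow> f x = x"
  and T_in_X: "f \<in> T \<Longrightarrow> x \<in> X \<Longrightarrow> f x \<in> X"
  by (auto simp: TP_def)

lemma bm_eq:
  assumes "f \<in> T" "B \<in> P" "x \<in> B"
  shows "blk (f x) = bm f B"
proof -
  obtain C where C: "C \<in> P" "f ` B \<subseteq> C" using assms by (auto simp: TP_def)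
  have "pt B 0 \<in> B" using pt_in block_card_pos assms by blast
  then show ?thesis using C assms blk_eq unfolding bm_def by (metis image_subset_iff)
qed

lemma bm_eqI: "f \<in> T \<Longrightarrow> B \<in> P \<Longrightarrow> C \<in> P \<Longrightarrow> x \<in> B \<Longrightarrow> f x \<in> C \<Longrightarrow> bm f B = C"
  using bm_eq blk_eq by metis

lemma bm_in: "f \<in> T \<Longrightarrow> B \<in> P \<Longrightarrow> bm f B \<in> P"
  unfolding bm_def by (rule blk_in[OF T_in_X[OF _ pt_in_X[OF _ block_card_pos]]])

lemma image_bm:
  assumes fB: "f \<in> T" "B \<in> P" shows "f ` B \<subseteq> bm f B"
proof (rule image_subsetI)
  fix x assume x: "x \<in> B"
  then have "f x \<in> X" using fB T_in_X block_subset by blast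
  then show "f x \<in> bm f B" using in_blk bm_eq[OF fB x] by metis
qed

lemma T_in_bm: "f \<in> T \<Longrightarrow> B \<in> P \<Longrightarrow> x \<in> B \<Longrightarrow> f x \<in> bm f B"
  using image_bm by blast

lemma id_T: "id \<in> T"
  by (rule TI) auto

lemma T_comp:
  assumes "f \<in> T" "g \<in> T"
  shows "g \<circ> f \<in> T"
proof (rule TI)
  fix B assume "B \<in> P"
  then show "\<exists>C\<in>P. (g \<circ> f) ` B \<subseteq> C"
    using image_bm[of f B] image_bm[of g "bm f B"] bm_in assms by (intro bexI[of _ "bm g (bm f B)"]) auto
qed (use assms in \<open>simp add: T_outside\<close>)

lemma bm_comp:
  assumes "f \<in> T" "g \<in> T" "B \<in> P"
  shows "bm (g \<circ> f) B = bm g (bm f B)"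
proof -
  obtain x where "x \<in> B" using assms block_nonempty by blast
  then show ?thesis using assms by (intro bm_eqI[of _ _ _ x] T_comp) (auto intro: bm_in T_in_bm)
qed

lemma bm_id: "B \<in> P \<Longrightarrow> bm id B = B"
  using block_nonempty[of B] bm_eqI[OF id_T] by (metis all_not_in_conv id_apply)

text \<open>No other block sees the change. The inductions on non-units alter maps one block at a
  time in this way.\<close>

lemma override_T:
  assumes "f \<in> T" "A \<in> P" "Q \<in> P" "j ` A \<subseteq> Q"
  shows "override_on f j A \<in> T"
proof (rule TI)
  fix x assume "x \<notin> X"
  then show "override_on f j A x = x"
    using assms block_subset T_outside by (auto simp: override_on_def)
next
  fix B assume B: "B \<in> P"
  show "\<exists>C\<in>P. override_on f j A ` B \<subseteq> C"
  proof (cases "B = A")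
    case True
    then show ?thesis using assms by (auto simp: override_on_def)
  next
    case False
    then have "override_on f j A ` B = f ` B"
      using block_disjoint[OF B assms(2)] by (auto simp: override_on_def image_iff)
    then show ?thesis using image_bm[OF assms(1) B] bm_in[OF assms(1) B] by auto
  qed
qed

lemma bm_override:
  assumes "f \<in> T" "A \<in> P" "Q \<in> P" "j ` A \<subseteq> Q" "B \<in> P"
  shows "bm (override_on f j A) B = (if B = A then Q else bm f B)"
proof -
  obtain x where x: "x \<in> B" using assms(5) block_nonempty by blast
  have "x \<notin> A" if "B \<noteq> A" using that x block_disjoint assms by blast
  then show ?thesis using assms x
    by (intro bm_eqI[OF override_T[OF assms(1-4)] assms(5) _ x]) (auto intro: bm_in T_in_bm)
qed

section \<open>Units and their action on blocks\<close>

lemma G_iff: "f \<in> G \<longleftrightarrow> f \<in> T \<and> f permutes X"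
  by (auto simp: SP_def permutes_imp_bij intro: bij_imp_permutes T_outside)

lemma G_T: "f \<in> G \<Longrightarrow> f \<in> T" and G_permutes: "f \<in> G \<Longrightarrow> f permutes X"
  by (auto simp: G_iff)

text \<open>The sum of all block sizes is invariant under a bijection of the blocks, so a strict
  increase somewhere would need a decrease elsewhere.\<close>

lemma card_preserving:
  assumes "bij_betw \<phi> P P" "\<And>B. B \<in> P \<Longrightarrow> card B \<le> card (\<phi> B)" "B \<in> P"
  shows "card (\<phi> B) = card B"
proof (rule ccontr)
  assume "card (\<phi> B) \<noteq> card B"
  then have "card B < card (\<phi> B)" using assms by (simp add: le_neq_implies_less)
  then have "sum card P < (\<Sum>B\<in>P. card (\<phi> B))"
    using assms finP by (intro sum_strict_mono_ex1) auto
  moreover have "(\<Sum>B\<in>P. card (\<phi> B)) = sum card P"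
    by (rule sum.reindex_bij_betw[OF assms(1)])
  ultimately show False by simp
qed

lemma inj_card_bm:
  assumes "f \<in> T" "B \<in> P" "inj_on f B"
  shows "card B \<le> card (bm f B)"
  using assms by (metis card_inj_on_le image_bm bm_in block_finite)

lemma bij_bm: "f \<in> T \<Longrightarrow> inj_on (bm f) P \<Longrightarrow> bij_betw (bm f) P P"
  using finP bm_in by (metis endo_inj_surj bij_betw_def image_subsetI)

lemma unitI:
  assumes "f \<in> T" "inj_on (bm f) P" "\<And>B. B \<in> P \<Longrightarrow> inj_on f B"
  shows "f \<in> G"
proof -
  have "inj_on f X"
  proof (rule inj_onI)
    fix x y assume xy: "x \<in> X" "y \<in> X" "f x = f y"
    then have "bm f (blk x) = bm f (blk y)"
      using bm_eq[OF assms(1) blk_in in_blk] by metis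
    then have "blk x = blk y" using assms(2) xy blk_in by (auto dest: inj_onD)
    then show "x = y" using xy assms(3)[OF blk_in] in_blk by (metis inj_onD)
  qed
  moreover have "f ` X \<subseteq> X" using T_in_X assms(1) by blast
  ultimately have "bij_betw f X X" using finX by (simp add: bij_betw_def endo_inj_surj)
  then show ?thesis using assms(1) by (simp add: SP_def)
qed

lemma unit_inj_on: "f \<in> G \<Longrightarrow> inj_on f B"
  using G_permutes permutes_inj inj_on_subset by blast

lemma unit_inj_bm:
  assumes "f \<in> G" shows "inj_on (bm f) P"
proof (rule eq_card_imp_inj_on[OF finP])
  have "P \<subseteq> bm f ` P"
  proof
    fix C assume C: "C \<in> P"
    then obtain y where y: "y \<in> C" using block_nonempty by blast
    then have "y \<in> X" using C block_subset by blast
    then have "y \<in> f ` X" using permutes_image[OF G_permutes[OF assms]] by simp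
    then obtain x where x: "x \<in> X" "f x = y" by auto
    then have "bm f (blk x) = C"
      using C y G_T[OF assms] by (intro bm_eqI[of f _ _ x] blk_in in_blk) auto
    then show "C \<in> bm f ` P" using x blk_in by blast
  qed
  moreover have "bm f ` P \<subseteq> P" using bm_in G_T assms by blast
  ultimately show "card (bm f ` P) = card P" by (simp add: subset_antisym)
qed

lemma unit_bij_bm: "f \<in> G \<Longrightarrow> bij_betw (bm f) P P"
  using bij_bm unit_inj_bm G_T by blast

lemma unit_card_bm: "f \<in> G \<Longrightarrow> B \<in> P \<Longrightarrow> card (bm f B) = card B"
  by (rule card_preserving[OF unit_bij_bm]) (auto intro: inj_card_bm G_T unit_inj_on)

lemma unit_image:
  assumes "f \<in> G" "B \<in> P" shows "f ` B = bm f B"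
  using assms
  by (intro card_subset_eq block_finite bm_in image_bm G_T)
    (auto simp: unit_card_bm card_image unit_inj_on)

lemma unit_comp: "f \<in> G \<Longrightarrow> g \<in> G \<Longrightarrow> g \<circ> f \<in> G"
  by (auto simp: G_iff intro: T_comp permutes_compose)

lemma id_G: "id \<in> G"
  by (simp add: G_iff id_T)

lemma comp_closed_G: "comp_closed G" and comp_closed_T: "comp_closed T"
  unfolding comp_closed_def using unit_comp T_comp by blast+

lemma inv_G: "f \<in> G \<Longrightarrow> inv f \<in> G"
  using comp_closed_inv(1)[OF comp_closed_G _ G_permutes finX] by blast

lemma unit_of_comp:
  assumes "f \<in> T" "g \<in> T" "g \<circ> f \<in> G"
  shows "f \<in> G" "g \<in> G"
proof -
  have inj: "inj_on (g \<circ> f) X" using unit_inj_on assms(3) by blast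
  have "inj_on f X" using inj by (rule inj_on_imageI2)
  moreover have "f ` X \<subseteq> X" using T_in_X assms(1) by blast
  ultimately have f: "f ` X = X" and bf: "bij_betw f X X"
    using finX by (simp_all add: bij_betw_def endo_inj_surj)
  show "f \<in> G" using bf assms(1) by (simp add: SP_def)
  have "inj_on g (f ` X)" using inj by (rule inj_on_imageI)
  moreover have "g ` X \<subseteq> X" using T_in_X assms(2) by blast
  ultimately have "bij_betw g X X" using f finX by (simp add: bij_betw_def endo_inj_surj)
  then show "g \<in> G" using assms(2) by (simp add: SP_def)
qed

text \<open>Indices beyond the size of \<open>Q\<close> are sent to the last point of \<open>Q\<close>.\<close>

definition cpt :: "'a set \<Rightarrow> 'a \<Rightarrow> 'a" where
  "cpt Q x = pt Q (min (idx x) (card Q - 1))"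

lemma cpt_in: "Q \<in> P \<Longrightarrow> cpt Q x \<in> Q"
  using block_card_pos[of Q] by (auto simp: cpt_def intro!: pt_in)

lemma cpt_pt: "R \<in> P \<Longrightarrow> k < card R \<Longrightarrow> k < card Q \<Longrightarrow> cpt Q (pt R k) = pt Q k"
  by (auto simp: cpt_def idx_pt min_def intro!: arg_cong[of _ _ "pt Q"])

text \<open>A smaller block embeds into a larger one by equal indices, and clamping back is a left
  inverse of the embedding.\<close>

lemma cpt_cpt:
  assumes "R \<in> P" "Q \<in> P" "x \<in> R" "card R \<le> card Q"
  shows "cpt R (cpt Q x) = x"
proof -
  obtain k where "k < card R" "x = pt R k" using assms block_ptE by metis
  then show ?thesis using assms by (simp add: cpt_pt)
qed

lemma cpt_inj: "R \<in> P \<Longrightarrow> Q \<in> P \<Longrightarrow> card R \<le> card Q \<Longrightarrow> inj_on (cpt Q) R"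
  by (metis cpt_cpt inj_onI)

text \<open>For blocks of equal size this is an involution matching equal indices. If
  \<open>Q\<close> is larger, only its surplus points are identified, all with the last point of
  \<open>R\<close>, so as little as possible is lost.\<close>

definition bswap :: "'a set \<Rightarrow> 'a set \<Rightarrow> 'a \<Rightarrow> 'a" where
  "bswap R Q x = (if x \<in> R then cpt Q x else if x \<in> Q then cpt R x else x)"

text \<open>A right inverse of \<open>bm\<close> on maps of the blocks. On size-preserving
  permutations it is a homomorphism, which splits the group of units into block permutations and
  maps fixing every block.\<close>

definition lift :: "('a set \<Rightarrow> 'a set) \<Rightarrow> 'a \<Rightarrow> 'a" where
  "lift \<phi> x = (if x \<in> X then cpt (\<phi> (blk x)) x else x)"

lemma lift_T:
  assumes "\<And>B. B \<in> P \<Longrightarrow> \<phi> B \<in> P" shows "lift \<phi> \<in> T"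
proof (rule TI)
  fix B assume B: "B \<in> P"
  then show "\<exists>C\<in>P. lift \<phi> ` B \<subseteq> C"
    using assms[OF B] block_subset[OF B] by (intro bexI[of _ "\<phi> B"]) (auto simp: lift_def blk_eq cpt_in)
qed (simp add: lift_def)

lemma lift_pt: "B \<in> P \<Longrightarrow> k < card B \<Longrightarrow> k < card (\<phi> B) \<Longrightarrow> lift \<phi> (pt B k) = pt (\<phi> B) k"
  by (simp add: lift_def pt_in_X blk_pt cpt_pt)

lemma bm_lift:
  assumes "\<And>B. B \<in> P \<Longrightarrow> \<phi> B \<in> P" "B \<in> P" shows "bm (lift \<phi>) B = \<phi> B"
proof -
  have "pt B 0 \<in> B" using pt_in block_card_pos assms by blast
  then show ?thesis using assms block_subset
    by (intro bm_eqI[OF lift_T, of _ _ _ "pt B 0"]) (auto simp: lift_def blk_eq cpt_in)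
qed

lemma cpt_self: "B \<in> P \<Longrightarrow> x \<in> B \<Longrightarrow> cpt B x = x"
  using cpt_pt by (metis block_ptE)

lemma bswap_lift:
  assumes "R \<in> P" "Q \<in> P" shows "bswap R Q = lift (transpose R Q)"
proof
  fix x
  show "bswap R Q x = lift (transpose R Q) x"
  proof (cases "x \<in> X")
    case True
    then have "x \<in> R \<longleftrightarrow> blk x = R" "x \<in> Q \<longleftrightarrow> blk x = Q" "cpt (blk x) x = x"
      using assms blk_eq in_blk blk_in cpt_self by metis+
    then show ?thesis using True by (auto simp: bswap_def lift_def transpose_def)
  next
    case False
    then show ?thesis using block_subset assms by (auto simp: bswap_def lift_def)
  qed
qed

text \<open>Size preservation is asked of \<open>\<psi>\<close>, which is applied first: then no
  index is clamped before \<open>\<phi>\<close> acts. For \<open>\<phi>\<close> any clamping happens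
  once on both sides.\<close>

lemma lift_comp:
  assumes "\<And>B. B \<in> P \<Longrightarrow> \<psi> B \<in> P" "\<And>B. B \<in> P \<Longrightarrow> card (\<psi> B) = card B"
  shows "lift \<phi> \<circ> lift \<psi> = lift (\<phi> \<circ> \<psi>)"
proof
  fix x
  show "(lift \<phi> \<circ> lift \<psi>) x = lift (\<phi> \<circ> \<psi>) x"
  proof (cases "x \<in> X")
    case True
    then obtain k where k: "blk x \<in> P" "k < card (blk x)" "x = pt (blk x) k"
      using blk_in in_blk block_ptE by metis
    define B where "B = blk x"
    have B: "B \<in> P" "k < card B" "x = pt B k" using k by (auto simp: B_def)
    have "k < card (\<psi> B)" "\<psi> B \<in> P" using assms B by auto
    then show ?thesis using B by (simp add: lift_def pt_in_X blk_pt cpt_pt) (simp add: cpt_def idx_pt)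
  qed (simp add: lift_def)
qed

lemma lift_id: "lift id = id"
  by (auto simp: fun_eq_iff lift_def blk_in in_blk cpt_self)

lemma lift_G:
  assumes "\<phi> permutes P" "\<And>B. B \<in> P \<Longrightarrow> card (\<phi> B) = card B"
  shows "lift \<phi> \<in> G"
proof -
  have \<phi>: "\<phi> B \<in> P" if "B \<in> P" for B using that permutes_in_image[OF assms(1)] by simp
  show ?thesis
  proof (rule unitI[OF lift_T[OF \<phi>]])
    show "inj_on (bm (lift \<phi>)) P"
      using permutes_inj[OF assms(1)] by (auto simp: inj_on_def bm_lift[OF \<phi>] dest: injD)
    fix B assume B: "B \<in> P"
    have "inj_on (cpt (\<phi> B)) B" using B \<phi> assms by (intro cpt_inj) auto
    then show "inj_on (lift \<phi>) B" using B block_subset[OF B]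
      by (auto simp: inj_on_def lift_def blk_eq subset_iff)
  qed
qed

lemma transpose_block_in: "R \<in> P \<Longrightarrow> Q \<in> P \<Longrightarrow> B \<in> P \<Longrightarrow> transpose R Q B \<in> P"
  and transpose_block_card: "card R = card Q \<Longrightarrow> card (transpose R Q B) = card B"
  by (simp_all add: transpose_def)

lemma bswap_T: "R \<in> P \<Longrightarrow> Q \<in> P \<Longrightarrow> bswap R Q \<in> T"
  by (simp add: bswap_lift lift_T transpose_block_in)

lemma bm_bswap: "R \<in> P \<Longrightarrow> Q \<in> P \<Longrightarrow> B \<in> P \<Longrightarrow> bm (bswap R Q) B = transpose R Q B"
  by (simp add: bswap_lift bm_lift transpose_block_in)

lemma bswap_G: "R \<in> P \<Longrightarrow> Q \<in> P \<Longrightarrow> card R = card Q \<Longrightarrow> bswap R Q \<in> G"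
  by (simp add: bswap_lift lift_G permutes_swap_id transpose_block_card)

lemma bswap_pt:
  assumes "R \<in> P" "Q \<in> P" "card R = card Q" "B \<in> P" "k < card B"
  shows "bswap R Q (pt B k) = pt (transpose R Q B) k"
  using assms by (simp add: bswap_lift lift_pt transpose_block_card)

lemma transpose_T:
  assumes "B \<in> P" "x \<in> B" "y \<in> B" shows "transpose x y \<in> T"
proof (rule TI)
  fix z assume "z \<notin> X"
  then show "transpose x y z = z" using assms block_subset by (auto simp: transpose_def)
next
  fix C assume C: "C \<in> P"
  have "transpose x y ` C \<subseteq> C"
    using assms block_disjoint[OF C assms(1)] by (auto simp: transpose_def)
  then show "\<exists>D\<in>P. transpose x y ` C \<subseteq> D" using C by blast
qed

lemma transpose_G:
  assumes "B \<in> P" "x \<in> B" "y \<in> B" shows "transpose x y \<in> G"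
  using transpose_T[OF assms] block_subset[OF assms(1)] assms(2,3)
  by (auto simp: G_iff intro!: permutes_swap_id)

lemma bm_transpose:
  assumes "B \<in> P" "x \<in> B" "y \<in> B" "C \<in> P" shows "bm (transpose x y) C = C"
proof -
  obtain z where "z \<in> C" using assms block_nonempty by blast
  then show ?thesis using assms block_disjoint[of B C]
    by (intro bm_eqI[OF transpose_T[OF assms(1-3)], of _ _ z]) (auto simp: transpose_def)
qed

lemma bswap_self: "B \<in> P \<Longrightarrow> bswap B B = id"
  by (simp add: bswap_lift lift_id)

lemma bswap_commute: "B \<in> P \<Longrightarrow> C \<in> P \<Longrightarrow> bswap B C = bswap C B"
  by (simp add: bswap_lift transpose_commute)

text \<open>The unit \<open>u\<close> respects indices, so it carries the clamping of one exchange
  to that of the other. \<open>R\<close> and \<open>Q\<close> may differ in size, hence the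
  non-invertible exchanges are covered.\<close>

lemma bswap_conj:
  assumes "u \<in> G" "R \<in> P" "R' \<in> P" "Q \<in> P" "Q' \<in> P" "card R' = card R" "card Q' = card Q"
    "R \<noteq> Q" "R' \<noteq> Q'"
    and u: "\<forall>k<card R. u (pt R' k) = pt R k" "\<forall>k<card Q. u (pt Q' k) = pt Q k"
  shows "u \<circ> bswap R' Q' = bswap R Q \<circ> u"
proof
  fix x
  have pos: "card R > 0" "card Q > 0" using block_card_pos assms by auto
  consider (1) k where "k < card R'" "x = pt R' k" | (2) k where "k < card Q'" "x = pt Q' k"
    | (3) "x \<notin> R'" "x \<notin> Q'" using block_ptE assms by metis
  then show "(u \<circ> bswap R' Q') x = (bswap R Q \<circ> u) x"
  proof cases
    case 1
    then have "x \<in> R'" "pt R k \<in> R" using assms pt_in by auto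
    then show ?thesis using 1 assms pos by (simp add: bswap_def cpt_def idx_pt)
  next
    case 2
    then have "x \<in> Q'" "pt Q k \<in> Q" using assms pt_in by auto
    moreover have "x \<notin> R'" "pt Q k \<notin> R" using calculation assms block_disjoint by blast+
    ultimately show ?thesis using 2 assms pos by (simp add: bswap_def cpt_def idx_pt)
  next
    case 3
    have "pt R' 0 \<in> R'" "u (pt R' 0) \<in> R" "pt Q' 0 \<in> Q'" "u (pt Q' 0) \<in> Q"
      using assms pos pt_in by simp_all
    then have "bm u R' = R" "bm u Q' = Q" using bm_eqI[OF G_T[OF assms(1)]] assms(2-5) by blast+
    moreover have "u x \<notin> u ` R'" "u x \<notin> u ` Q'"
      using 3 permutes_inj[OF G_permutes[OF assms(1)]] by (auto simp: inj_eq)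
    ultimately have "u x \<notin> R" "u x \<notin> Q" using unit_image[OF assms(1)] assms(3,5) by auto
    then show ?thesis using 3 by (simp add: bswap_def)
  qed
qed

text \<open>As for transpositions of points: conjugating the exchange of \<open>C\<close> and
  \<open>D\<close> by that of \<open>B\<close> and \<open>C\<close> replaces \<open>C\<close> by
  \<open>B\<close>.\<close>

lemma bswap_trans:
  assumes H: "comp_closed H" "id \<in> H"
    and B: "B \<in> P" "C \<in> P" "D \<in> P" "card B = card C" "card C = card D"
    and sw: "bswap B C \<in> H" "bswap C D \<in> H"
  shows "bswap B D \<in> H"
proof (cases "B = D \<or> C = D \<or> B = C")
  case True
  then show ?thesis using assms bswap_self by auto
next
  case False
  then have ne: "B \<noteq> D" "C \<noteq> D" "B \<noteq> C" "D \<noteq> B" "D \<noteq> C" by blast+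
  have uG: "bswap B C \<in> G" using B by (intro bswap_G)
  have "bswap B C \<circ> bswap C D = bswap B D \<circ> bswap B C"
    by (rule bswap_conj[OF uG B(1,2,3,3)]) (simp_all add: bswap_pt B ne)
  then show ?thesis using comp_closed_conj[OF H(1) sw G_permutes[OF uG] finX] by blast
qed

lemma lift_in:
  assumes H: "comp_closed H" "id \<in> H"
    and \<phi>: "\<phi> permutes P" "\<And>B. B \<in> P \<Longrightarrow> card (\<phi> B) = card B" "\<And>B. B \<in> P \<Longrightarrow> bswap B (\<phi> B) \<in> H"
  shows "lift \<phi> \<in> H"
proof (rule permutes_class_induct[OF finP \<phi>(1),
      where E = "\<lambda>B C. B \<in> P \<and> C \<in> P \<and> card B = card C \<and> bswap B C \<in> H"])
  show "lift id \<in> H" using H by (simp add: lift_id)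
  fix B C \<psi> assume BC: "B \<in> P" "C \<in> P" "B \<in> P \<and> C \<in> P \<and> card B = card C \<and> bswap B C \<in> H"
    and \<psi>: "\<psi> permutes P" "\<And>x. x \<in> P \<Longrightarrow> x \<in> P \<and> \<psi> x \<in> P \<and> card x = card (\<psi> x) \<and> bswap x (\<psi> x) \<in> H"
      "lift \<psi> \<in> H"
  have "\<psi> D \<in> P" "card (\<psi> D) = card D" if "D \<in> P" for D using \<psi>(2)[OF that] by simp_all
  then have "lift (transpose B C \<circ> \<psi>) = bswap B C \<circ> lift \<psi>"
    using BC by (simp add: bswap_lift lift_comp)
  then show "lift (transpose B C \<circ> \<psi>) \<in> H"
    using comp_closedD[OF H(1), of "bswap B C" "lift \<psi>"] BC \<psi>(3) by simp
next
  fix B assume "B \<in> P"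
  then show "B \<in> P \<and> \<phi> B \<in> P \<and> card B = card (\<phi> B) \<and> bswap B (\<phi> B) \<in> H"
    using \<phi>(2,3) permutes_in_image[OF \<phi>(1)] by simp
next
  fix B C assume "B \<in> P \<and> C \<in> P \<and> card B = card C \<and> bswap B C \<in> H"
  then show "C \<in> P \<and> B \<in> P \<and> card C = card B \<and> bswap C B \<in> H"
    using bswap_commute by metis
next
  fix B C D assume "B \<in> P \<and> C \<in> P \<and> card B = card C \<and> bswap B C \<in> H"
    "C \<in> P \<and> D \<in> P \<and> card C = card D \<and> bswap C D \<in> H"
  then show "B \<in> P \<and> D \<in> P \<and> card B = card D \<and> bswap B D \<in> H"
    using bswap_trans[OF H] by auto
qed

text \<open>Dividing by the lifted block permutation leaves a map that fixes every block.
  Injectivity inside the blocks is not assumed, so this serves units and non-units alike.\<close>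

lemma straighten_blocks:
  assumes f: "f \<in> T" "inj_on (bm f) P" "\<And>B. B \<in> P \<Longrightarrow> card (bm f B) = card B"
  obtains \<phi> g where "\<phi> permutes P" "\<forall>B\<in>P. \<phi> B = bm f B" "lift \<phi> \<in> G" "g \<in> T"
    "lift \<phi> \<circ> g = f" "g = inv (lift \<phi>) \<circ> f" "\<forall>B\<in>P. bm g B = B"
proof -
  define \<phi> where "\<phi> = restrict_id (bm f) P"
  have \<phi>: "\<phi> permutes P"
    using bij_bm[OF f(1,2)] by (auto simp: \<phi>_def intro: permutes_restrict_id)
  have \<phi>_bm: "\<phi> B = bm f B" if "B \<in> P" for B using that by (simp add: \<phi>_def)
  have lG: "lift \<phi> \<in> G" using \<phi> \<phi>_bm f(3) by (intro lift_G) auto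
  define g where "g = inv (lift \<phi>) \<circ> f"
  have gT: "g \<in> T" unfolding g_def using inv_G[OF lG] f(1) G_T by (intro T_comp) auto
  have lg: "lift \<phi> \<circ> g = f"
    unfolding g_def o_assoc permutes_inv_o(1)[OF G_permutes[OF lG]] by simp
  have "bm g B = B" if B: "B \<in> P" for B
  proof -
    have "\<phi> (bm g B) = bm f B"
      using bm_comp[OF gT G_T[OF lG] B] bm_lift[of \<phi> "bm g B"] lg bm_in[OF gT B]
        permutes_in_image[OF \<phi>] by simp
    then show ?thesis using \<phi>_bm[OF B] permutes_inj[OF \<phi>] by (metis injD)
  qed
  then show thesis by (intro that[OF \<phi> _ lG gT lg g_def] ballI \<phi>_bm)
qed

text \<open>After straightening, the lifted part is a product of block exchanges, and the rest moves
  every point within its block, so it is a product of transpositions inside blocks.\<close>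

lemma G_subset:
  assumes H: "comp_closed H" "id \<in> H"
    and tr: "\<And>B x y. B \<in> P \<Longrightarrow> x \<in> B \<Longrightarrow> y \<in> B \<Longrightarrow> transpose x y \<in> H"
    and sw: "\<And>B C. B \<in> P \<Longrightarrow> C \<in> P \<Longrightarrow> card B = card C \<Longrightarrow> B \<noteq> C \<Longrightarrow> bswap B C \<in> H"
  shows "G \<subseteq> H"
proof
  fix f assume f: "f \<in> G"
  obtain \<phi> g where \<phi>: "\<phi> permutes P" "\<forall>B\<in>P. \<phi> B = bm f B" "lift \<phi> \<in> G"
    and g: "lift \<phi> \<circ> g = f" "g = inv (lift \<phi>) \<circ> f" "\<forall>B\<in>P. bm g B = B"
    by (rule straighten_blocks[OF G_T[OF f] unit_inj_bm[OF f] unit_card_bm[OF f]])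
  have \<phi>_card: "card (\<phi> B) = card B" if "B \<in> P" for B
    using unit_card_bm[OF f that] \<phi>(2) that by simp
  have "lift \<phi> \<in> H"
  proof (rule lift_in[OF H \<phi>(1) \<phi>_card])
    fix B assume B: "B \<in> P"
    then show "bswap B (\<phi> B) \<in> H"
      using sw[OF B, of "\<phi> B"] bswap_self[OF B] H(2) \<phi>(2) \<phi>_card bm_in[OF G_T[OF f]]
      by (cases "B = \<phi> B") auto
  qed
  have gG: "g \<in> G" unfolding g(2) using inv_G[OF \<phi>(3)] f by (intro unit_comp)
  have "g \<in> H"
  proof (rule comp_closed_permutes[OF H finX G_permutes[OF gG]])
    fix x assume x: "x \<in> X"
    then have "g x \<in> blk x" using T_in_bm[OF G_T[OF gG] blk_in in_blk] g(3) blk_in by metis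
    then show "transpose x (g x) \<in> H" using tr blk_in in_blk x by blast
  qed
  then show "f \<in> H" using comp_closedD[OF H(1) \<open>lift \<phi> \<in> H\<close>] g(1) by metis
qed

end

section \<open>Generating all block-preserving maps\<close>

lemma finite_obtain_max:
  fixes g :: "'b \<Rightarrow> nat"
  assumes "finite A" "A \<noteq> {}"
  obtains x where "x \<in> A" "\<And>y. y \<in> A \<Longrightarrow> g y \<le> g x"
proof -
  have "Max (g ` A) \<in> g ` A" using assms by (intro Max_in) auto
  then obtain x where "x \<in> A" "g x = Max (g ` A)" by auto
  then show thesis using that assms(1) by simp
qed

text \<open>Match a part of \<open>S'\<close> of the right size with \<open>S\<close> and the
  complements with each other. It lets the image of a standard map be moved over any image that is
  not larger.\<close>

lemma permutes_covering_subset: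
  assumes "finite Q" "S \<subseteq> Q" "S' \<subseteq> Q" "card S \<le> card S'"
  obtains \<pi> where "\<pi> permutes Q" "S \<subseteq> \<pi> ` S'"
proof -
  have fin: "finite S" "finite S'" using assms finite_subset by blast+
  obtain S0 where S0: "S0 \<subseteq> S'" "card S0 = card S"
    using assms(4) by (rule obtain_subset_with_card_n)
  have fS0: "finite S0" "S0 \<subseteq> Q" using S0 fin assms finite_subset by blast+
  obtain f where f: "bij_betw f S0 S"
    using finite_same_card_bij[OF fS0(1) fin(1) S0(2)] by blast
  have "card (Q - S0) = card (Q - S)" using S0 fin fS0 assms by (simp add: card_Diff_subset)
  then obtain g where g: "bij_betw g (Q - S0) (Q - S)"
    using finite_same_card_bij assms(1) by (metis finite_Diff)
  define \<pi> where "\<pi> x = (if x \<in> S0 then f x else if x \<in> Q then g x else x)" for x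
  have "bij_betw \<pi> S0 S" using f by (rule bij_betw_cong[THEN iffD1, rotated]) (simp add: \<pi>_def)
  moreover have "bij_betw \<pi> (Q - S0) (Q - S)"
    using g by (rule bij_betw_cong[THEN iffD1, rotated]) (simp add: \<pi>_def)
  ultimately have "bij_betw \<pi> (S0 \<union> (Q - S0)) (S \<union> (Q - S))"
    by (rule bij_betw_combine) auto
  moreover have "S0 \<union> (Q - S0) = Q" "S \<union> (Q - S) = Q" using fS0 assms by auto
  ultimately have "\<pi> permutes Q" using fS0 by (intro bij_imp_permutes) (auto simp: \<pi>_def)
  moreover have "S \<subseteq> \<pi> ` S'" using \<open>bij_betw \<pi> S0 S\<close> S0 by (auto simp: bij_betw_def)
  ultimately show thesis using that by blast
qed

context partitioned
begin

definition drop_top :: "'a set \<Rightarrow> 'a \<Rightarrow> 'a" where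
  "drop_top B = id(pt B (card B - 1) := pt B (card B - 2))"

definition collapse :: "'a set \<Rightarrow> 'a set \<Rightarrow> 'a \<Rightarrow> 'a" where
  "collapse R Q = override_on id (cpt Q) R"

text \<open>Units act transitively on pairs of distinct blocks of prescribed sizes, and can do so
  respecting indices. This is why one generator per pair of sizes is enough.\<close>

lemma move_pair:
  assumes "R \<in> P" "R' \<in> P" "Q \<in> P" "Q' \<in> P" "card R' = card R" "card Q' = card Q" "R \<noteq> Q" "R' \<noteq> Q'"
  obtains u where "u \<in> G" "\<forall>k<card R. u (pt R' k) = pt R k"
    "\<forall>k<card Q. u (pt Q' k) = pt Q k" "bm u R' = R" "bm u Q' = Q"
proof -
  \<comment> \<open>The swap of \<open>R'\<close> and \<open>R\<close> may displace
    \<open>Q'\<close> if sizes coincide; \<open>Q''\<close> is where \<open>Q'\<close> lies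
    afterwards.\<close>
  define Q'' where "Q'' = transpose R' R Q'"
  have Q'': "Q'' \<in> P" "card Q'' = card Q" "Q'' \<noteq> R"
    using assms transpose_block_in transpose_block_card[of R' R Q'] by (auto simp: Q''_def transpose_def)
  define u where "u = bswap Q'' Q \<circ> bswap R' R"
  have uG: "u \<in> G" unfolding u_def using assms Q'' by (intro unit_comp bswap_G) auto
  have 1: "u (pt R' k) = pt R k" if "k < card R" for k
    using that assms Q'' by (simp add: u_def bswap_pt)
  have 2: "u (pt Q' k) = pt Q k" if "k < card Q" for k
    using that assms Q'' by (simp add: u_def bswap_pt Q''_def[symmetric])
  have "pt R' 0 \<in> R'" "u (pt R' 0) \<in> R" "pt Q' 0 \<in> Q'" "u (pt Q' 0) \<in> Q"
    using assms 1[of 0] 2[of 0] block_card_pos[of R] block_card_pos[of Q] by (auto intro!: pt_in)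
  then have "bm u R' = R" "bm u Q' = Q" using bm_eqI[OF G_T[OF uG]] assms by blast+
  then show thesis using that uG 1 2 by blast
qed

lemma move_points:
  assumes "B \<in> P" "B' \<in> P" "card B' = card B" "x \<in> B" "y \<in> B" "x' \<in> B'" "y' \<in> B'" "x \<noteq> y" "x' \<noteq> y'"
  obtains u where "u \<in> G" "u x' = x" "u y' = y"
proof -
  define u0 where "u0 = bswap B' B"
  have u0: "u0 \<in> G" "u0 x' \<in> B" "u0 y' \<in> B"
    using assms by (auto simp: u0_def bswap_def cpt_in intro: bswap_G)
  define y2 where "y2 = transpose (u0 x') x (u0 y')"
  have ne: "u0 x' \<noteq> u0 y'" using assms(9) permutes_inj[OF G_permutes[OF u0(1)]] by (simp add: inj_eq)
  have y2: "y2 \<in> B" "y2 \<noteq> x" using u0 assms ne by (auto simp: y2_def transpose_def)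
  define u where "u = transpose y2 y \<circ> (transpose (u0 x') x \<circ> u0)"
  have "u \<in> G" unfolding u_def using assms u0 y2 by (intro unit_comp transpose_G[of B]) auto
  moreover have "u x' = x" using assms y2 by (simp add: u_def)
  moreover have "u y' = y" by (simp add: u_def y2_def)
  ultimately show thesis using that by blast
qed

text \<open>Conjugation by units spreads the given representatives to all blocks of the same sizes.
  From these come all maps inside one block, then exchanges and collapses along arbitrary maps
  between two blocks, and with them every map can be repaired step by step.\<close>

lemma T_subset_of_generators:
  assumes H: "comp_closed H" "G \<subseteq> H"
    and coll: "\<And>R Q. R \<in> P \<Longrightarrow> Q \<in> P \<Longrightarrow> R \<noteq> Q \<Longrightarrow> card R \<le> card Q \<Longrightarrow>
      \<exists>R'\<in>P. \<exists>Q'\<in>P. R' \<noteq> Q' \<and> card R' = card R \<and> card Q' = card Q \<and> collapse R' Q' \<in> H"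
    and swap: "\<And>R Q. R \<in> P \<Longrightarrow> Q \<in> P \<Longrightarrow> card R < card Q \<Longrightarrow>
      \<not> (\<exists>M\<in>P. card R < card M \<and> card M < card Q) \<Longrightarrow>
      \<exists>R'\<in>P. \<exists>Q'\<in>P. card R' = card R \<and> card Q' = card Q \<and> bswap R' Q' \<in> H"
    and drop: "\<And>B. B \<in> P \<Longrightarrow> card B \<ge> 2 \<Longrightarrow> \<not> (\<exists>C\<in>P. card C = card B - 1) \<Longrightarrow>
      \<exists>B'\<in>P. card B' = card B \<and> drop_top B' \<in> H"
  shows "T \<subseteq> H"
proof -
  note comp = comp_closedD[OF H(1)]
  have GH: "f \<in> H" if "f \<in> G" for f using that H by blast
  have conj: "f' \<in> H" if "u \<in> G" "f \<in> H" "u \<circ> f = f' \<circ> u" for u f f'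
    using comp_closed_conj[OF H(1) GH[OF that(1)] that(2) G_permutes[OF that(1)] finX that(3)] .

  have swap1: "bswap R Q \<in> H" if "R \<in> P" "Q \<in> P" "card R < card Q"
     "\<not> (\<exists>M\<in>P. card R < card M \<and> card M < card Q)" for R Q
  proof -
    note asm = that
    obtain R' Q' where RQ: "R' \<in> P" "Q' \<in> P" "card R' = card R" "card Q' = card Q" "bswap R' Q' \<in> H"
      using swap[OF asm] by blast
    have ne: "R \<noteq> Q" "R' \<noteq> Q'" using asm RQ by auto
    obtain u where u: "u \<in> G" "\<forall>k<card R. u (pt R' k) = pt R k"
      "\<forall>k<card Q. u (pt Q' k) = pt Q k" "bm u R' = R" "bm u Q' = Q"
      using move_pair[OF asm(1) RQ(1) asm(2) RQ(2) RQ(3,4) ne] by blast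
    have "u \<circ> bswap R' Q' = bswap R Q \<circ> u"
      using bswap_conj[OF u(1) asm(1) RQ(1) asm(2) RQ(2,3,4) ne u(2,3)] .
    then show ?thesis using conj u RQ by blast
  qed

  have coll1: "collapse R Q \<in> H" if "R \<in> P" "Q \<in> P" "R \<noteq> Q" "card R \<le> card Q" for R Q
  proof -
    note asm = that
    obtain R' Q' where RQ: "R' \<in> P" "Q' \<in> P" "card R' = card R" "card Q' = card Q" "R' \<noteq> Q'"
       "collapse R' Q' \<in> H"
      using coll[OF asm] by blast
    obtain u where u: "u \<in> G" "\<forall>k<card R. u (pt R' k) = pt R k"
      "\<forall>k<card Q. u (pt Q' k) = pt Q k" "bm u R' = R" "bm u Q' = Q"
      using move_pair[OF asm(1) RQ(1) asm(2) RQ(2) RQ(3,4) asm(3) RQ(5)] by blast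
    have "u \<circ> collapse R' Q' = collapse R Q \<circ> u"
    proof
      fix x
      show "(u \<circ> collapse R' Q') x = (collapse R Q \<circ> u) x"
      proof (cases "x \<in> R'")
        case True
        then obtain k where k: "k < card R'" "x = pt R' k" using block_ptE RQ by metis
        then have "pt R k \<in> R" using RQ asm pt_in by auto
        then show ?thesis using True k RQ asm u by (simp add: collapse_def cpt_def idx_pt)
      next
        case False
        have "u x \<notin> u ` R'"
          using False permutes_inj[OF G_permutes[OF u(1)]] by (auto simp: inj_eq)
        then have "u x \<notin> R" using unit_image[OF u(1)] u(4,5) RQ by auto
        then show ?thesis using False by (simp add: collapse_def)
      qed
    qed
    then show ?thesis using conj u RQ by blast
  qed

  have drop1: "id(x := y) \<in> H" if asm: "B \<in> P" "x \<in> B" "y \<in> B" for B x y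
  proof (cases "x = y")
    case True
    then have "id(x := y) = id" by auto
    then show ?thesis using GH id_G by metis
  next
    case False
    then have c2: "card B \<ge> 2"
      using asm block_card_ge_2 by blast
    have "\<exists>B'\<in>P. card B' = card B \<and> drop_top B' \<in> H"
    proof (cases "\<exists>C\<in>P. card C = card B - 1")
      case True
      then obtain C where C: "C \<in> P" "card C = card B - 1" by blast
      have w: "bswap C B \<in> H" using C c2 asm by (intro swap1) auto
      have CB: "C \<noteq> B" using C c2 by auto
      \<comment> \<open>With a block \<open>C\<close> one point smaller at hand, going to
        \<open>C\<close> and back clamps just the last index of \<open>B\<close>. Drops are
        therefore required as generators only at gap sizes.\<close>
      have "bswap C B \<circ> bswap C B = drop_top B"
      proof
        fix z
        have B12: "pt B (card B - 1) \<in> B" "pt B (card B - 2) \<in> B" using c2 asm pt_in by auto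
        consider (1) "z \<in> C" | (2) k where "k < card B" "z = pt B k" "z \<in> B" | (3) "z \<notin> C" "z \<notin> B"
          using block_ptE[OF asm(1)] by metis
        then show "(bswap C B \<circ> bswap C B) z = drop_top B z"
        proof cases
          case 1
          have "cpt B z \<in> B" "cpt C (cpt B z) = z" using 1 C asm by (auto intro!: cpt_in cpt_cpt)
          moreover have "z \<notin> B" "cpt B z \<notin> C" using CB 1 calculation C asm block_disjoint by blast+
          ultimately show ?thesis using 1 B12 by (auto simp: bswap_def drop_top_def)
        next
          case 2
          have m: "min k (card C - 1) < card C" using c2 C by linarith
          have "z \<notin> C" "cpt C z \<in> C" using CB 2 C asm block_disjoint cpt_in by blast+
          then have "(bswap C B \<circ> bswap C B) z = cpt B (cpt C z)" using 2 by (simp add: bswap_def)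
          also have "\<dots> = pt B (min k (card B - 2))"
            using 2 C c2 asm m by (simp add: cpt_def idx_pt numeral_2_eq_2)
          finally show ?thesis using 2 asm c2 by (auto simp: drop_top_def pt_inject min_def intro!: arg_cong[of _ _ "pt B"])
        next
          case 3
          then show ?thesis using B12 by (auto simp: bswap_def drop_top_def)
        qed
      qed
      then have "drop_top B \<in> H" using comp[OF w w] by simp
      then show ?thesis using asm by blast
    next
      case False
      then show ?thesis using drop[OF asm(1) c2] by blast
    qed
    then obtain B' where B': "B' \<in> P" "card B' = card B" "drop_top B' \<in> H" by blast
    define x' where "x' = pt B' (card B' - 1)"
    define y' where "y' = pt B' (card B' - 2)"
    have xy': "x' \<in> B'" "y' \<in> B'" "x' \<noteq> y'" using B' c2 by (auto simp: x'_def y'_def pt_in pt_inject)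
    obtain u where u: "u \<in> G" "u x' = x" "u y' = y"
      by (rule move_points[OF asm(1) B'(1,2) asm(2,3) xy'(1,2) False xy'(3)])
    have "u \<circ> id(x' := y') = id(x := y) \<circ> u"
      using u permutes_inj[OF G_permutes[OF u(1)]] by (auto simp: fun_eq_iff inj_eq)
    then show ?thesis using conj[OF u(1) B'(3)] by (simp add: drop_top_def x'_def y'_def)
  qed

  \<comment> \<open>Induct on the number of missed points of \<open>B\<close>: send one of two
    colliding points to a missed \<open>y\<close>, and afterwards identify \<open>y\<close> with the
    old common value. As \<open>y\<close> was missed, this affects no other point.\<close>
  have inner: "override_on id a B \<in> H" if B: "B \<in> P" and a: "a ` B \<subseteq> B" for a B
    using a
  proof (induction "card (B - a ` B)" arbitrary: a rule: less_induct)
    case less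
    show ?case
    proof (cases "inj_on a B")
      case True
      then have "bij_betw a B B" using less.prems block_finite[OF B] by (simp add: bij_betw_def endo_inj_surj)
      then have "bij_betw (override_on id a B) B B"
        by (rule bij_betw_cong[THEN iffD1, rotated]) simp
      then have "override_on id a B permutes B" by (intro bij_imp_permutes) auto
      then have "override_on id a B permutes X" using block_subset[OF B] by (rule permutes_subset)
      moreover have "override_on id a B \<in> T" using override_T[OF id_T B B] less.prems by simp
      ultimately show ?thesis using GH by (simp add: G_iff)
    next
      case False
      then obtain p q where pq: "p \<in> B" "q \<in> B" "p \<noteq> q" "a p = a q" by (auto simp: inj_on_def)
      have "a ` B \<noteq> B" using False endo_inj_surj block_finite[OF B]
        by (metis eq_card_imp_inj_on)
      then obtain y where y: "y \<in> B" "y \<notin> a ` B" using less.prems by blast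
      define a' where "a' = a(q := y)"
      have a'B: "a' ` B \<subseteq> B" using less.prems y by (auto simp: a'_def)
      have "a ` B \<subseteq> a' ` B"
      proof
        fix z assume "z \<in> a ` B"
        then obtain x where x: "x \<in> B" "z = a x" by blast
        show "z \<in> a' ` B"
        proof (cases "x = q")
          case True
          then have "z = a' p" using x pq by (simp add: a'_def)
          then show ?thesis using pq by blast
        next
          case False
          then have "z = a' x" using x by (simp add: a'_def)
          then show ?thesis using x by blast
        qed
      qed
      moreover have "y \<in> a' ` B" using pq by (auto simp: a'_def)
      ultimately have "B - a' ` B \<subset> B - a ` B" using y by blast
      then have "card (B - a' ` B) < card (B - a ` B)"
        using block_finite[OF B] by (intro psubset_card_mono) auto
      then have "override_on id a' B \<in> H" using less.hyps a'B by blast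
      moreover have "id(y := a p) \<in> H" using drop1[OF B y(1)] less.prems pq by blast
      moreover have "override_on id a B = id(y := a p) \<circ> override_on id a' B"
      proof
        fix x
        show "override_on id a B x = (id(y := a p) \<circ> override_on id a' B) x"
        proof (cases "x \<in> B")
          case True
          then have "a x \<noteq> y" using y by blast
          then show ?thesis using True pq by (auto simp: a'_def)
        next
          case False
          then show ?thesis using y by auto
        qed
      qed
      ultimately show ?thesis using comp by metis
    qed
  qed

  have swap2: "bswap R Q \<in> H" if "R \<in> P" "Q \<in> P" "card R \<le> card Q" for R Q
    using that
  proof (induction "card Q - card R" arbitrary: R Q rule: less_induct)
    case less
    consider (1) "card R = card Q" | (2) M where "M \<in> P" "card R < card M" "card M < card Q"
      | (3) "card R < card Q" "\<not> (\<exists>M\<in>P. card R < card M \<and> card M < card Q)"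
      using less.prems(3) by (meson le_neq_implies_less)
    then show ?case
    proof cases
      case 1
      then show ?thesis using GH bswap_G less.prems by blast
    next
      case 2
      have "bswap R M \<in> H" "bswap M Q \<in> H" using 2 less by auto
      then have "bswap M Q \<circ> (bswap R M \<circ> bswap M Q) \<in> H" using comp by blast
      \<comment> \<open>Points of \<open>M\<close> are parked in \<open>Q\<close> and return
        unharmed because \<open>Q\<close> is larger. Points of \<open>Q\<close> are clamped to the
        size of \<open>M\<close> and then to that of \<open>R\<close>, which equals clamping
        once.\<close>
      moreover have "bswap M Q \<circ> (bswap R M \<circ> bswap M Q) = bswap R Q"
      proof
        fix x
        have ne: "R \<noteq> M" "M \<noteq> Q" "R \<noteq> Q" using 2 by auto
        have dis: "y \<notin> B" if "y \<in> C" "B \<in> P" "C \<in> P" "B \<noteq> C" for y B C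
          using that block_disjoint by blast
        consider (a) "x \<in> R" "x \<notin> M" "x \<notin> Q" | (b) "x \<in> M" "x \<notin> R" "x \<notin> Q"
          | (c) "x \<in> Q" "x \<notin> M" "x \<notin> R" | (d) "x \<notin> R" "x \<notin> M" "x \<notin> Q"
          using dis less.prems 2 ne by metis
        then show "(bswap M Q \<circ> (bswap R M \<circ> bswap M Q)) x = bswap R Q x"
        proof cases
          case a
          then obtain k where k: "k < card R" "x = pt R k" using block_ptE less.prems by metis
          have "cpt M x \<in> M" using 2 cpt_in by blast
          then have "(bswap M Q \<circ> (bswap R M \<circ> bswap M Q)) x = cpt Q (cpt M x)"
            using a by (simp add: bswap_def)
          also have "\<dots> = cpt Q x" using 2 less.prems k by (simp add: cpt_pt)
          finally show ?thesis using a by (simp add: bswap_def)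
        next
          case b
          have "cpt Q x \<in> Q" "cpt M (cpt Q x) = x" using 2 less.prems b cpt_in cpt_cpt by auto
          moreover have "cpt Q x \<notin> M" "cpt Q x \<notin> R" using calculation dis less.prems 2 ne by blast+
          ultimately show ?thesis using b by (simp add: bswap_def)
        next
          case c
          then obtain k where k: "k < card Q" "x = pt Q k" using block_ptE less.prems by metis
          have cM: "cpt M x \<in> M" "cpt R (cpt M x) \<in> R" using 2 less.prems cpt_in by blast+
          then have "cpt M x \<notin> R" "cpt R (cpt M x) \<notin> M" "cpt R (cpt M x) \<notin> Q"
            using dis less.prems 2 ne by blast+
          then have "(bswap M Q \<circ> (bswap R M \<circ> bswap M Q)) x = cpt R (cpt M x)"
            using c cM by (simp add: bswap_def)
          also have "\<dots> = cpt R x"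
          proof -
            have "min k (card M - 1) < card M" using 2 by linarith
            then have "cpt R (cpt M x) = pt R (min (min k (card M - 1)) (card R - 1))"
              using 2 less.prems k by (simp add: cpt_def idx_pt)
            also have "min (min k (card M - 1)) (card R - 1) = min k (card R - 1)" using 2 by linarith
            finally show ?thesis using k less.prems by (simp add: cpt_def idx_pt)
          qed
          finally show ?thesis using c by (simp add: bswap_def)
        next
          case d
          then show ?thesis by (simp add: bswap_def)
        qed
      qed
      ultimately show ?thesis by simp
    next
      case 3
      then show ?thesis using swap1 less.prems by blast
    qed
  qed

  \<comment> \<open>Since \<open>R\<close> is not larger than \<open>Q\<close>, both arbitrary maps
    can be absorbed by self-maps of \<open>Q\<close>: \<open>\<gamma>\<close> prepares the points
    leaving \<open>Q\<close>, and \<open>\<alpha>\<close> corrects those arriving from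
    \<open>R\<close>.\<close>
  have eswap: "override_on (override_on id b Q) a R \<in> H"
    if "R \<in> P" "Q \<in> P" "R \<noteq> Q" "card R \<le> card Q" "a ` R \<subseteq> Q" "b ` Q \<subseteq> R" for R Q a b
  proof -
    define \<alpha> where "\<alpha> = override_on id (\<lambda>y. a (cpt R y)) Q"
    define \<gamma> where "\<gamma> = override_on id (\<lambda>y. cpt Q (b y)) Q"
    have "\<alpha> \<in> H" unfolding \<alpha>_def using that cpt_in[of R] by (intro inner) auto
    moreover have "\<gamma> \<in> H" unfolding \<gamma>_def using that cpt_in[of Q] by (intro inner) auto
    ultimately have "\<alpha> \<circ> (bswap R Q \<circ> \<gamma>) \<in> H" using swap2[OF that(1,2,4)] by (intro comp)
    also have "\<alpha> \<circ> (bswap R Q \<circ> \<gamma>) = override_on (override_on id b Q) a R"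
    proof
      fix x
      have dis: "y \<notin> Q" if "y \<in> R" for y using that \<open>R \<noteq> Q\<close> \<open>R \<in> P\<close> \<open>Q \<in> P\<close> block_disjoint by blast
      consider (a) "x \<in> R" "x \<notin> Q" | (b) "x \<in> Q" "x \<notin> R" | (c) "x \<notin> R" "x \<notin> Q" using dis by blast
      then show "(\<alpha> \<circ> (bswap R Q \<circ> \<gamma>)) x = override_on (override_on id b Q) a R x"
      proof cases
        case a
        then have "cpt Q x \<in> Q" "cpt R (cpt Q x) = x" using that cpt_in cpt_cpt by auto
        then show ?thesis using a by (simp add: \<alpha>_def \<gamma>_def bswap_def)
      next
        case b
        then have bR: "b x \<in> R" using that by blast
        then have "cpt Q (b x) \<in> Q" "cpt R (cpt Q (b x)) = b x" using that cpt_in cpt_cpt by auto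
        moreover have "cpt Q (b x) \<notin> R" using calculation dis by blast
        ultimately show ?thesis using b bR dis by (simp add: \<alpha>_def \<gamma>_def bswap_def)
      next
        case c
        then show ?thesis by (simp add: \<alpha>_def \<gamma>_def bswap_def)
      qed
    qed
    finally show ?thesis .
  qed

  \<comment> \<open>A correction on \<open>Q\<close> after the collapse would also move the points
    of \<open>Q\<close> that must stay fixed. Hence only a permutation \<open>\<pi>\<close> of
    \<open>Q\<close> is used, undone in advance by \<open>inv \<pi>\<close>; the rest of the
    adjustment, \<open>\<gamma>\<close>, takes place inside \<open>R\<close>.\<close>
  have ecoll1: "override_on id a R \<in> H"
    if "R \<in> P" "Q \<in> P" "R \<noteq> Q" "card R \<le> card Q" "a ` R \<subseteq> Q" for R Q a
  proof -
    note asm = that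
    have dis: "y \<notin> Q" if "y \<in> R" for y using that asm block_disjoint by blast
    have "card (a ` R) \<le> card (cpt Q ` R)"
      using asm block_finite cpt_inj by (simp add: card_image card_image_le)
    moreover have "cpt Q ` R \<subseteq> Q" using asm cpt_in by blast
    ultimately obtain \<pi> where \<pi>: "\<pi> permutes Q" "a ` R \<subseteq> \<pi> ` cpt Q ` R"
      using permutes_covering_subset block_finite asm by metis
    have \<pi>Q: "override_on id \<pi> Q = \<pi>" "override_on id (inv \<pi>) Q = inv \<pi>"
      using permutes_not_in[OF \<pi>(1)] permutes_not_in[OF permutes_inv[OF \<pi>(1)]]
      by (auto simp: fun_eq_iff override_on_def)
    have \<pi>H: "\<pi> \<in> H" "inv \<pi> \<in> H"
      using inner[of Q \<pi>] inner[of Q "inv \<pi>"] \<pi>Q asm permutes_image[OF \<pi>(1)]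
        permutes_image[OF permutes_inv[OF \<pi>(1)]] by auto
    have "\<exists>r\<in>R. \<pi> (cpt Q r) = a x" if "x \<in> R" for x using \<pi>(2) that by force
    then obtain g where g: "\<And>x. x \<in> R \<Longrightarrow> g x \<in> R \<and> \<pi> (cpt Q (g x)) = a x" by metis
    define \<gamma> where "\<gamma> = override_on id g R"
    have "\<gamma> \<in> H" unfolding \<gamma>_def using asm g by (intro inner) auto
    then have "\<pi> \<circ> (collapse R Q \<circ> (\<gamma> \<circ> inv \<pi>)) \<in> H" using coll1[OF asm(1-4)] \<pi>H by (intro comp)
    also have "\<pi> \<circ> (collapse R Q \<circ> (\<gamma> \<circ> inv \<pi>)) = override_on id a R"
    proof
      fix x
      show "(\<pi> \<circ> (collapse R Q \<circ> (\<gamma> \<circ> inv \<pi>))) x = override_on id a R x"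
      proof (cases "x \<in> R")
        case True
        then have "inv \<pi> x = x" using dis permutes_not_in[OF permutes_inv[OF \<pi>(1)]] by blast
        then show ?thesis using True g by (simp add: \<gamma>_def collapse_def)
      next
        case False
        have "inv \<pi> x \<notin> R"
        proof (cases "x \<in> Q")
          case True
          then have "inv \<pi> x \<in> Q" using permutes_in_image[OF permutes_inv[OF \<pi>(1)]] by blast
          then show ?thesis using dis by blast
        next
          case False
          then have "inv \<pi> x = x" using permutes_not_in[OF permutes_inv[OF \<pi>(1)]] by blast
          then show ?thesis using \<open>x \<notin> R\<close> by simp
        qed
        then show ?thesis using False permutes_inverses[OF \<pi>(1)] by (simp add: \<gamma>_def collapse_def)
      qed
    qed
    finally show ?thesis .
  qed

  \<comment> \<open>If \<open>R\<close> is the larger block, its points are first moved inside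
    \<open>R\<close> to where their images will be found. Then \<open>Q\<close> is collapsed into
    \<open>R\<close>, and an exchange moves everything to \<open>Q\<close>, where clamping undoes
    the embedding.\<close>
  have ecoll: "override_on id a R \<in> H"
    if "R \<in> P" "Q \<in> P" "R \<noteq> Q" "a ` R \<subseteq> Q" for R Q a
  proof (cases "card R \<le> card Q")
    case True
    then show ?thesis using ecoll1 that by blast
  next
    case False
    have dis: "y \<notin> Q" if "y \<in> R" for y using that \<open>R \<noteq> Q\<close> \<open>R \<in> P\<close> \<open>Q \<in> P\<close> block_disjoint by blast
    define \<gamma> where "\<gamma> = override_on id (\<lambda>x. cpt R (a x)) R"
    define c where "c = override_on id (cpt R) Q"
    define w where "w = override_on (override_on id (cpt Q) R) (cpt R) Q"
    have "\<gamma> \<in> H" unfolding \<gamma>_def using that cpt_in by (intro inner) auto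
    moreover have "c \<in> H" unfolding c_def using that cpt_in False by (intro ecoll1[of Q R]) auto
    moreover have "w \<in> H" unfolding w_def using that cpt_in False by (intro eswap) auto
    ultimately have "w \<circ> (c \<circ> \<gamma>) \<in> H" by (intro comp)
    also have "w \<circ> (c \<circ> \<gamma>) = override_on id a R"
    proof
      fix x
      consider (a) "x \<in> R" "x \<notin> Q" | (b) "x \<in> Q" "x \<notin> R" | (c) "x \<notin> R" "x \<notin> Q" using dis by blast
      then show "(w \<circ> (c \<circ> \<gamma>)) x = override_on id a R x"
      proof cases
        case a
        have "cpt R (a x) \<in> R" "cpt Q (cpt R (a x)) = a x" using a that False cpt_in cpt_cpt by auto
        then show ?thesis using a dis by (simp add: w_def c_def \<gamma>_def)
      next
        case b
        have "cpt R x \<in> R" "cpt Q (cpt R x) = x" using b that False cpt_in cpt_cpt by auto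
        then show ?thesis using b dis by (simp add: w_def c_def \<gamma>_def)
      next
        case c
        then show ?thesis by (simp add: w_def c_def \<gamma>_def)
      qed
    qed
    finally show ?thesis .
  qed

  have blockfix: "f \<in> H" if "f \<in> T" "\<And>B. B \<in> P \<Longrightarrow> bm f B = B" for f
    using that
  proof (induction "card {B\<in>P. \<exists>x\<in>B. f x \<noteq> x}" arbitrary: f rule: less_induct)
    case less
    show ?case
    proof (cases "\<exists>B\<in>P. \<exists>x\<in>B. f x \<noteq> x")
      case False
      then have "f x = x" for x using less.prems(1) T_outside blk_in in_blk by metis
      then have "f = id" by auto
      then show ?thesis using GH id_G by simp
    next
      case True
      then obtain B x where B: "B \<in> P" "x \<in> B" "f x \<noteq> x" by blast
      define f' where "f' = override_on f id B"
      have f'T: "f' \<in> T" unfolding f'_def using less.prems B by (intro override_T) auto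
      have f'b: "bm f' C = C" if "C \<in> P" for C
        unfolding f'_def using less.prems B that by (subst bm_override[of _ _ B]) auto
      have "{C\<in>P. \<exists>x\<in>C. f' x \<noteq> x} \<subset> {C\<in>P. \<exists>x\<in>C. f x \<noteq> x}"
        using B by (auto simp: f'_def override_on_def)
      then have "card {C\<in>P. \<exists>x\<in>C. f' x \<noteq> x} < card {C\<in>P. \<exists>x\<in>C. f x \<noteq> x}"
        using finP by (intro psubset_card_mono) auto
      then have "f' \<in> H" using less.hyps f'T f'b by blast
      moreover have fB: "f ` B \<subseteq> B" using image_bm[OF less.prems(1) B(1)] less.prems(2)[OF B(1)] by simp
      then have "override_on id f B \<in> H" using inner B by blast
      moreover have "override_on id f B \<circ> f' = f"
      proof
        fix x
        show "(override_on id f B \<circ> f') x = f x"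
        proof (cases "x \<in> B")
          case False
          have "f x \<notin> B"
          proof (cases "x \<in> X")
            case True
            then have "f x \<in> blk x" using T_in_bm[OF less.prems(1) blk_in in_blk] less.prems(2) blk_in by metis
            then show ?thesis using False B True block_disjoint in_blk blk_in by metis
          qed (use T_outside[OF less.prems(1)] False in simp)
          then show ?thesis using False by (simp add: f'_def)
        qed (simp add: f'_def)
      qed
      ultimately show ?thesis using comp by metis
    qed
  qed

  have sizepres: "f \<in> H"
    if f: "f \<in> T" "inj_on (bm f) P" "\<And>B. B \<in> P \<Longrightarrow> card (bm f B) = card B" for f
  proof -
    obtain \<phi> g where g: "lift \<phi> \<in> G" "g \<in> T" "lift \<phi> \<circ> g = f" "\<forall>B\<in>P. bm g B = B"
      by (rule straighten_blocks[OF f])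
    then show ?thesis using comp[OF GH[OF g(1)] blockfix[OF g(2)]] by simp
  qed

  \<comment> \<open>The induction counts the blocks whose image has another size. The largest such
    block \<open>B\<close> is given an image of its own size.\<close>
  have blockbij: "f \<in> H" if "f \<in> T" "inj_on (bm f) P" for f
    using that
  proof (induction "card {B\<in>P. card (bm f B) \<noteq> card B}" arbitrary: f rule: less_induct)
    case less
    note fT = less.prems(1) and finj = less.prems(2)
    have fbij: "bm f ` P = P" using bij_bm[OF fT finj] by (simp add: bij_betw_def)
    let ?N = "{B\<in>P. card (bm f B) \<noteq> card B}"
    show ?case
    proof (cases "?N = {}")
      case True
      then show ?thesis using sizepres less.prems by blast
    next
      case False
      have fN: "finite ?N" using finP by simp
      obtain B where B: "B \<in> ?N" and Bmax: "\<And>C. C \<in> ?N \<Longrightarrow> card C \<le> card B"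
        using finite_obtain_max[OF fN False, of card] by blast
      have BP: "B \<in> P" using B by simp
      define R where "R = bm f B"
      have RP: "R \<in> P" using bm_in fT BP by (simp add: R_def)
      \<comment> \<open>Blocks larger than \<open>B\<close> keep their size under
        \<open>bm f\<close>, so they are permuted among themselves and leave no room for the image
        of \<open>B\<close>.\<close>
      have RB: "card R < card B"
      proof (rule ccontr)
        assume "\<not> card R < card B"
        then have big: "card R > card B" using B by (simp add: R_def)
        let ?Big = "{C\<in>P. card C > card B}"
        have "card (bm f C) = card C" if "C \<in> ?Big" for C using Bmax that by force
        then have "bm f ` ?Big \<subseteq> ?Big" using bm_in fT by auto
        moreover have "inj_on (bm f) ?Big" using finj by (auto intro: inj_on_subset)
        ultimately have "bm f ` ?Big = ?Big" using finP by (intro endo_inj_surj) auto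
        moreover have "R \<in> ?Big" using big RP by simp
        ultimately obtain C where "C \<in> ?Big" "bm f C = bm f B" unfolding R_def by (metis (no_types, lifting) imageE)
        then show False using finj BP by (auto dest: inj_onD)
      qed
      \<comment> \<open>\<open>B\<close> leaves the blocks of its size, and \<open>bm f\<close> is
        onto, so some block of another size has to fill the vacancy.\<close>
      have "\<exists>A\<in>P. card A \<noteq> card B \<and> card (bm f A) = card B"
      proof (rule ccontr)
        assume *: "\<not> ?thesis"
        let ?S = "{C\<in>P. card C = card B}"
        have "?S \<subseteq> bm f ` ?S"
        proof
          fix D assume D: "D \<in> ?S"
          then obtain C where "C \<in> P" "D = bm f C" using fbij by blast
          then show "D \<in> bm f ` ?S" using * D by auto
        qed
        moreover have "card (bm f ` ?S) \<le> card ?S" using finP by (intro card_image_le) auto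
        ultimately have "bm f ` ?S = ?S" using finP by (intro card_seteq[symmetric]) auto
        moreover have "R \<in> bm f ` ?S" using BP by (auto simp: R_def)
        ultimately show False using RB by auto
      qed
      then obtain A where A: "A \<in> P" "card A \<noteq> card B" "card (bm f A) = card B" by blast
      define Q where "Q = bm f A"
      have QP: "Q \<in> P" "card Q = card B" using bm_in fT A by (auto simp: Q_def)
      have AN: "A \<in> ?N" using A by simp
      have AB: "card A < card B" using Bmax[OF AN] A by simp
      have ne: "A \<noteq> B" "R \<noteq> Q" using AB RB QP by auto
      have other: "bm f C \<noteq> R" "bm f C \<noteq> Q" if "C \<in> P" "C \<noteq> A" "C \<noteq> B" for C
        using that finj A BP by (auto simp: R_def Q_def dest: inj_onD)
      have disAB: "y \<notin> B" if "y \<in> A" for y using that ne A BP block_disjoint by blast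
      have disRQ: "y \<notin> Q" if "y \<in> R" for y using that ne RP QP block_disjoint by blast
      have fA: "f x \<in> Q" if "x \<in> A" for x using T_in_bm[OF fT A(1) that] by (simp add: Q_def)
      have fB: "f x \<in> R" if "x \<in> B" for x using T_in_bm[OF fT BP that] by (simp add: R_def)
      have fC: "f x \<notin> R" "f x \<notin> Q" "f x \<notin> R \<union> Q" if "x \<notin> A" "x \<notin> B" for x
      proof -
        show "f x \<notin> R \<union> Q"
        proof (cases "x \<in> X")
          case True
          then have "blk x \<noteq> A" "blk x \<noteq> B" using that in_blk by auto
          then have "bm f (blk x) \<noteq> R" "bm f (blk x) \<noteq> Q" using other blk_in True by auto
          moreover have "f x \<in> bm f (blk x)" using T_in_bm[OF fT blk_in in_blk] True by blast
          ultimately show ?thesis using block_disjoint[OF bm_in[OF fT blk_in[OF True]]] RP QP by blast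
        next
          case False
          then show ?thesis using T_outside[OF fT] RP QP block_subset by (metis Un_iff subsetD)
        qed
        then show "f x \<notin> R" "f x \<notin> Q" by auto
      qed
      have fin: "f' \<in> H" if f': "f' \<in> T" "bm f' A = R" "bm f' B = Q"
        "\<And>C. C \<in> P \<Longrightarrow> C \<noteq> A \<Longrightarrow> C \<noteq> B \<Longrightarrow> bm f' C = bm f C" for f'
      proof (rule less.hyps[OF _ f'(1)])
        \<comment> \<open>\<open>B\<close> leaves the exceptional set, and \<open>A\<close> was
          already in it, so the new size of its image does not matter.\<close>
        have "{C\<in>P. card (bm f' C) \<noteq> card C} \<subseteq> ?N - {B}"
        proof
          fix C assume C: "C \<in> {C\<in>P. card (bm f' C) \<noteq> card C}"
          then have "C \<noteq> B" using f'(3) QP by auto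
          then show "C \<in> ?N - {B}" using C f'(4)[of C] AN by (cases "C = A") auto
        qed
        moreover have "B \<in> ?N" by (fact B)
        ultimately have "{C\<in>P. card (bm f' C) \<noteq> card C} \<subset> ?N" by blast
        then show "card {C\<in>P. card (bm f' C) \<noteq> card C} < card ?N" using fN by (rule psubset_card_mono[rotated])
        show "inj_on (bm f') P"
        proof (rule inj_onI)
          fix C D assume CD: "C \<in> P" "D \<in> P" "bm f' C = bm f' D"
          then show "C = D"
            using f' other ne finj by (metis inj_onD)
        qed
      qed
      have cR: "cpt R ` A \<subseteq> R" using RP cpt_in by blast
      show ?thesis
      proof (cases "card A \<le> card R")
        case True
        \<comment> \<open>Send \<open>B\<close> to \<open>Q\<close> instead of \<open>R\<close>, and \<open>A\<close> to \<open>R\<close>, then exchange \<open>R\<close> and \<open>Q\<close>.\<close>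
        define f1 where "f1 = override_on f (cpt R) A"
        define f' where "f' = override_on f1 (\<lambda>x. cpt Q (f x)) B"
        have f1: "f1 \<in> T" "\<And>C. C \<in> P \<Longrightarrow> bm f1 C = (if C = A then R else bm f C)"
          unfolding f1_def using override_T[OF fT A(1) RP cR] bm_override[OF fT A(1) RP cR] by blast+
        have jQ: "(\<lambda>x. cpt Q (f x)) ` B \<subseteq> Q" using QP(1) cpt_in by blast
        have "f' \<in> T" "\<And>C. C \<in> P \<Longrightarrow> bm f' C = (if C = B then Q else bm f1 C)"
          unfolding f'_def
          using override_T[OF f1(1) BP QP(1) jQ] bm_override[OF f1(1) BP QP(1) jQ] by blast+
        then have "f' \<in> H" using ne f1 A BP by (intro fin) auto
        define k where "k = override_on (override_on id (cpt R) Q) (\<lambda>r. f (cpt A r)) R"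
        have "k \<in> H" unfolding k_def using RP QP ne RB A cpt_in fA by (intro eswap) auto
        moreover have "k \<circ> f' = f"
        proof
          fix x
          consider (a) "x \<in> A" "x \<notin> B" | (b) "x \<in> B" | (c) "x \<notin> A" "x \<notin> B" using disAB by blast
          then show "(k \<circ> f') x = f x"
          proof cases
            case a
            have "cpt R x \<in> R" "cpt A (cpt R x) = x" using a True A RP cpt_in cpt_cpt by auto
            then show ?thesis using a by (simp add: k_def f'_def f1_def)
          next
            case b
            have "cpt Q (f x) \<in> Q" "cpt R (cpt Q (f x)) = f x"
              using b fB RP QP RB cpt_in cpt_cpt by auto
            moreover have "cpt Q (f x) \<notin> R" using calculation disRQ by blast
            ultimately show ?thesis using b by (simp add: k_def f'_def)
          next
            case c
            then show ?thesis using fC by (simp add: k_def f'_def f1_def)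
          qed
        qed
        ultimately show ?thesis using comp \<open>f' \<in> H\<close> by metis
      next
        case False
        \<comment> \<open>Now \<open>R\<close> is too small to hold \<open>A\<close>: exchange \<open>A\<close> and \<open>B\<close> first.\<close>
        define f1 where "f1 = override_on f (cpt R) A"
        define f' where "f' = override_on f1 (\<lambda>x. f (cpt A x)) B"
        have f1: "f1 \<in> T" "\<And>C. C \<in> P \<Longrightarrow> bm f1 C = (if C = A then R else bm f C)"
          unfolding f1_def using override_T[OF fT A(1) RP cR] bm_override[OF fT A(1) RP cR] by blast+
        have jQ: "(\<lambda>x. f (cpt A x)) ` B \<subseteq> Q" using cpt_in[OF A(1)] fA by blast
        have "f' \<in> T" "\<And>C. C \<in> P \<Longrightarrow> bm f' C = (if C = B then Q else bm f1 C)"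
          unfolding f'_def
          using override_T[OF f1(1) BP QP(1) jQ] bm_override[OF f1(1) BP QP(1) jQ] by blast+
        then have "f' \<in> H" using ne f1 A BP by (intro fin) auto
        define k where "k = override_on (override_on id (\<lambda>x. cpt A (f x)) B) (cpt B) A"
        have "k \<in> H" unfolding k_def using A BP ne AB cpt_in fA by (intro eswap) auto
        moreover have "f' \<circ> k = f"
        proof
          fix x
          consider (a) "x \<in> A" "x \<notin> B" | (b) "x \<in> B" "x \<notin> A" | (c) "x \<notin> A" "x \<notin> B" using disAB by blast
          then show "(f' \<circ> k) x = f x"
          proof cases
            case a
            have "cpt B x \<in> B" "cpt A (cpt B x) = x" using a AB A BP cpt_in cpt_cpt by auto
            then show ?thesis using a by (simp add: k_def f'_def)
          next
            case b
            have "cpt A (f x) \<in> A" "cpt R (cpt A (f x)) = f x"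
              using b fB RP A False cpt_in cpt_cpt by auto
            moreover have "cpt A (f x) \<notin> B" using calculation disAB by blast
            ultimately show ?thesis using b by (simp add: k_def f'_def f1_def)
          next
            case c
            then show ?thesis by (simp add: k_def f'_def f1_def)
          qed
        qed
        ultimately show ?thesis using comp \<open>f' \<in> H\<close> by metis
      qed
    qed
  qed

  have "f \<in> H" if "f \<in> T" for f
    using that
  \<comment> \<open>Every weight is positive and decreases with the size of the block. The measure
    drops both when a missing block gets hit and when it is traded for a larger missing one.\<close>
  proof (induction "\<Sum>R\<in>P - bm f ` P. Suc (card X) - card R" arbitrary: f rule: less_induct)
    case less
    note fT = less.prems
    let ?M = "P - bm f ` P"
    have fM: "finite ?M" using finP by simp
    show ?case
    proof (cases "inj_on (bm f) P")
      case True
      then show ?thesis using blockbij fT by blast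
    next
      case False
      have "?M \<noteq> {}"
      proof
        assume "?M = {}"
        then have "bm f ` P = P" using bm_in fT by blast
        then show False using False finP by (simp add: finite_surj_inj)
      qed
      then obtain R where R: "R \<in> ?M" and Rmax: "\<And>C. C \<in> ?M \<Longrightarrow> card C \<le> card R"
        using finite_obtain_max[OF fM, of card] by blast
      have RP: "R \<in> P" using R by simp
      have cX: "card C \<le> card X" if "C \<in> P" for C using that block_subset finX by (simp add: card_mono)
      have fR: "f x \<notin> R" for x
      proof (cases "x \<in> X")
        case True
        then show ?thesis using R RP bm_eqI[OF fT blk_in RP in_blk] blk_in by blast
      next
        case False
        then show ?thesis using T_outside[OF fT] RP block_subset by (metis subsetD)
      qed
      have step: "\<exists>f' a. f' \<in> T \<and> (\<forall>C\<in>P. bm f' C = (if C = A then R else bm f C)) \<and>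
          (\<forall>x. x \<notin> A \<longrightarrow> f' x = f x) \<and> a ` R \<subseteq> bm f A \<and> (\<forall>x\<in>A. f' x \<in> R \<and> a (f' x) = f x)"
        if A: "A \<in> P" "card (f ` A) \<le> card R" for A
      proof -
        have "finite (f ` A)" "finite R" using A RP block_finite by auto
        from card_le_inj[OF this A(2)] obtain h where h: "h ` (f ` A) \<subseteq> R" "inj_on h (f ` A)" by auto
        obtain q where q: "q \<in> bm f A" using block_nonempty[OF bm_in[OF fT A(1)]] by auto
        \<comment> \<open>A left inverse of \<open>h\<close> on the image of \<open>A\<close>. The
          default \<open>q\<close> only ensures that all of \<open>R\<close> is sent into the single
          block \<open>bm f A\<close>.\<close>
        define a where "a r = (if r \<in> h ` f ` A then inv_into (f ` A) h r else q)" for r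
        define f' where "f' = override_on f (\<lambda>x. h (f x)) A"
        have "a ` R \<subseteq> bm f A"
          using q image_bm[OF fT A(1)] inv_into_into[of _ h "f ` A"] by (auto simp: a_def)
        moreover have "a (f' x) = f x" "f' x \<in> R" if "x \<in> A" for x
          using that h by (auto simp: a_def f'_def inv_into_f_f)
        moreover have jR: "(\<lambda>x. h (f x)) ` A \<subseteq> R" using h by auto
        have "f' \<in> T" unfolding f'_def using fT A(1) RP jR by (rule override_T)
        moreover have "bm f' C = (if C = A then R else bm f C)" if "C \<in> P" for C
          unfolding f'_def using fT A(1) RP jR that by (rule bm_override)
        ultimately show ?thesis by (intro exI[of _ f'] exI[of _ a]) (auto simp: f'_def)
      qed
      \<comment> \<open>In cases 1 and 2 redirect \<open>A\<close> to the missing block \<open>R\<close> and repair this afterwards.\<close>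
      consider (1) A A' where "A \<in> P" "A' \<in> P" "A \<noteq> A'" "bm f A = bm f A'" "card (f ` A) \<le> card R"
        | (2) A where "A \<in> P" "card (f ` A) \<le> card R" "card R < card (bm f A)"
            "\<And>A'. A' \<in> P \<Longrightarrow> A' \<noteq> A \<Longrightarrow> bm f A' \<noteq> bm f A"
        | (3) "\<And>A A'. A \<in> P \<Longrightarrow> A' \<in> P \<Longrightarrow> A \<noteq> A' \<Longrightarrow> bm f A = bm f A' \<Longrightarrow> card R < card (f ` A)"
            "\<And>A. A \<in> P \<Longrightarrow> card R < card (bm f A) \<Longrightarrow> card R < card (f ` A)"
        by (metis not_le)
      then show ?thesis
      proof cases
        case 1
        obtain f' a where f': "f' \<in> T" "\<And>C. C \<in> P \<Longrightarrow> bm f' C = (if C = A then R else bm f C)"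
          "\<And>x. x \<notin> A \<Longrightarrow> f' x = f x" "a ` R \<subseteq> bm f A" "\<And>x. x \<in> A \<Longrightarrow> f' x \<in> R \<and> a (f' x) = f x"
          using step[OF 1(1,5)] by metis
        have "bm f' ` P = insert R (bm f ` P)"
        proof -
          have "bm f ` P = bm f ` (P - {A})" using 1 by blast
          moreover have "bm f' ` (P - {A}) = bm f ` (P - {A})" using f'(2) by auto
          moreover have "bm f' ` P = insert (bm f' A) (bm f' ` (P - {A}))" using 1 by blast
          ultimately show ?thesis using f'(2) 1 by simp
        qed
        then have "P - bm f' ` P = ?M - {R}" by auto
        then have "(\<Sum>C\<in>P - bm f' ` P. Suc (card X) - card C) < (\<Sum>C\<in>?M. Suc (card X) - card C)"
          using cX[OF RP] sum.remove[OF fM R, of "\<lambda>C. Suc (card X) - card C"] by simp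
        then have "f' \<in> H" using less.hyps f'(1) by blast
        moreover have "bm f A \<noteq> R" using R 1 by blast
        then have "override_on id a R \<in> H"
          using ecoll[OF RP bm_in[OF fT 1(1)] _ f'(4)] by blast
        moreover have "override_on id a R \<circ> f' = f"
        proof
          fix x show "(override_on id a R \<circ> f') x = f x"
            using f' fR by (cases "x \<in> A") auto
        qed
        ultimately show ?thesis using comp by metis
      next
        case 2
        obtain f' a where f': "f' \<in> T" "\<And>C. C \<in> P \<Longrightarrow> bm f' C = (if C = A then R else bm f C)"
          "\<And>x. x \<notin> A \<Longrightarrow> f' x = f x" "a ` R \<subseteq> bm f A" "\<And>x. x \<in> A \<Longrightarrow> f' x \<in> R \<and> a (f' x) = f x"
          using step[OF 2(1,2)] by metis
        define Q where "Q = bm f A"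
        have QP: "Q \<in> P" "Q \<noteq> R" "card R < card Q" "Q \<in> bm f ` P" using bm_in fT 2 R by (auto simp: Q_def)
        have "bm f' ` P = insert R (bm f ` P - {Q})"
        proof -
          have "bm f ` P - {Q} = bm f ` (P - {A})" using 2 by (auto simp: Q_def)
          moreover have "bm f' ` (P - {A}) = bm f ` (P - {A})" using f'(2) by auto
          moreover have "bm f' ` P = insert (bm f' A) (bm f' ` (P - {A}))" using 2 by blast
          ultimately show ?thesis using f'(2) 2 by simp
        qed
        then have M': "P - bm f' ` P = insert Q (?M - {R})" using QP by auto
        have "(\<Sum>C\<in>P - bm f' ` P. Suc (card X) - card C) =
            (Suc (card X) - card Q) + (\<Sum>C\<in>?M - {R}. Suc (card X) - card C)"
          unfolding M' using fM QP by (intro sum.insert) auto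
        also have "\<dots> < (Suc (card X) - card R) + (\<Sum>C\<in>?M - {R}. Suc (card X) - card C)"
          using QP cX[OF RP] cX[OF QP(1)] by simp
        also have "\<dots> = (\<Sum>C\<in>?M. Suc (card X) - card C)"
          using sum.remove[OF fM R, of "\<lambda>C. Suc (card X) - card C"] by simp
        finally have "f' \<in> H" using less.hyps f'(1) by blast
        moreover have "override_on (override_on id (cpt R) Q) a R \<in> H"
          using RP QP f'(4) cpt_in by (intro eswap) (auto simp: Q_def)
        moreover have "override_on (override_on id (cpt R) Q) a R \<circ> f' = f"
        proof
          fix x show "(override_on (override_on id (cpt R) Q) a R \<circ> f') x = f x"
          proof (cases "x \<in> A")
            case False
            have "f x \<notin> Q"
            proof (cases "x \<in> X")
              case True
              then have "blk x \<in> P" "blk x \<noteq> A" "x \<in> blk x" using blk_in in_blk False by auto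
              then show ?thesis using 2(4) bm_eqI[OF fT _ QP(1)] unfolding Q_def by blast
            next
              case False
              then show ?thesis using T_outside[OF fT] QP block_subset by (metis subsetD)
            qed
            then show ?thesis using f' fR False by auto
          qed (use f' in auto)
        qed
        ultimately show ?thesis using comp by metis
      next
        case 3
        \<comment> \<open>Then \<open>bm f\<close> permutes the blocks larger than \<open>R\<close>, so a collision involves only small blocks.\<close>
        let ?Big = "{C\<in>P. card R < card C}" and ?Pre = "{A\<in>P. card R < card (bm f A)}"
        have fl: "card (f ` A) \<le> card A" if "A \<in> P" for A using that block_finite by (simp add: card_image_le)
        have 1: "?Pre \<subseteq> ?Big" using 3(2) fl by force
        have 2: "bm f ` ?Pre = ?Big"
        proof
          show "bm f ` ?Pre \<subseteq> ?Big" using bm_in fT by auto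
          show "?Big \<subseteq> bm f ` ?Pre"
          proof
            fix C assume C: "C \<in> ?Big"
            then have "C \<notin> ?M" using Rmax by force
            then show "C \<in> bm f ` ?Pre" using C by auto
          qed
        qed
        have fin: "finite ?Pre" "finite ?Big" using finP by auto
        \<comment> \<open>\<open>?Pre\<close> lies in \<open>?Big\<close> and is mapped onto it. By
          counting the two sets agree and the map is injective there, yet it would identify the two
          colliding blocks.\<close>
        have "card ?Big \<le> card ?Pre" using card_image_le[OF fin(1), of "bm f"] 2 by simp
        then have eq: "?Pre = ?Big" by (rule card_seteq[OF fin(2) 1])
        have inj: "inj_on (bm f) ?Big" using 2 fin(2) unfolding eq by (intro eq_card_imp_inj_on) simp_all
        obtain A A' where A: "A \<in> P" "A' \<in> P" "A \<noteq> A'" "bm f A = bm f A'"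
          using False by (auto simp: inj_on_def)
        then have "card R < card A" "card R < card A'"
          using 3(1)[OF A] 3(1)[OF A(2,1) A(3,4)[symmetric]] fl[OF A(1)] fl[OF A(2)] by linarith+
        then show ?thesis using A inj by (auto dest: inj_onD)
      qed
    qed
  qed
  then show ?thesis by blast
qed

end

section \<open>Unavoidable non-units\<close>

lemma card_le_of_disjoint_hits:
  assumes "finite V" "\<And>i. i \<in> I \<Longrightarrow> \<exists>v\<in>V. v \<in> F i"
    and "\<And>v i j. i \<in> I \<Longrightarrow> j \<in> I \<Longrightarrow> v \<in> F i \<Longrightarrow> v \<in> F j \<Longrightarrow> i = j"
  shows "card I \<le> card V"
proof -
  obtain w where w: "\<And>i. i \<in> I \<Longrightarrow> w i \<in> V \<and> w i \<in> F i" using assms(2) by metis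
  then have "inj_on w I" using assms(3) by (metis inj_onI)
  moreover have "w ` I \<subseteq> V" using w by blast
  ultimately show ?thesis using assms(1) by (rule card_inj_on_le)
qed

lemma sgen_meets_prime:
  assumes "sgen U = S" "comp_closed S" "A \<subseteq> S" "A \<noteq> {}"
    and prime: "\<And>f g. f \<in> S \<Longrightarrow> g \<in> S \<Longrightarrow> g \<circ> f \<in> A \<Longrightarrow> f \<in> A \<or> g \<in> A"
  shows "\<exists>u\<in>U. u \<in> A"
proof (rule ccontr)
  assume "\<not> ?thesis"
  moreover have "U \<subseteq> S" using assms(1) sgen.base by blast
  moreover have "comp_closed (S - A)"
    unfolding comp_closed_def using prime assms(2) comp_closedD by blast
  ultimately have "sgen U \<subseteq> S - A" by (intro sgen_least) auto
  then show False using assms by blast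
qed

context partitioned
begin

section \<open>Sizes and types of unavoidable non-units\<close>

definition sizes :: "nat set" where
  "sizes = card ` P"

definition multi :: "nat set" where
  "multi = {s. card {B\<in>P. card B = s} \<ge> 2}"

text \<open>Ordering the two sizes counts each unordered pair once; a diagonal pair needs two
  distinct blocks to merge.\<close>

definition size_pairs :: "(nat \<times> nat) set" where
  "size_pairs = {(s, s'). s \<in> sizes \<and> s' \<in> sizes \<and> s < s'} \<union> (\<lambda>s. (s, s)) ` multi"

text \<open>An exchange of consecutive sizes is indexed by the larger of the two.\<close>

definition nonmin_sizes :: "nat set" where
  "nonmin_sizes = {s \<in> sizes. \<exists>s0\<in>sizes. s0 < s}"

definition gap_sizes :: "nat set" where
  "gap_sizes = {s. s \<ge> 2 \<and> s \<in> sizes \<and> s - 1 \<notin> sizes}"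

text \<open>The three kinds of non-units that every generating set of \<open>T\<close> must meet.\<close>

definition coll_type :: "nat \<times> nat \<Rightarrow> ('a \<Rightarrow> 'a) set" where
  "coll_type = (\<lambda>(s, s'). {f \<in> T. (\<forall>B\<in>P. inj_on f B) \<and>
     (\<exists>B\<in>P. \<exists>C\<in>P. B \<noteq> C \<and> card B = s \<and> card C = s' \<and> bm f B = bm f C \<and>
        (\<forall>D\<in>P. \<forall>E\<in>P. bm f D = bm f E \<longrightarrow> D = E \<or> {D, E} = {B, C}))})"

text \<open>The bound on the image of \<open>B\<close> expresses minimal loss: as many points
  survive as the next smaller size can hold. \<open>B\<close> is the one block where injectivity may
  fail, and by \<open>swap_shrinks\<close> it does fail there.\<close>

definition swap_type :: "nat \<Rightarrow> ('a \<Rightarrow> 'a) set" where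
  "swap_type s = {f \<in> T. inj_on (bm f) P \<and> (\<exists>B\<in>P. card (bm f B) \<noteq> card B) \<and>
     (\<exists>B\<in>P. card B = s \<and> (\<forall>C\<in>P. C \<noteq> B \<longrightarrow> inj_on f C) \<and> (\<forall>s0\<in>sizes. s0 < s \<longrightarrow> s0 \<le> card (f ` B)))}"

definition drop_type :: "nat \<Rightarrow> ('a \<Rightarrow> 'a) set" where
  "drop_type s = {f \<in> T. inj_on (bm f) P \<and>
     (\<exists>B\<in>P. card B = s \<and> (\<forall>C\<in>P. C \<noteq> B \<longrightarrow> inj_on f C) \<and> card (f ` B) = s - 1)}"

lemma coll_typeE:
  assumes "f \<in> coll_type (s, s')"
  obtains B C where "f \<in> T" "\<forall>B\<in>P. inj_on f B" "B \<in> P" "C \<in> P" "B \<noteq> C" "card B = s" "card C = s'"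
    "bm f B = bm f C" "\<forall>D\<in>P. \<forall>E\<in>P. bm f D = bm f E \<longrightarrow> D = E \<or> {D, E} = {B, C}"
  using assms unfolding coll_type_def prod.case mem_Collect_eq by (elim conjE bexE) (rule that)

lemma swap_typeE:
  assumes "f \<in> swap_type s"
  obtains B where "f \<in> T" "inj_on (bm f) P" "\<exists>C\<in>P. card (bm f C) \<noteq> card C" "B \<in> P" "card B = s"
    "\<forall>C\<in>P. C \<noteq> B \<longrightarrow> inj_on f C" "\<forall>s0\<in>sizes. s0 < s \<longrightarrow> s0 \<le> card (f ` B)"
  using assms unfolding swap_type_def mem_Collect_eq by (elim conjE bexE[of P "\<lambda>B. card B = s \<and> _ B"]) (rule that)

lemma drop_typeE:
  assumes "f \<in> drop_type s"
  obtains B where "f \<in> T" "inj_on (bm f) P" "B \<in> P" "card B = s"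
    "\<forall>C\<in>P. C \<noteq> B \<longrightarrow> inj_on f C" "card (f ` B) = s - 1"
  using assms unfolding drop_type_def mem_Collect_eq by (elim conjE bexE) (rule that)

lemma coll_typeI:
  assumes "f \<in> T" "\<And>D. D \<in> P \<Longrightarrow> inj_on f D" "B \<in> P" "C \<in> P" "B \<noteq> C" "card B = s" "card C = s'"
    "bm f B = bm f C" "\<And>D E. D \<in> P \<Longrightarrow> E \<in> P \<Longrightarrow> bm f D = bm f E \<Longrightarrow> D = E \<or> {D, E} = {B, C}"
  shows "f \<in> coll_type (s, s')"
  unfolding coll_type_def prod.case mem_Collect_eq
  by (rule conjI, fact, rule conjI, rule ballI, erule assms(2), rule bexI[of _ B], rule bexI[of _ C],
      (intro conjI ballI impI assms; assumption), fact, fact)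

lemma swap_typeI:
  assumes "f \<in> T" "inj_on (bm f) P" "B0 \<in> P" "card (bm f B0) \<noteq> card B0" "B \<in> P" "card B = s"
    "\<And>C. C \<in> P \<Longrightarrow> C \<noteq> B \<Longrightarrow> inj_on f C"
    "\<And>s0. s0 \<in> sizes \<Longrightarrow> s0 < s \<Longrightarrow> s0 \<le> card (f ` B)"
  shows "f \<in> swap_type s"
  unfolding swap_type_def mem_Collect_eq
  by (rule conjI, fact, rule conjI, fact, rule conjI, rule bexI[of _ B0], fact, fact, rule bexI[of _ B],
      (intro conjI ballI impI assms; assumption), fact)

lemma drop_typeI:
  assumes "f \<in> T" "inj_on (bm f) P" "B \<in> P" "card B = s"
    "\<And>C. C \<in> P \<Longrightarrow> C \<noteq> B \<Longrightarrow> inj_on f C" "card (f ` B) = s - 1"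
  shows "f \<in> drop_type s"
  unfolding drop_type_def mem_Collect_eq
  by (rule conjI, fact, rule conjI, fact, rule bexI[of _ B],
      (intro conjI ballI impI assms; assumption), fact)

section \<open>Closure of the complements under composition\<close>

lemma unit_preimage:
  assumes "f \<in> G" "D \<in> P"
  obtains E where "E \<in> P" "bm f E = D" "f ` E = D" "card E = card D"
  using unit_bij_bm[OF assms(1)] assms unit_image unit_card_bm
  by (metis bij_betw_imp_surj_on imageE)

lemma inj_on_unit_comp:
  assumes "inj_on (g \<circ> f) E" "f ` E = D" shows "inj_on g D"
  using assms inj_on_imageI by blast

text \<open>If \<open>f\<close> merges blocks at all, it merges exactly \<open>B\<close> and
  \<open>C\<close>. Otherwise it is a unit, and transport along it turns the merging done by the
  composite into one done by \<open>g\<close>, with the same sizes.\<close>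

lemma coll_type_prime:
  assumes "f \<in> T" "g \<in> T" "g \<circ> f \<in> coll_type p"
  shows "f \<in> coll_type p \<or> g \<in> coll_type p"
proof -
  obtain s s' where p: "p = (s, s')" by (cases p)
  obtain B C where inj0: "\<forall>D\<in>P. inj_on (g \<circ> f) D"
    and BC: "B \<in> P" "C \<in> P" "B \<noteq> C" "card B = s" "card C = s'" "bm (g \<circ> f) B = bm (g \<circ> f) C"
    and only0: "\<forall>D\<in>P. \<forall>E\<in>P. bm (g \<circ> f) D = bm (g \<circ> f) E \<longrightarrow> D = E \<or> {D, E} = {B, C}"
    using assms(3) unfolding p by (rule coll_typeE)
  note inj = bspec[OF inj0] and only = only0[rule_format]
  have finj: "inj_on f D" if "D \<in> P" for D using inj[OF that] by (rule inj_on_imageI2)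
  have only_f: "D = E \<or> {D, E} = {B, C}" if "D \<in> P" "E \<in> P" "bm f D = bm f E" for D E
    using only that bm_comp[OF assms(1,2)] by simp
  show ?thesis
  proof (cases "bm f B = bm f C")
    case True
    then have "f \<in> coll_type p" unfolding p
      using coll_typeI[OF assms(1) finj BC(1-5) _ only_f] by blast
    then show ?thesis ..
  next
    case False
    have "inj_on (bm f) P"
    proof (rule inj_onI)
      fix D E assume "D \<in> P" "E \<in> P" "bm f D = bm f E"
      then show "D = E" using only_f[of D E] False by (auto simp: doubleton_eq_iff)
    qed
    then have fG: "f \<in> G" using unitI assms finj by blast
    have ginj: "inj_on g D" if D: "D \<in> P" for D
    proof -
      obtain E where "E \<in> P" "f ` E = D" using unit_preimage[OF fG D] by metis
      then show ?thesis using inj inj_on_unit_comp by blast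
    qed
    have g_only: "D = E \<or> {D, E} = {bm f B, bm f C}" if DE: "D \<in> P" "E \<in> P" "bm g D = bm g E" for D E
    proof -
      obtain D' where D': "D' \<in> P" "bm f D' = D" using unit_preimage[OF fG DE(1)] by metis
      obtain E' where E': "E' \<in> P" "bm f E' = E" using unit_preimage[OF fG DE(2)] by metis
      have "bm (g \<circ> f) D' = bm (g \<circ> f) E'" using D' E' DE bm_comp[OF assms(1,2)] by simp
      then show ?thesis using only[OF D'(1) E'(1)] D'(2) E'(2) by (auto simp: doubleton_eq_iff)
    qed
    have bC: "bm f B \<in> P" "bm f C \<in> P" "bm g (bm f B) = bm g (bm f C)"
        "card (bm f B) = s" "card (bm f C) = s'"
      using BC bm_in[OF assms(1)] bm_comp[OF assms(1,2)] unit_card_bm[OF fG] by auto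
    have "g \<in> coll_type p" unfolding p
      by (rule coll_typeI[OF assms(2) ginj bC(1,2) False bC(4,5,3) g_only])
    then show ?thesis ..
  qed
qed

lemma bm_comp_inj:
  assumes "f \<in> T" "g \<in> T" "inj_on (bm (g \<circ> f)) P"
  shows "inj_on (bm f) P" "inj_on (bm g) P" "bij_betw (bm f) P P"
proof -
  have inj: "inj_on (bm g \<circ> bm f) P"
    using assms(3) bm_comp[OF assms(1,2)] by (auto simp: inj_on_def)
  then show f: "inj_on (bm f) P" by (rule inj_on_imageI2)
  then show b: "bij_betw (bm f) P P" using bij_bm assms by blast
  show "inj_on (bm g) P" using inj_on_imageI[OF inj] b by (simp add: bij_betw_def)
qed

text \<open>If \<open>f\<close> changes the size of some block, it inherits the type, as its image
  of \<open>B\<close> is at least as large as that of the composite. Otherwise it preserves sizes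
  and maps every block except possibly \<open>B\<close> bijectively, so \<open>g\<close> inherits
  the type at \<open>bm f B\<close>. Note that \<open>f\<close> need not be a unit then.\<close>

lemma swap_type_prime:
  assumes "f \<in> T" "g \<in> T" "g \<circ> f \<in> swap_type s"
  shows "f \<in> swap_type s \<or> g \<in> swap_type s"
proof -
  obtain B where inj: "inj_on (bm (g \<circ> f)) P" and B0_ex: "\<exists>C\<in>P. card (bm (g \<circ> f) C) \<noteq> card C"
    and B_all: "B \<in> P" "card B = s" "\<forall>C\<in>P. C \<noteq> B \<longrightarrow> inj_on (g \<circ> f) C"
      "\<forall>s0\<in>sizes. s0 < s \<longrightarrow> s0 \<le> card ((g \<circ> f) ` B)"
    using assms(3) by (rule swap_typeE)
  note B = B_all[rule_format]
  obtain B0 where B0: "B0 \<in> P" "card (bm (g \<circ> f) B0) \<noteq> card B0" using B0_ex by blast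
  note bij = bm_comp_inj[OF assms(1,2) inj]
  have finj: "inj_on f C" if "C \<in> P" "C \<noteq> B" for C using B(3)[OF that] by (rule inj_on_imageI2)
  have fin: "finite (f ` B)" "finite (g ` bm f B)" using block_finite B bm_in assms by auto
  have c1: "card ((g \<circ> f) ` B) \<le> card (f ` B)"
    using fin by (metis card_image_le image_comp)
  have c2: "card ((g \<circ> f) ` B) \<le> card (g ` bm f B)"
    using fin image_bm[OF assms(1) B(1)] by (metis card_mono image_comp image_mono)
  show ?thesis
  proof (cases "\<exists>C\<in>P. card (bm f C) \<noteq> card C")
    case True
    have "s0 \<le> card (f ` B)" if "s0 \<in> sizes" "s0 < s" for s0
      using B(4)[OF that] c1 by simp
    then have "f \<in> swap_type s" using True swap_typeI[OF assms(1) bij(1) _ _ B(1,2) finj] by blast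
    then show ?thesis ..
  next
    case False
    then have pres: "\<And>C. C \<in> P \<Longrightarrow> card (bm f C) = card C" by blast
    have g0: "bm f B0 \<in> P" "card (bm g (bm f B0)) \<noteq> card (bm f B0)"
      using B0 pres bm_comp[OF assms(1,2)] bm_in[OF assms(1)] by auto
    have ginj: "inj_on g C" if C: "C \<in> P" "C \<noteq> bm f B" for C
    proof -
      obtain E where E: "E \<in> P" "bm f E = C" using C bij(3) by (metis bij_betw_imp_surj_on imageE)
      then have EB: "E \<noteq> B" using C by blast
      have "f ` E = C" using image_bm[OF assms(1) E(1)] pres[OF E(1)] E block_finite C
        by (metis card_image card_subset_eq finj[OF E(1) EB])
      then show ?thesis using B(3)[OF E(1) EB] inj_on_unit_comp by blast
    qed
    have le: "s0 \<le> card (g ` bm f B)" if "s0 \<in> sizes" "s0 < s" for s0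
      using B(4)[OF that] c2 by simp
    have gB: "bm f B \<in> P" "card (bm f B) = s" using B pres bm_in assms by auto
    have "g \<in> swap_type s" by (rule swap_typeI[OF assms(2) bij(2) g0 gB ginj le])
    then show ?thesis ..
  qed
qed

text \<open>Only one point is lost on \<open>B\<close>, hence it is lost entirely in one factor:
  either \<open>f\<close> is injective on \<open>B\<close> and thus a unit, or its image of
  \<open>B\<close> already has exactly \<open>s - 1\<close> points.\<close>

lemma drop_type_prime:
  assumes "f \<in> T" "g \<in> T" "g \<circ> f \<in> drop_type s"
  shows "f \<in> drop_type s \<or> g \<in> drop_type s"
proof -
  obtain B where inj: "inj_on (bm (g \<circ> f)) P"
    and B_all: "B \<in> P" "card B = s" "\<forall>C\<in>P. C \<noteq> B \<longrightarrow> inj_on (g \<circ> f) C" "card ((g \<circ> f) ` B) = s - 1"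
    using assms(3) by (rule drop_typeE)
  note B = B_all[rule_format]
  note bij = bm_comp_inj[OF assms(1,2) inj]
  have finj: "inj_on f C" if "C \<in> P" "C \<noteq> B" for C using B(3)[OF that] by (rule inj_on_imageI2)
  have fB: "finite B" using block_finite B by blast
  have c1: "s - 1 \<le> card (f ` B)"
    using fB B(4) by (metis card_image_le finite_imageI image_comp)
  show ?thesis
  proof (cases "inj_on f B")
    case True
    then have fG: "f \<in> G" using unitI[OF assms(1) bij(1)] finj by blast
    have ginj: "inj_on g C" if C: "C \<in> P" "C \<noteq> bm f B" for C
    proof -
      obtain E where E: "E \<in> P" "bm f E = C" "f ` E = C" using unit_preimage[OF fG C(1)] by metis
      then have "inj_on (g \<circ> f) E" using B(3) C by blast
      then show ?thesis using E inj_on_unit_comp by blast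
    qed
    have gc: "card (g ` bm f B) = s - 1" using B(4) unit_image[OF fG B(1)] by (metis image_comp)
    have gB: "bm f B \<in> P" "card (bm f B) = s" using B unit_card_bm[OF fG] bm_in assms by auto
    have "g \<in> drop_type s" by (rule drop_typeI[OF assms(2) bij(2) gB ginj gc])
    then show ?thesis ..
  next
    case False
    then have "card (f ` B) < s" using fB B(2) by (metis card_image_le eq_card_imp_inj_on le_neq_implies_less)
    then have "card (f ` B) = s - 1" using c1 by linarith
    then have "f \<in> drop_type s" using drop_typeI[OF assms(1) bij(1) B(1,2) finj] by blast
    then show ?thesis ..
  qed
qed

text \<open>Otherwise no block would go to a smaller one, and all sizes would be preserved.\<close>

lemma swap_shrinks:
  assumes "f \<in> T" "inj_on (bm f) P" "\<exists>C\<in>P. card (bm f C) \<noteq> card C" "B \<in> P"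
    "\<And>C. C \<in> P \<Longrightarrow> C \<noteq> B \<Longrightarrow> inj_on f C"
  shows "card (bm f B) < card B"
proof (rule ccontr)
  assume *: "\<not> ?thesis"
  have "card C \<le> card (bm f C)" if "C \<in> P" for C
    using * that assms inj_card_bm by (cases "C = B") auto
  then show False using assms(3) card_preserving[OF bij_bm[OF assms(1,2)]] by blast
qed

section \<open>Disjointness of the types from each other and from the units\<close>

lemma coll_type_not_inj:
  assumes "f \<in> coll_type p" shows "\<not> inj_on (bm f) P"
proof -
  obtain s s' where p: "p = (s, s')" by (cases p)
  obtain B C where "B \<in> P" "C \<in> P" "B \<noteq> C" "bm f B = bm f C"
    using assms unfolding p by (rule coll_typeE)
  then show ?thesis by (auto dest: inj_onD)
qed

lemma coll_type_unique:
  assumes "p \<in> size_pairs" "p' \<in> size_pairs" "f \<in> coll_type p" "f \<in> coll_type p'"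
  shows "p = p'"
proof -
  obtain s1 s2 s1' s2' where p: "p = (s1, s2)" "p' = (s1', s2')" by (cases p, cases p')
  obtain B C where BC: "B \<in> P" "C \<in> P" "B \<noteq> C" "card B = s1" "card C = s2" "bm f B = bm f C"
    and only: "\<forall>D\<in>P. \<forall>E\<in>P. bm f D = bm f E \<longrightarrow> D = E \<or> {D, E} = {B, C}"
    using assms(3) unfolding p by (rule coll_typeE)
  obtain B' C' where BC': "B' \<in> P" "C' \<in> P" "B' \<noteq> C'" "card B' = s1'" "card C' = s2'" "bm f B' = bm f C'"
    using assms(4) unfolding p by (rule coll_typeE)
  have "{B', C'} = {B, C}" using only[rule_format, OF BC'(1,2,6)] BC'(3) by simp
  moreover have "s1 \<le> s2" "s1' \<le> s2'" using assms(1,2) unfolding p size_pairs_def by auto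
  ultimately show ?thesis using BC BC' unfolding p by (auto simp: doubleton_eq_iff)
qed

lemma swap_type_unique:
  assumes "f \<in> swap_type s" "f \<in> swap_type s'" shows "s = s'"
proof -
  obtain B where B: "f \<in> T" "inj_on (bm f) P" "\<exists>C\<in>P. card (bm f C) \<noteq> card C" "B \<in> P"
    "\<forall>C\<in>P. C \<noteq> B \<longrightarrow> inj_on f C" "card B = s"
    using assms(1) by (rule swap_typeE)
  obtain B' where B': "B' \<in> P" "\<forall>C\<in>P. C \<noteq> B' \<longrightarrow> inj_on f C" "card B' = s'"
    using assms(2) by (rule swap_typeE)
  have "\<not> inj_on f B" using swap_shrinks[OF B(1-4)] B(5) inj_card_bm[OF B(1) B(4)] by auto
  then have "B = B'" using B'(2) B(4) by blast
  then show ?thesis using B B' by simp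
qed

lemma drop_type_unique:
  assumes "s \<ge> 2" "f \<in> drop_type s" "f \<in> drop_type s'" shows "s = s'"
proof -
  obtain B where B: "B \<in> P" "card B = s" "card (f ` B) = s - 1"
    using assms(2) by (rule drop_typeE)
  obtain B' where B': "B' \<in> P" "\<forall>C\<in>P. C \<noteq> B' \<longrightarrow> inj_on f C" "card B' = s'"
    using assms(3) by (rule drop_typeE)
  have "\<not> inj_on f B" using B assms(1) by (auto dest: card_image)
  then have "B = B'" using B'(2) B(1) by blast
  then show ?thesis using B B' by simp
qed

text \<open>Such a map would send a block of size \<open>s\<close> to a strictly smaller block while
  keeping \<open>s - 1\<close> points. This requires a block of size \<open>s - 1\<close>, which a
  gap size excludes.\<close>

lemma drop_swap_disjoint:
  assumes "s \<in> gap_sizes" "f \<in> drop_type s" "f \<in> swap_type s'" shows False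
proof -
  obtain B where B: "B \<in> P" "card B = s" "card (f ` B) = s - 1"
    using assms(2) by (rule drop_typeE)
  obtain B' where B': "f \<in> T" "inj_on (bm f) P" "\<exists>C\<in>P. card (bm f C) \<noteq> card C" "B' \<in> P"
    "\<forall>C\<in>P. C \<noteq> B' \<longrightarrow> inj_on f C" "card B' = s'"
    using assms(3) by (rule swap_typeE)
  have s: "s \<ge> 2" "s - 1 \<notin> sizes" using assms(1) by (auto simp: gap_sizes_def)
  have "\<not> inj_on f B" using B s by (auto dest: card_image)
  then have BB: "B = B'" using B'(5) B(1) by blast
  have "card (bm f B) < s" using swap_shrinks[OF B'(1-4)] B'(5) BB B by simp
  moreover have "s - 1 \<le> card (bm f B)"
    using B(3) image_bm[OF B'(1) B(1)] block_finite[OF bm_in[OF B'(1) B(1)]] by (metis card_mono)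
  ultimately have "card (bm f B) = s - 1" by linarith
  then show False using s bm_in[OF B'(1) B(1)] by (metis imageI sizes_def)
qed

lemma units_no_type:
  assumes "f \<in> G"
  shows "p \<in> size_pairs \<Longrightarrow> f \<notin> coll_type p" "f \<notin> swap_type s" "s \<ge> 2 \<Longrightarrow> f \<notin> drop_type s"
proof -
  show "p \<in> size_pairs \<Longrightarrow> f \<notin> coll_type p" using coll_type_not_inj unit_inj_bm[OF assms] by blast
  show "f \<notin> swap_type s" using unit_card_bm[OF assms] unfolding swap_type_def by blast
  show "f \<notin> drop_type s" if s: "s \<ge> 2"
  proof
    assume "f \<in> drop_type s"
    then obtain B where "B \<in> P" "card B = s" "card (f ` B) = s - 1" by (rule drop_typeE)
    then show False using card_image[OF unit_inj_on[OF assms, of B]] s by linarith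
  qed
qed

section \<open>Standard maps of each type\<close>

lemma collapse_T: "R \<in> P \<Longrightarrow> Q \<in> P \<Longrightarrow> collapse R Q \<in> T"
  and bm_collapse: "R \<in> P \<Longrightarrow> Q \<in> P \<Longrightarrow> B \<in> P \<Longrightarrow> bm (collapse R Q) B = (if B = R then Q else B)"
  using override_T[OF id_T, of R Q "cpt Q"] bm_override[OF id_T, of R Q "cpt Q" B] cpt_in[of Q]
  by (auto simp: collapse_def image_subset_iff bm_id)

lemma collapse_type:
  assumes "R \<in> P" "Q \<in> P" "R \<noteq> Q" "card R \<le> card Q"
  shows "collapse R Q \<in> coll_type (card R, card Q)"
proof -
  have inj: "inj_on (collapse R Q) B" if B: "B \<in> P" for B
  proof (cases "B = R")
    case True
    then show ?thesis using cpt_inj[OF assms(1,2,4)] by (simp add: collapse_def inj_on_def)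
  next
    case False
    then have "x \<notin> R" if "x \<in> B" for x using that B assms block_disjoint by blast
    then show ?thesis by (simp add: collapse_def inj_on_def)
  qed
  have only: "D = E \<or> {D, E} = {R, Q}" if "D \<in> P" "E \<in> P" "bm (collapse R Q) D = bm (collapse R Q) E" for D E
    using that bm_collapse[OF assms(1,2)] by (auto split: if_splits)
  have "bm (collapse R Q) R = bm (collapse R Q) Q" using bm_collapse assms by simp
  from coll_typeI[OF collapse_T[OF assms(1,2)] inj assms(1-3) refl refl this only]
  show ?thesis .
qed

lemma bswap_type:
  assumes "R \<in> P" "Q \<in> P" "card R < card Q" "\<not> (\<exists>M\<in>P. card R < card M \<and> card M < card Q)"
  shows "bswap R Q \<in> swap_type (card Q)"
proof -
  have ne: "R \<noteq> Q" using assms by auto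
  have injb: "inj_on (bm (bswap R Q)) P"
    using bm_bswap[OF assms(1,2)] by (intro inj_onI) (metis transpose_eq_imp_eq)
  have cR: "card (bm (bswap R Q) R) \<noteq> card R" using bm_bswap assms by simp
  have inj: "inj_on (bswap R Q) C" if C: "C \<in> P" "C \<noteq> Q" for C
  proof (cases "C = R")
    case True
    then show ?thesis using cpt_inj[OF assms(1,2)] assms(3) by (simp add: bswap_def inj_on_def)
  next
    case False
    then have "x \<notin> R" "x \<notin> Q" if "x \<in> C" for x using that C assms block_disjoint by blast+
    then show ?thesis by (simp add: bswap_def inj_on_def)
  qed
  have le: "s0 \<le> card (bswap R Q ` Q)" if s0: "s0 \<in> sizes" "s0 < card Q" for s0
  proof -
    have "R \<subseteq> bswap R Q ` Q"
    proof
      fix x assume x: "x \<in> R"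
      have "cpt Q x \<in> Q" "cpt R (cpt Q x) = x" using x assms cpt_in cpt_cpt by auto
      moreover have "cpt Q x \<notin> R" using calculation ne assms block_disjoint by blast
      ultimately show "x \<in> bswap R Q ` Q" by (intro image_eqI[of _ _ "cpt Q x"]) (simp_all add: bswap_def)
    qed
    then have "card R \<le> card (bswap R Q ` Q)" using assms block_finite by (simp add: card_mono)
    moreover have "s0 \<le> card R" using s0 assms(4) by (force simp: sizes_def)
    ultimately show ?thesis by simp
  qed
  show ?thesis by (rule swap_typeI[OF bswap_T[OF assms(1,2)] injb assms(1) cR assms(2) refl inj le])
qed

lemma drop_top_T:
  assumes "B \<in> P" "card B \<ge> 2" shows "drop_top B \<in> T" and "C \<in> P \<Longrightarrow> bm (drop_top B) C = C"
proof -
  have B12: "pt B (card B - 1) \<in> B" "pt B (card B - 2) \<in> B" using assms by (auto intro!: pt_in)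
  have im: "drop_top B ` C \<subseteq> C" if "C \<in> P" for C
    using B12 block_disjoint[OF that assms(1)] by (auto simp: drop_top_def)
  show T: "drop_top B \<in> T"
  proof (rule TI)
    fix x assume "x \<notin> X"
    then show "drop_top B x = x" using B12 block_subset assms by (auto simp: drop_top_def)
  qed (use im in blast)
  show "bm (drop_top B) C = C" if C: "C \<in> P"
  proof -
    obtain x where "x \<in> C" using block_nonempty C by blast
    then show ?thesis using im[OF C] C by (intro bm_eqI[OF T C C]) auto
  qed
qed

lemma drop_top_type:
  assumes "B \<in> P" "card B \<ge> 2" shows "drop_top B \<in> drop_type (card B)"
proof -
  let ?x = "pt B (card B - 1)" and ?y = "pt B (card B - 2)"
  have B12: "?x \<in> B" "?y \<in> B" "?x \<noteq> ?y" using assms by (auto simp: pt_in pt_inject)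
  have injb: "inj_on (bm (drop_top B)) P" using drop_top_T[OF assms] by (simp add: inj_on_def)
  have inj: "inj_on (drop_top B) C" if C: "C \<in> P" "C \<noteq> B" for C
  proof -
    have "?x \<notin> C" using B12 C assms block_disjoint by blast
    then show ?thesis by (auto simp: drop_top_def inj_on_def)
  qed
  have "drop_top B ` B = B - {?x}" using B12 by (auto simp: drop_top_def)
  then have c: "card (drop_top B ` B) = card B - 1" using B12 block_finite[OF assms(1)] by simp
  show ?thesis by (rule drop_typeI[OF drop_top_T(1)[OF assms] injb assms(1) refl inj c])
qed

lemma multiI:
  assumes "B \<in> P" "C \<in> P" "B \<noteq> C" "card B = card C" shows "card B \<in> multi"
  using card_mono[of "{D\<in>P. card D = card B}" "{B, C}"] assms finP by (simp add: multi_def)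

lemma multi_unique:
  assumes "B \<in> P" "C \<in> P" "card B = card C" "card B \<notin> multi" shows "B = C"
  using multiI assms by blast

lemma multiE:
  assumes "s \<in> multi"
  obtains B C where "B \<in> P" "C \<in> P" "B \<noteq> C" "card B = s" "card C = s"
proof -
  have "\<not> card {B\<in>P. card B = s} \<le> Suc 0" using assms by (simp add: multi_def)
  then show thesis using that card_le_Suc0_iff_eq[of "{B\<in>P. card B = s}"] finP by auto
qed

lemma size_pairs_obtain:
  assumes "(s, s') \<in> size_pairs"
  obtains B C where "B \<in> P" "C \<in> P" "B \<noteq> C" "card B = s" "card C = s'" "s \<le> s'"
proof (cases "s = s'")
  case True
  then have "s \<in> multi" using assms by (auto simp: size_pairs_def)
  then show thesis using multiE that True by (metis order_refl)
next
  case False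
  then obtain B C where "B \<in> P" "C \<in> P" "card B = s" "card C = s'" "s < s'"
    using assms by (auto simp: size_pairs_def sizes_def)
  then show thesis using that[of B C] by auto
qed

lemma nonmin_sizes_obtain:
  assumes "s \<in> nonmin_sizes"
  obtains B C where "B \<in> P" "C \<in> P" "card B < card C" "card C = s"
    "\<not> (\<exists>M\<in>P. card B < card M \<and> card M < card C)"
proof -
  have *: "finite {B\<in>P. card B < s}" "{B\<in>P. card B < s} \<noteq> {}"
    using assms finP by (auto simp: nonmin_sizes_def sizes_def)
  obtain B where B: "B \<in> {B\<in>P. card B < s}" "\<And>C. C \<in> {B\<in>P. card B < s} \<Longrightarrow> card C \<le> card B"
    using finite_obtain_max[OF *, of card] by blast
  obtain C where C: "C \<in> P" "card C = s" using assms by (auto simp: nonmin_sizes_def sizes_def)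
  show thesis using that[of B C] B C by force
qed

lemma finite_sizes: "finite sizes"
  using finP by (simp add: sizes_def)

lemma multi_subset: "multi \<subseteq> sizes"
  by (rule subsetI, erule multiE) (auto simp: sizes_def)

lemma finite_types: "finite size_pairs" "finite nonmin_sizes" "finite gap_sizes" "finite multi"
proof -
  show "finite multi" using multi_subset finite_sizes finite_subset by blast
  have "size_pairs \<subseteq> sizes \<times> sizes" using multi_subset by (auto simp: size_pairs_def)
  then show "finite size_pairs" using finite_sizes finite_subset by blast
  show "finite nonmin_sizes" "finite gap_sizes"
    using finite_sizes by (auto simp: nonmin_sizes_def gap_sizes_def)
qed

lemma nonunit_generators_bound:
  assumes "finite U" "sgen U = T"
  shows "card size_pairs + card nonmin_sizes + card gap_sizes \<le> card (U - G)"
proof -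
  \<comment> \<open>A tagged union, because one size may index both an exchange and a drop.\<close>
  define I where "I = size_pairs <+> (nonmin_sizes <+> gap_sizes)"
  define F where "F = case_sum coll_type (case_sum swap_type drop_type)"
  have hit: "\<exists>u\<in>U. u \<in> A" if "A \<subseteq> T" "A \<noteq> {}"
    "\<And>f g. f \<in> T \<Longrightarrow> g \<in> T \<Longrightarrow> g \<circ> f \<in> A \<Longrightarrow> f \<in> A \<or> g \<in> A" for A
    using sgen_meets_prime[OF assms(2) comp_closed_T that] .
  have "card I \<le> card (U - G)"
  proof (rule card_le_of_disjoint_hits[where F = F])
    show "finite (U - G)" using assms by simp
    show "\<exists>v\<in>U - G. v \<in> F i" if i: "i \<in> I" for i
    proof -
      consider (1) p where "i = Inl p" "p \<in> size_pairs" | (2) s where "i = Inr (Inl s)" "s \<in> nonmin_sizes"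
        | (3) s where "i = Inr (Inr s)" "s \<in> gap_sizes" using i by (auto simp: I_def)
      then show ?thesis
      proof cases
        case 1
        obtain s s' where p: "p = (s, s')" by (cases p)
        obtain B C where "B \<in> P" "C \<in> P" "B \<noteq> C" "card B = s" "card C = s'" "s \<le> s'"
          using size_pairs_obtain 1 p by blast
        then have "coll_type p \<noteq> {}" using collapse_type[of B C] p by auto
        moreover have "coll_type p \<subseteq> T" by (auto simp: coll_type_def p)
        ultimately have "\<exists>u\<in>U. u \<in> coll_type p" using coll_type_prime hit by metis
        then show ?thesis using 1 units_no_type(1) unfolding F_def by (metis Diff_iff sum.case(1))
      next
        case 2
        obtain B C where "B \<in> P" "C \<in> P" "card B < card C" "card C = s"
           "\<not> (\<exists>M\<in>P. card B < card M \<and> card M < card C)"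
          using nonmin_sizes_obtain 2 by blast
        then have "swap_type s \<noteq> {}" using bswap_type by blast
        moreover have "swap_type s \<subseteq> T" by (auto simp: swap_type_def)
        ultimately have "\<exists>u\<in>U. u \<in> swap_type s" using swap_type_prime hit by metis
        then show ?thesis using 2 units_no_type by (auto simp: F_def)
      next
        case 3
        obtain B where "B \<in> P" "card B = s" "s \<ge> 2" using 3 by (auto simp: gap_sizes_def sizes_def)
        then have "drop_type s \<noteq> {}" using drop_top_type by blast
        moreover have "drop_type s \<subseteq> T" by (auto simp: drop_type_def)
        ultimately have "\<exists>u\<in>U. u \<in> drop_type s" using drop_type_prime hit by metis
        then show ?thesis using 3 units_no_type \<open>s \<ge> 2\<close> by (auto simp: F_def)
      qed
    qed
    have ib: "f \<in> swap_type s \<Longrightarrow> inj_on (bm f) P" "f \<in> drop_type s \<Longrightarrow> inj_on (bm f) P" for f s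
      by (auto simp: swap_type_def drop_type_def)
    have g2: "s \<ge> 2" if "s \<in> gap_sizes" for s using that by (simp add: gap_sizes_def)
    show "i = j" if "i \<in> I" "j \<in> I" "v \<in> F i" "v \<in> F j" for v i j
      using that unfolding I_def F_def
      by (elim PlusE; simp)
        (blast dest: ib coll_type_not_inj coll_type_unique swap_type_unique drop_type_unique[OF g2]
          drop_swap_disjoint)+
  qed
  moreover have "card I = card size_pairs + (card nonmin_sizes + card gap_sizes)"
    unfolding I_def using finite_types by (simp add: card_Plus)
  ultimately show ?thesis by simp
qed

end

section \<open>Lower bound for the group of units\<close>

lemma odd_card_sym_diff:
  assumes "finite A" "finite B"
  shows "odd (card (sym_diff A B)) \<longleftrightarrow> odd (card A) \<noteq> odd (card B)"
proof -
  have "card (sym_diff A B) = card (A - B) + card (B - A)"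
    using assms by (intro card_Un_disjoint) auto
  moreover have "card A = card (A - B) + card (A \<inter> B)" "card B = card (B - A) + card (A \<inter> B)"
    using assms by (metis Int_commute add.commute card_Diff_subset_Int card_mono finite_Int inf_le1 le_add_diff_inverse)+
  ultimately show ?thesis by presburger
qed

text \<open>\<open>\<chi>\<close> is a homomorphism onto an elementary abelian 2-group whose vectors
  are subsets of \<open>I\<close>. Its value on a word depends only on which generators occur an odd
  number of times, so \<open>2 ^ card V\<close> values must exhaust the \<open>2 ^ card I\<close>
  subsets.\<close>

lemma sym_diff_hom_bound:
  fixes \<chi> :: "('a \<Rightarrow> 'a) \<Rightarrow> 'i set"
  assumes "finite I" "finite V" "V \<subseteq> S" "comp_closed S"
    and hom: "\<And>f g. f \<in> S \<Longrightarrow> g \<in> S \<Longrightarrow> \<chi> (g \<circ> f) = sym_diff (\<chi> g) (\<chi> f)"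
    and sub: "\<And>f. f \<in> S \<Longrightarrow> \<chi> f \<subseteq> I"
    and surj: "Pow I \<subseteq> \<chi> ` sgen V"
  shows "card I \<le> card V"
proof -
  define \<Sigma> where "\<Sigma> W = {i\<in>I. odd (card {v\<in>W. i \<in> \<chi> v})}" for W
  have VS: "sgen V \<subseteq> S" using assms by (intro sgen_least)
  have "\<exists>W\<subseteq>V. \<chi> f = \<Sigma> W" if "f \<in> sgen V" for f
    using that
  proof induction
    case (base u)
    have "{v \<in> {u}. i \<in> \<chi> v} = (if i \<in> \<chi> u then {u} else {})" for i by auto
    then have "\<Sigma> {u} = \<chi> u" using sub[of u] base assms(3) by (auto simp: \<Sigma>_def)
    then show ?case using base by (intro exI[of _ "{u}"]) auto
  next
    case (prod f g)
    then obtain W W' where W: "W \<subseteq> V" "\<chi> f = \<Sigma> W" "W' \<subseteq> V" "\<chi> g = \<Sigma> W'" by blast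
    have fin: "finite W" "finite W'" using W assms(2) finite_subset by blast+
    have "{v \<in> sym_diff W' W. i \<in> \<chi> v} = sym_diff {v\<in>W'. i \<in> \<chi> v} {v\<in>W. i \<in> \<chi> v}" for i by auto
    then have "\<Sigma> (sym_diff W' W) = sym_diff (\<Sigma> W') (\<Sigma> W)"
      using fin by (auto simp: \<Sigma>_def odd_card_sym_diff)
    moreover have "\<chi> (g \<circ> f) = sym_diff (\<chi> g) (\<chi> f)" using hom prod VS by blast
    ultimately have "\<chi> (g \<circ> f) = \<Sigma> (sym_diff W' W)" using W by simp
    moreover have "sym_diff W' W \<subseteq> V" using W by blast
    ultimately show ?case by blast
  qed
  then have "\<chi> ` sgen V \<subseteq> \<Sigma> ` Pow V" by blast
  then have "Pow I \<subseteq> \<Sigma> ` Pow V" using surj by (rule order_trans[rotated])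
  then have "card (Pow I) \<le> card (Pow V)" using assms(2) by (meson finite_Pow_iff surj_card_le)
  then show ?thesis using assms(1,2) by (simp add: card_Pow)
qed

lemma sgen_singleton_commute:
  assumes "f \<in> sgen {v}" "g \<in> sgen {v}" shows "g \<circ> f = f \<circ> g"
proof -
  have *: "h \<circ> v = v \<circ> h" if "h \<in> sgen {v}" for h
    using that
  proof induction
    case (prod f g)
    have "(g \<circ> f) \<circ> v = g \<circ> (v \<circ> f)" using prod by (simp only: comp_assoc)
    also have "\<dots> = (v \<circ> g) \<circ> f" using prod by (simp only: o_assoc)
    finally show ?case by (simp only: comp_assoc)
  qed simp
  show ?thesis using assms(1)
  proof induction
    case (prod f1 f2)
    have "g \<circ> (f2 \<circ> f1) = (f2 \<circ> g) \<circ> f1" using prod by (simp only: o_assoc)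
    also have "\<dots> = f2 \<circ> (f1 \<circ> g)" using prod by (simp only: comp_assoc)
    finally show ?case by (simp only: comp_assoc)
  qed (use *[OF assms(2)] in auto)
qed

context partitioned
begin

section \<open>Sign vectors of units\<close>

definition big_sizes :: "nat set" where
  "big_sizes = {s \<in> sizes. s \<ge> 2}"

lemma finite_big_sizes: "finite big_sizes"
  using finite_sizes by (simp add: big_sizes_def)

definition unit_rank :: nat where
  "unit_rank = card big_sizes + card multi"

definition level :: "nat \<Rightarrow> 'a set" where
  "level s = {x\<in>X. card (blk x) = s}"

definition blevel :: "nat \<Rightarrow> 'a set set" where
  "blevel s = {B\<in>P. card B = s}"

lemma blk_unit: "f \<in> G \<Longrightarrow> x \<in> X \<Longrightarrow> blk (f x) = bm f (blk x)"
  using bm_eq[OF G_T blk_in in_blk] by blast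

lemma unit_level:
  assumes "f \<in> G" shows "bij_betw f (level s) (level s)" "bij_betw (bm f) (blevel s) (blevel s)"
proof -
  have "f ` level s \<subseteq> level s"
    using assms T_in_X G_T blk_unit unit_card_bm blk_in by (auto simp: level_def)
  then show "bij_betw f (level s) (level s)"
    using unit_inj_on[OF assms] finX by (simp add: bij_betw_def level_def endo_inj_surj)
  have "bm f ` blevel s \<subseteq> blevel s"
    using assms bm_in G_T unit_card_bm by (auto simp: blevel_def)
  moreover have "inj_on (bm f) (blevel s)"
    using unit_inj_bm[OF assms] by (rule inj_on_subset) (auto simp: blevel_def)
  ultimately show "bij_betw (bm f) (blevel s) (blevel s)"
    using finP by (simp add: bij_betw_def blevel_def endo_inj_surj)
qed

definition level_sign :: "nat + nat \<Rightarrow> ('a \<Rightarrow> 'a) \<Rightarrow> int" where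
  "level_sign i f = (case i of Inl s \<Rightarrow> sign_on (level s) f | Inr s \<Rightarrow> sign_on (blevel s) (bm f))"

lemma level_sign_comp:
  assumes "f \<in> G" "g \<in> G" shows "level_sign i (g \<circ> f) = level_sign i g * level_sign i f"
proof (cases i)
  case (Inl s)
  then show ?thesis using assms unit_level finX
    by (simp add: level_sign_def sign_on_compose level_def del: comp_apply)
next
  case (Inr s)
  have "sign_on (blevel s) (bm (g \<circ> f)) = sign_on (blevel s) (bm g \<circ> bm f)"
    using assms bm_comp[OF G_T G_T] by (intro sign_on_cong) (auto simp: blevel_def)
  also have "\<dots> = sign_on (blevel s) (bm g) * sign_on (blevel s) (bm f)"
    using assms unit_level finP by (intro sign_on_compose) (auto simp: blevel_def)
  finally show ?thesis using Inr by (simp add: level_sign_def)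
qed

lemma level_sign_cases: "level_sign i f = 1 \<or> level_sign i f = -1"
  by (auto simp: level_sign_def sign_on_def sign_def split: sum.split)

text \<open>The sign vector, written as the set of coordinates equal to -1. Size 1 gets a block
  coordinate only, since on singletons the sign on points coincides with it.\<close>

definition odd_levels :: "('a \<Rightarrow> 'a) \<Rightarrow> (nat + nat) set" where
  "odd_levels f = {i \<in> big_sizes <+> multi. level_sign i f = -1}"

lemma odd_levels_comp: "f \<in> G \<Longrightarrow> g \<in> G \<Longrightarrow> odd_levels (g \<circ> f) = sym_diff (odd_levels g) (odd_levels f)"
  using level_sign_cases by (force simp: odd_levels_def level_sign_comp simp del: comp_apply)

lemma odd_levels_id: "odd_levels id = {}"
proof -
  have "level_sign i id = 1" for i
  proof (cases i)
    case (Inr s)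
    have "sign_on (blevel s) (bm id) = sign_on (blevel s) id"
      by (rule sign_on_cong) (auto simp: blevel_def bm_id)
    then show ?thesis using Inr by (simp add: level_sign_def)
  qed (simp add: level_sign_def)
  then show ?thesis by (simp add: odd_levels_def)
qed

lemma odd_levels_transpose:
  assumes "B \<in> P" "x \<in> B" "y \<in> B" "x \<noteq> y"
  shows "odd_levels (transpose x y) = {Inl (card B)}"
proof -
  have xy: "x \<in> level (card B)" "y \<in> level (card B)"
    using assms block_subset blk_eq by (auto simp: level_def)
  have 1: "level_sign (Inl (card B)) (transpose x y) = -1"
    using xy assms by (simp add: level_sign_def sign_on_transpose)
  have 2: "level_sign (Inl s) (transpose x y) = 1" if "s \<noteq> card B" for s
  proof -
    have "sign_on (level s) (transpose x y) = sign_on (level s) id"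
      using that xy by (intro sign_on_cong) (auto simp: level_def transpose_def)
    then show ?thesis by (simp add: level_sign_def)
  qed
  have 3: "level_sign (Inr s) (transpose x y) = 1" for s
  proof -
    have "sign_on (blevel s) (bm (transpose x y)) = sign_on (blevel s) id"
      using bm_transpose[OF assms(1-3)] by (intro sign_on_cong) (auto simp: blevel_def)
    then show ?thesis by (simp add: level_sign_def)
  qed
  have "card B \<ge> 2" using assms by (rule block_card_ge_2)
  then have "card B \<in> big_sizes" using assms by (auto simp: big_sizes_def sizes_def)
  then show ?thesis using 1 2 3 by (auto simp: odd_levels_def) (metis one_neq_neg_one)
qed

text \<open>The sign on points depends on the parity of \<open>card B\<close>. It is left open here,
  because a transposition inside \<open>B\<close> can correct it.\<close>

lemma odd_levels_bswap:
  assumes "B \<in> P" "C \<in> P" "B \<noteq> C" "card B = card C"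
  shows "Inr (card B) \<in> odd_levels (bswap B C)" "odd_levels (bswap B C) \<subseteq> {Inr (card B), Inl (card B)}"
proof -
  have bl: "B \<in> blevel (card B)" "C \<in> blevel (card B)" using assms by (auto simp: blevel_def)
  have "sign_on (blevel (card B)) (bm (bswap B C)) = sign_on (blevel (card B)) (transpose B C)"
    using bm_bswap[OF assms(1,2)] by (intro sign_on_cong) (auto simp: blevel_def)
  then have 1: "level_sign (Inr (card B)) (bswap B C) = -1"
    using bl assms by (simp add: level_sign_def sign_on_transpose)
  have 2: "level_sign (Inr s) (bswap B C) = 1" if "s \<noteq> card B" for s
  proof -
    have "sign_on (blevel s) (bm (bswap B C)) = sign_on (blevel s) id"
      using that bl bm_bswap[OF assms(1,2)]
      by (intro sign_on_cong) (auto simp: blevel_def transpose_def)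
    then show ?thesis by (simp add: level_sign_def)
  qed
  have 3: "level_sign (Inl s) (bswap B C) = 1" if "s \<noteq> card B" for s
  proof -
    have "bswap B C x = x" if "x \<in> level s" for x
      using that \<open>s \<noteq> card B\<close> assms blk_eq by (auto simp: level_def bswap_def)
    then have "sign_on (level s) (bswap B C) = sign_on (level s) id"
      by (intro sign_on_cong) auto
    then show ?thesis by (simp add: level_sign_def)
  qed
  have "card B \<in> multi" using assms by (rule multiI)
  then show "Inr (card B) \<in> odd_levels (bswap B C)" using 1 by (auto simp: odd_levels_def)
  show "odd_levels (bswap B C) \<subseteq> {Inr (card B), Inl (card B)}"
    using 2 3 by (auto simp: odd_levels_def) (metis one_neq_neg_one)+
qed

lemma odd_levels_surj: "Pow (big_sizes <+> multi) \<subseteq> odd_levels ` G"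
proof
  have ex: "\<exists>e\<in>G. odd_levels e = {i}" if i: "i \<in> big_sizes <+> multi" for i
    using i
  proof
    fix s assume s: "i = Inl s" "s \<in> big_sizes"
    then obtain B where B: "B \<in> P" "card B = s" "s \<ge> 2" by (auto simp: big_sizes_def sizes_def)
    then have xy: "pt B 0 \<in> B" "pt B 1 \<in> B" "pt B 0 \<noteq> pt B 1" by (auto simp: pt_in pt_inject)
    then show ?thesis using odd_levels_transpose[OF B(1) xy] transpose_G[OF B(1) xy(1,2)] s B by blast
  next
    fix s assume s: "i = Inr s" "s \<in> multi"
    then obtain B C where BC: "B \<in> P" "C \<in> P" "B \<noteq> C" "card B = s" "card C = s" by (metis multiE)
    have b: "Inr s \<in> odd_levels (bswap B C)" "odd_levels (bswap B C) \<subseteq> {Inr s, Inl s}" "bswap B C \<in> G"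
      using odd_levels_bswap[OF BC(1-3)] BC bswap_G by auto
    show ?thesis
    \<comment> \<open>An unwanted point sign is cancelled by a transposition; for singletons the
      coordinate \<open>Inl s\<close> does not exist.\<close>
    proof (cases "Inl s \<in> odd_levels (bswap B C)")
      case True
      then have "s \<ge> 2" by (auto simp: odd_levels_def big_sizes_def)
      then have xy: "pt B 0 \<in> B" "pt B 1 \<in> B" "pt B 0 \<noteq> pt B 1" using BC by (auto simp: pt_in pt_inject)
      let ?t = "transpose (pt B 0) (pt B 1)"
      have t: "odd_levels ?t = {Inl s}" "?t \<in> G"
        using odd_levels_transpose[OF BC(1) xy] transpose_G[OF BC(1) xy(1,2)] BC by auto
      have "odd_levels (?t \<circ> bswap B C) = sym_diff (odd_levels ?t) (odd_levels (bswap B C))"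
        using t b by (intro odd_levels_comp)
      also have "\<dots> = {i}" using t b True s by auto
      finally show ?thesis using unit_comp[OF b(3) t(2)] by blast
    next
      case False
      then have "odd_levels (bswap B C) = {i}" using b s by auto
      then show ?thesis using b by blast
    qed
  qed
  fix J assume "J \<in> Pow (big_sizes <+> multi)"
  then have J: "J \<subseteq> big_sizes <+> multi" by simp
  have "finite J" using J finite_big_sizes finite_types finite_subset by (metis finite_Plus)
  then show "J \<in> odd_levels ` G" using J
  proof (induction J)
    case empty
    then show ?case using odd_levels_id id_G by (metis imageI)
  next
    case (insert i J)
    then obtain f where f: "f \<in> G" "odd_levels f = J" by auto
    have "i \<in> big_sizes <+> multi" using insert.prems by simp
    then obtain e where e: "e \<in> G" "odd_levels e = {i}" using ex[of i] by auto
    note fe = f e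
    have "odd_levels (e \<circ> f) = sym_diff {i} J" using odd_levels_comp[OF f(1) e(1)] fe by simp
    also have "\<dots> = insert i J" using insert by auto
    finally show ?case using unit_comp[OF f(1) e(1)] by (metis imageI)
  qed
qed

lemma unit_generators_bound:
  assumes "finite V" "sgen V = G"
  shows "unit_rank \<le> card V"
proof -
  have "card (big_sizes <+> multi) \<le> card V"
  proof (rule sym_diff_hom_bound[where \<chi> = odd_levels and S = G])
    show "V \<subseteq> G" using assms sgen.base by blast
    show "finite (big_sizes <+> multi)" using finite_big_sizes finite_types by simp
    show "Pow (big_sizes <+> multi) \<subseteq> odd_levels ` sgen V" using odd_levels_surj assms by simp
  qed (use assms comp_closed_G odd_levels_comp in \<open>auto simp: odd_levels_def\<close>)
  then show ?thesis using finite_big_sizes finite_types by (simp add: unit_rank_def card_Plus)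
qed

section \<open>Commutative groups of units\<close>

lemma transpose_singletons_G:
  assumes "x \<in> X" "y \<in> X" "card (blk x) = 1" "card (blk y) = 1"
  shows "transpose x y \<in> G"
proof -
  have xy: "blk x = {x}" "blk y = {y}" using assms in_blk card_1_singletonE by (metis singletonD)+
  have "transpose x y \<in> T"
  proof (rule TI)
    fix B assume B: "B \<in> P"
    show "\<exists>C\<in>P. transpose x y ` B \<subseteq> C"
    proof (cases "x \<in> B \<or> y \<in> B")
      case True
      then have "B = {x} \<or> B = {y}" using xy blk_eq[OF B] by metis
      then show ?thesis using xy blk_in assms(1,2) by (metis image_empty image_insert order_refl transpose_apply_first transpose_apply_second)
    next
      case False
      then have "transpose x y z = z" if "z \<in> B" for z using that by (auto simp: transpose_def)
      then have "transpose x y ` B = B" by simp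
      then show ?thesis using B by blast
    qed
  qed (use assms in \<open>auto simp: transpose_def\<close>)
  then show ?thesis using assms by (auto simp: G_iff intro: permutes_swap_id)
qed

text \<open>Any moved point shows that its size contributes a sign coordinate, so with at most one
  coordinate all movement happens in one level. All transpositions of that level are units, and
  overlapping ones do not commute; hence the level has at most two points. It excludes a single
  generator once there are three units.\<close>

lemma commutative_units_card:
  assumes comm: "\<And>f g. f \<in> G \<Longrightarrow> g \<in> G \<Longrightarrow> g \<circ> f = f \<circ> g" and "unit_rank \<le> 1"
  shows "card G \<le> 2"
proof -
  have moved: "\<exists>i. i \<in> big_sizes <+> multi \<and> (i = Inl (card (blk x)) \<or> i = Inr (card (blk x)))"
    if x: "x \<in> X" "f \<in> G" "f x \<noteq> x" for f x
  proof (cases "bm f (blk x) = blk x")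
    case True
    then have "f x \<in> blk x" using T_in_bm[OF G_T[OF x(2)] blk_in in_blk] x(1) by metis
    then have "card (blk x) \<ge> 2" using block_card_ge_2[OF blk_in in_blk] x by metis
    then have "card (blk x) \<in> big_sizes" using x blk_in by (auto simp: big_sizes_def sizes_def)
    then show ?thesis by blast
  next
    case False
    then have "card (blk x) \<in> multi"
      using x blk_in bm_in[OF G_T] unit_card_bm[OF x(2)] by (intro multiI[of _ "bm f (blk x)"]) auto
    then show ?thesis by blast
  qed
  have "card (big_sizes <+> multi) \<le> Suc 0"
    using assms(2) finite_big_sizes finite_types by (simp add: unit_rank_def card_Plus)
  then have one: "i = j" if "i \<in> big_sizes <+> multi" "j \<in> big_sizes <+> multi" for i j
    using that finite_big_sizes finite_types by (subst (asm) card_le_Suc0_iff_eq) auto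
  show ?thesis
  proof (cases "\<exists>f\<in>G. f \<noteq> id")
    case False
    then have "G \<subseteq> {id}" by auto
    then have "card G \<le> card {id :: 'a \<Rightarrow> 'a}" by (intro card_mono) auto
    then show ?thesis by simp
  next
    case True
    then obtain f x where f: "f \<in> G" "f x \<noteq> x" by (auto simp: fun_eq_iff)
    then have x: "x \<in> X" using T_outside G_T by blast
    define s where "s = card (blk x)"
    obtain i where i: "i \<in> big_sizes <+> multi" "i = Inl s \<or> i = Inr s"
      using moved[OF x f] s_def by blast
    \<comment> \<open>Singletons can be interchanged freely. A level of larger size is a single
      block, because a repeated size at least 2 would yield two coordinates.\<close>
    have tr: "transpose u v \<in> G" if uv: "u \<in> level s" "v \<in> level s" for u v
    proof (cases "s = 1")
      case True
      then show ?thesis using uv transpose_singletons_G by (auto simp: level_def)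
    next
      case False
      have "s \<noteq> 0" using x blk_in block_card_pos by (fastforce simp: s_def)
      then have "s \<in> big_sizes" using False x blk_in by (auto simp: big_sizes_def s_def sizes_def)
      then have "s \<notin> multi" using one[of "Inl s" "Inr s"] by blast
      then have "blk u = blk v" using uv multi_unique blk_in by (auto simp: level_def)
      then show ?thesis using uv transpose_G[OF blk_in in_blk] in_blk by (metis (mono_tags, lifting) level_def mem_Collect_eq)
    qed
    have three: "u = w" if "u \<in> level s" "v \<in> level s" "w \<in> level s" "u \<noteq> v" "v \<noteq> w" for u v w
    proof (rule ccontr)
      assume "u \<noteq> w"
      moreover have "(transpose u v \<circ> transpose v w) u = (transpose v w \<circ> transpose u v) u"
        using comm tr that by metis
      ultimately show False using that by (auto simp: transpose_def split: if_splits)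
    qed
    have mv: "z \<in> level s \<and> g z \<in> level s" if g: "g \<in> G" "g z \<noteq> z" for g z
    proof -
      have z: "z \<in> X" using g T_outside G_T by blast
      obtain j where j: "j \<in> big_sizes <+> multi" "j = Inl (card (blk z)) \<or> j = Inr (card (blk z))"
        using moved[OF z g] by blast
      then have "card (blk z) = s" using one[OF i(1) j(1)] i j by auto
      then have "z \<in> level s" using z by (simp add: level_def)
      then show ?thesis using unit_level(1)[OF g(1)] bij_betwE by blast
    qed
    have fx: "x \<in> level s" "f x \<in> level s" using mv f by blast+
    have all: "z = x \<or> z = f x" if "z \<in> level s" for z
      using three[of z x "f x"] three[of x z "f x"] that fx f by metis
    have "G \<subseteq> {id, transpose x (f x)}"
    proof
      fix g assume g: "g \<in> G"
      have inj: "inj g" using permutes_inj[OF G_permutes[OF g]] .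
      show "g \<in> {id, transpose x (f x)}"
      proof (cases "g = id")
        case False
        then obtain z where "g z \<noteq> z" by (auto simp: fun_eq_iff)
        then have 1: "g x = f x" "g (f x) = x" using mv[OF g] all inj by (metis injD)+
        have "g z = z" if "z \<noteq> x" "z \<noteq> f x" for z using mv[OF g] all that by blast
        then have "g = transpose x (f x)" using 1 by (auto simp: fun_eq_iff transpose_def)
        then show ?thesis by simp
      qed simp
    qed
    then have "card G \<le> card {id, transpose x (f x)}" by (intro card_mono) auto
    also have "\<dots> \<le> 2" by (simp add: card_insert_if)
    finally show ?thesis .
  qed
qed

lemma unit_generators_bound_max:
  assumes "finite V" "sgen V = G" "card G \<ge> 3"
  shows "max 2 unit_rank \<le> card V"
proof -
  have "2 \<le> card V"
  proof (rule ccontr)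
    assume "\<not> ?thesis"
    then consider "card V = 0" | "card V = 1" by linarith
    then show False
    proof cases
      case 1
      then have "V = {}" using assms by simp
      moreover have "f \<notin> sgen {}" for f :: "'a \<Rightarrow> 'a"
      proof
        assume "f \<in> sgen {}" then show False by induction auto
      qed
      ultimately show False using assms id_G by blast
    next
      case 2
      then obtain v where "V = {v}" using card_1_singletonE by blast
      then have "card G \<le> 2"
        using 2 unit_generators_bound[OF assms(1,2)] sgen_singleton_commute assms(2)
        by (intro commutative_units_card) auto
      then show False using assms by simp
    qed
  qed
  then show ?thesis using unit_generators_bound assms by simp
qed

lemma sgen_units:
  assumes "sgen U = T" shows "sgen (U \<inter> G) = G"
proof
  show "sgen (U \<inter> G) \<subseteq> G" using comp_closed_G by (intro sgen_least) auto
  have "f \<in> G \<longrightarrow> f \<in> sgen (U \<inter> G)" if "f \<in> sgen U" for f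
    using that
  proof induction
    case (base u)
    then show ?case by (auto intro: sgen.base)
  next
    case (prod f g)
    then show ?case using unit_of_comp assms sgen.prod by metis
  qed
  then show "G \<subseteq> sgen (U \<inter> G)" using assms G_T by blast
qed

lemma generators_bound:
  assumes "finite U" "sgen U = T" "card G \<ge> 3"
  shows "max 2 unit_rank + (card size_pairs + card nonmin_sizes + card gap_sizes) \<le> card U"
proof -
  have "max 2 unit_rank \<le> card (U \<inter> G)"
    using unit_generators_bound_max[OF _ sgen_units[OF assms(2)] assms(3)] assms(1) by simp
  moreover have "card (U \<inter> G) + card (U - G) = card U"
    using card_Int_Diff[OF assms(1)] by metis
  ultimately show ?thesis using nonunit_generators_bound[OF assms(1,2)] by linarith
qed

section \<open>Generators of the group of units\<close>


lemma transpose_bswap_image: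
  assumes H: "comp_closed H" and B: "B \<in> P" "C \<in> P" "card B = card C" "bswap B C \<in> H"
    and tr: "\<forall>x\<in>B. \<forall>y\<in>B. transpose x y \<in> H"
  shows "\<forall>x\<in>C. \<forall>y\<in>C. transpose x y \<in> H"
proof (intro ballI)
  fix x y assume xy: "x \<in> C" "y \<in> C"
  have g: "bswap B C \<in> G" using B bswap_G by blast
  have "C = bswap B C ` B" using unit_image[OF g B(1)] bm_bswap[OF B(1,2,1)] by simp
  then obtain x' y' where "x' \<in> B" "y' \<in> B" "x = bswap B C x'" "y = bswap B C y'" using xy by blast
  then show "transpose x y \<in> H"
    using transpose_image_in[OF H B(4) G_permutes[OF g] finX] tr by metis
qed

lemma bswap_involution: "B \<in> P \<Longrightarrow> C \<in> P \<Longrightarrow> card B = card C \<Longrightarrow> bswap B C \<circ> bswap B C = id"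
  using lift_comp[of "transpose B C" "transpose B C"]
  by (simp add: bswap_lift lift_id transpose_block_in transpose_block_card)

lemma permutes_within_unit:
  assumes "c permutes X" "\<And>x. x \<in> X \<Longrightarrow> transpose x (c x) \<in> G"
  shows "c \<in> G"
  using comp_closed_permutes[OF comp_closed_G id_G finX assms] .

lemma block_permutation_G:
  assumes "B \<in> P" "c permutes B" shows "c \<in> G"
proof (rule permutes_within_unit)
  show "c permutes X" using assms block_subset permutes_subset by blast
  fix x
  show "transpose x (c x) \<in> G"
  proof (cases "x \<in> B")
    case True
    then show ?thesis using transpose_G[OF assms(1)] permutes_in_image[OF assms(2)] by blast
  next
    case False
    then show ?thesis using permutes_not_in[OF assms(2)] id_G by simp
  qed
qed

lemma disjoint_comp_commute:
  assumes "\<And>x. x \<in> A \<Longrightarrow> f x \<in> A" "\<And>x. x \<notin> A \<Longrightarrow> f x = x"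
    and "\<And>x. x \<in> B \<Longrightarrow> g x \<in> B" "\<And>x. x \<notin> B \<Longrightarrow> g x = x" and "A \<inter> B = {}"
  shows "f \<circ> g = g \<circ> f"
proof
  fix x
  show "(f \<circ> g) x = (g \<circ> f) x"
  proof (cases "x \<in> B")
    case True
    then have "g x \<notin> A" "x \<notin> A" using assms(3,5) by blast+
    then show ?thesis using assms(2) by simp
  next
    case False
    then have "f x \<notin> B" using assms(1,2,5) by (cases "x \<in> A") auto
    then show ?thesis using False assms(4) by simp
  qed
qed

text \<open>For size at least 2 this says that \<open>H\<close> contains generators of the wreath
  product acting on the level, in the form that \<open>G_subset\<close> consumes.\<close>

definition generates_level :: "('a \<Rightarrow> 'a) set \<Rightarrow> nat \<Rightarrow> bool" where
  "generates_level H s \<longleftrightarrow> (\<forall>B\<in>blevel s. \<forall>C\<in>blevel s. bswap B C \<in> H) \<and>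
     (\<forall>B\<in>blevel s. \<forall>x\<in>B. \<forall>y\<in>B. transpose x y \<in> H)"

text \<open>Four ingredients generate the wreath product: a cycle and a transposition in blocks, an
  exchange, and a rotation of the blocks. They are merged into two generators, one of them an
  involution times an odd cycle on another support. With two blocks the exchange occupies both, so
  the involution is a transposition and the exchange stands alone. Bounding the support of
  \<open>g1\<close> allows it to carry further cycles later.\<close>

lemma wreath_generators:
  assumes s: "s \<in> big_sizes" "s \<in> multi"
  obtains g1 g2 where "g1 \<in> G" "g2 \<in> G" "\<forall>x. x \<notin> level s \<longrightarrow> g1 x = x"
    "\<forall>H. comp_closed H \<longrightarrow> g1 \<in> H \<longrightarrow> g2 \<in> H \<longrightarrow>
      generates_level H s"
proof -
  have fin: "finite (blevel s)" using finP by (simp add: blevel_def)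
  define m where "m = card (blevel s)"
  have m: "m \<ge> 2" using s(2) by (simp add: m_def multi_def blevel_def)
  obtain b where b: "bij_betw b {..<m} (blevel s)"
    using ex_bij_betw_nat_finite[OF fin] by (auto simp: m_def atLeast0LessThan)
  have bP: "b i \<in> P" "card (b i) = s" if "i < m" for i
    using b that by (auto simp: bij_betw_def blevel_def)
  have binj: "b i = b j \<longleftrightarrow> i = j" if "i < m" "j < m" for i j
    using b that by (auto simp: bij_betw_def dest: inj_onD)
  have bE: "\<exists>i<m. B = b i" if "B \<in> blevel s" for B using b that by (auto simp: bij_betw_def)
  have s2: "s \<ge> 2" using s by (simp add: big_sizes_def)
  have lev: "x \<in> level s" if "x \<in> b i" "i < m" for x i
    using bP[OF that(2)] that(1) block_subset blk_eq by (auto simp: level_def)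
  show thesis
  proof (cases "m = 2")
    case True
    define B where "B = b 0"
    define C where "C = b 1"
    have BC: "B \<in> P" "C \<in> P" "card B = s" "card C = s" "B \<noteq> C"
      using bP True binj by (auto simp: B_def C_def)
    have only: "D = B \<or> D = C" if D: "D \<in> blevel s" for D
    proof -
      obtain i where "i < 2" "D = b i" using bE[OF D] True by auto
      then show ?thesis by (auto simp: B_def C_def less_2_cases_iff)
    qed
    obtain x y c N where c: "x \<in> C" "y \<in> C" "x \<noteq> y" "c permutes C" "odd N" "c ^^ N = id"
      "cycle_connects c x y C"
      using odd_cycle_exists[of C] BC s2 block_finite by metis
    define w where "w = bswap B C"
    have wG: "w \<in> G" using BC by (simp add: w_def bswap_G)
    have ww: "w (w z) = z" for z using bswap_involution[of B C] BC by (metis comp_apply id_apply w_def)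
    have wC: "w z \<in> B" if "z \<in> C" for z
      using unit_image[OF wG BC(2)] bm_bswap[OF BC(1,2,2)] that by (auto simp: w_def)
    define \<tau> where "\<tau> = transpose (w x) (w y)"
    have \<tau>G: "\<tau> \<in> G" unfolding \<tau>_def using wC c BC by (intro transpose_G[of B]) auto
    have cG: "c \<in> G" using block_permutation_G BC c by blast
    have dis: "z \<notin> C" if "z \<in> B" for z using that BC block_disjoint by blast
    have \<tau>C: "\<tau> z = z" if "z \<notin> B" for z
      using that wC c by (auto simp: \<tau>_def transpose_def)
    have comm: "\<tau> \<circ> c = c \<circ> \<tau>"
      using permutes_in_image[OF c(4)] permutes_not_in[OF c(4)] wC c dis \<tau>C
      by (intro disjoint_comp_commute[of B \<tau> C c]) (auto simp: \<tau>_def transpose_def)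
    have pow: "(\<tau> \<circ> c) ^^ N = \<tau>"
      using c comm by (intro odd_funpow_involution) (auto simp: \<tau>_def)
    have Npos: "N > 0" using c(5) by (cases N) auto
    have key: "generates_level H s"
      if H: "comp_closed H" "\<tau> \<circ> c \<in> H" "w \<in> H" for H
    proof -
      have idH: "id \<in> H" using comp_closed_inv(2)[OF H(1,3) G_permutes[OF wG] finX] .
      have \<tau>H: "\<tau> \<in> H" using funpow_in[OF H(1,2) Npos] pow by simp
      have "transpose (w (w x)) (w (w y)) \<in> H"
        using transpose_image_in[OF H(1,3) G_permutes[OF wG] finX] \<tau>H by (simp add: \<tau>_def)
      then have tH: "transpose x y \<in> H" by (simp add: ww)
      have tcG: "\<tau> \<circ> c \<in> G" using unit_comp cG \<tau>G by blast
      have "(\<tau> \<circ> c) z = c z" if "z \<in> C" for z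
        using that \<tau>C dis permutes_in_image[OF c(4)] by auto
      then have trC: "\<forall>x\<in>C. \<forall>y\<in>C. transpose x y \<in> H"
        using comp_closed_symmetric[OF H(1,2) G_permutes[OF tcG] finX _ tH c(7)] by blast
      have wCB: "bswap C B \<in> H" "bswap B C \<in> H"
        using H(3) bswap_commute[OF BC(1,2)] by (simp_all add: w_def)
      have trB: "\<forall>x\<in>B. \<forall>y\<in>B. transpose x y \<in> H"
        using transpose_bswap_image[OF H(1) BC(2,1) _ wCB(1) trC] BC by simp
      have "bswap D E \<in> H" if "D \<in> blevel s" "E \<in> blevel s" for D E
        using only[OF that(1)] only[OF that(2)] wCB bswap_self BC idH by auto
      moreover have "\<forall>x\<in>D. \<forall>y\<in>D. transpose x y \<in> H" if "D \<in> blevel s" for D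
        using only[OF that] trB trC by blast
      ultimately show ?thesis unfolding generates_level_def by blast
    qed
    show thesis
    proof (rule that[of "\<tau> \<circ> c" w])
      show "\<tau> \<circ> c \<in> G" using unit_comp cG \<tau>G by blast
      show "\<forall>z. z \<notin> level s \<longrightarrow> (\<tau> \<circ> c) z = z"
      proof (intro allI impI)
        fix z assume "z \<notin> level s"
        then have "z \<notin> B" "z \<notin> C" using lev True by (auto simp: B_def C_def)
        then show "(\<tau> \<circ> c) z = z" using \<tau>C permutes_not_in[OF c(4)] by simp
      qed
      show "w \<in> G" by (rule wG)
    qed (use key in blast)
  next
    case False
    then have m3: "m \<ge> 3" using m by simp
    define A where "A = b 2"
    \<comment> \<open>The transposition sits in the last block, away from the steps of the rotation
      used below. For \<open>m = 3\<close> this block is \<open>A\<close>, and the exchange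
      \<open>u\<close> is the identity.\<close>
    define L where "L = b (m - 1)"
    have AL: "A \<in> P" "card A = s" "L \<in> P" "card L = s" using bP m3 by (auto simp: A_def L_def)
    obtain x y c N where c: "x \<in> A" "y \<in> A" "x \<noteq> y" "c permutes A" "odd N" "c ^^ N = id"
      "cycle_connects c x y A"
      using odd_cycle_exists[of A] AL s2 block_finite by metis
    have Npos: "N > 0" using c(5) by (cases N) auto
    define w where "w = bswap (b 0) (b 1)"
    have b01: "b 0 \<in> P" "b 1 \<in> P" "card (b 0) = card (b 1)" "b 0 \<noteq> b 1" "b 0 \<noteq> A" "b 1 \<noteq> A"
      using bP m3 binj by (auto simp: A_def)
    have wG: "w \<in> G" using b01 by (simp add: w_def bswap_G)
    have ww: "w \<circ> w = id" using bswap_involution b01 by (simp add: w_def)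
    have cG: "c \<in> G" using block_permutation_G AL c by blast
    have wout: "w z = z" if "z \<notin> b 0" "z \<notin> b 1" for z using that by (simp add: w_def bswap_def)
    have disA: "z \<notin> b 0" "z \<notin> b 1" if "z \<in> A" for z using that AL b01 block_disjoint by blast+
    have comm: "w \<circ> c = c \<circ> w"
    proof (rule disjoint_comp_commute[of "b 0 \<union> b 1" w A c])
      show "w z \<in> b 0 \<union> b 1" if "z \<in> b 0 \<union> b 1" for z
        using that b01 cpt_in by (auto simp: w_def bswap_def)
    qed (use wout disA permutes_in_image[OF c(4)] permutes_not_in[OF c(4)] in auto)
    have pow: "(w \<circ> c) ^^ N = w"
      using c comm ww by (intro odd_funpow_involution) auto
    define \<phi> where "\<phi> = map_permutation {..<m} b (\<lambda>i. if i < m then (i + 1) mod m else i)"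
    have cyc: "(\<lambda>i. if i < m then (i + 1) mod m else i) permutes {..<m}"
    proof (rule bij_imp_permutes)
      have "inj_on (\<lambda>i. if i < m then (i + 1) mod m else i) {..<m}"
        by (rule inj_onI) (auto simp: mod_Suc split: if_splits)
      moreover have "(\<lambda>i. if i < m then (i + 1) mod m else i) ` {..<m} \<subseteq> {..<m}" using m3 by auto
      ultimately show "bij_betw (\<lambda>i. if i < m then (i + 1) mod m else i) {..<m} {..<m}"
        unfolding bij_betw_def using endo_inj_surj[OF finite_lessThan] by blast
    qed auto
    have \<phi>lev: "\<phi> permutes blevel s"
      unfolding \<phi>_def using map_permutation_permutes[OF b cyc] .
    have \<phi>P: "\<phi> permutes P" using \<phi>lev by (rule permutes_subset) (auto simp: blevel_def)
    have \<phi>b: "\<phi> (b i) = b ((i + 1) mod m)" if "i < m" for i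
    proof -
      have "inj_on b {..<m}" using b by (simp add: bij_betw_def)
      then show ?thesis unfolding \<phi>_def using that by (subst map_permutation_apply) auto
    qed
    have \<phi>card: "card (\<phi> B) = card B" for B
      using permutes_in_image[OF \<phi>lev, of B] permutes_not_in[OF \<phi>lev, of B]
      by (cases "B \<in> blevel s") (auto simp: blevel_def)
    define \<rho> where "\<rho> = lift \<phi>"
    have \<rho>G: "\<rho> \<in> G" unfolding \<rho>_def using lift_G \<phi>P \<phi>card by blast
    define u where "u = bswap A L"
    have uG: "u \<in> G" using AL by (simp add: u_def bswap_G)
    have uA: "u z \<in> L" if "z \<in> A" for z
      using unit_image[OF uG AL(1)] bm_bswap[OF AL(1,3,1)] that by (auto simp: u_def)
    have uu: "u (u z) = z" for z using bswap_involution[of A L] AL by (metis comp_apply id_apply u_def)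
    define \<tau> where "\<tau> = transpose (u x) (u y)"
    have \<tau>G: "\<tau> \<in> G" unfolding \<tau>_def using uA c AL by (intro transpose_G[of L]) auto
    define g2 where "g2 = \<rho> \<circ> \<tau>"
    have g2G: "g2 \<in> G" unfolding g2_def using \<rho>G \<tau>G by (intro unit_comp)
    \<comment> \<open>None of these blocks is \<open>L\<close>, so \<open>\<tau>\<close> is
      invisible and \<open>g2\<close> shifts indices exactly as the rotation does.\<close>
    have g2b: "g2 (pt (b i) k) = pt (b (Suc i)) k" if "Suc i < m" "k < s" for i k
    proof -
      have im: "i < m" using that by simp
      have "pt (b i) k \<in> b i" "b i \<noteq> L" using that bP[OF im] pt_in binj by (auto simp: L_def)
      then have "pt (b i) k \<notin> L" using bP[OF im] AL block_disjoint by blast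
      then have "\<tau> (pt (b i) k) = pt (b i) k" using uA c by (auto simp: \<tau>_def transpose_def)
      then have "g2 (pt (b i) k) = \<rho> (pt (b i) k)" by (simp add: g2_def)
      also have "\<dots> = pt (\<phi> (b i)) k"
        unfolding \<rho>_def using that bP[OF im] \<phi>card by (intro lift_pt) auto
      finally show ?thesis using \<phi>b[OF im] that by simp
    qed
    have g1G: "w \<circ> c \<in> G" using wG cG by (intro unit_comp)
    have key: "generates_level H s"
      if H: "comp_closed H" "w \<circ> c \<in> H" "g2 \<in> H" for H
    proof -
      have idH: "id \<in> H" using comp_closed_inv(2)[OF H(1,3) G_permutes[OF g2G] finX] .
      have wH: "w \<in> H" using funpow_in[OF H(1,2) Npos] pow by simp
      have "w \<circ> (w \<circ> c) \<in> H" using comp_closedD[OF H(1) wH H(2)] .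
      then have cH: "c \<in> H" using ww by (simp add: o_assoc)
      \<comment> \<open>Conjugation by \<open>g2\<close> shifts the first exchange along the
        sequence. Stopping before the last block suffices, since the adjacent exchanges already
        generate all others.\<close>
      have step: "Suc i < m \<Longrightarrow> bswap (b i) (b (Suc i)) \<in> H" for i
      proof (induction i)
        case 0
        then show ?case using wH by (simp add: w_def)
      next
        case (Suc i)
        have i: "i < m" "Suc i < m" "Suc (Suc i) < m" using Suc.prems by auto
        have "g2 \<circ> bswap (b i) (b (Suc i)) = bswap (b (Suc i)) (b (Suc (Suc i))) \<circ> g2"
          using i bP binj g2b by (intro bswap_conj g2G) auto
        then show ?case
          using comp_closed_conj[OF H(1,3) Suc.IH[OF i(2)] G_permutes[OF g2G] finX] by blast
      qed
      have from0: "i < m \<Longrightarrow> bswap (b 0) (b i) \<in> H" for i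
      proof (induction i)
        case 0
        then show ?case using bswap_self[OF b01(1)] idH by metis
      next
        case (Suc i)
        then show ?case
          using bswap_trans[OF H(1) idH, of "b 0" "b i" "b (Suc i)"] step[of i] bP b01 by simp
      qed
      have sw: "bswap B C \<in> H" if BC: "B \<in> blevel s" "C \<in> blevel s" for B C
      proof -
        obtain i j where ij: "i < m" "B = b i" "j < m" "C = b j" using bE BC by metis
        have "bswap B (b 0) \<in> H" using from0[OF ij(1)] ij bswap_commute bP b01 by metis
        then show ?thesis
          using bswap_trans[OF H(1) idH, of B "b 0" C] from0[OF ij(3)] ij bP m by simp
      qed
      \<comment> \<open>The rotation is itself a product of exchanges, so it can be divided out of
        \<open>g2\<close>, leaving \<open>\<tau>\<close>.\<close>
      have "\<rho> \<in> H" unfolding \<rho>_def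
      proof (rule lift_in[OF H(1) idH \<phi>P])
        fix B assume B: "B \<in> P"
        show "bswap B (\<phi> B) \<in> H"
        proof (cases "B \<in> blevel s")
          case True
          then show ?thesis using sw permutes_in_image[OF \<phi>lev] by blast
        next
          case False
          then show ?thesis using permutes_not_in[OF \<phi>lev] bswap_self[OF B] idH by metis
        qed
      qed (rule \<phi>card)
      then have "inv \<rho> \<circ> g2 \<in> H"
        using comp_closed_inv(1)[OF H(1) _ G_permutes[OF \<rho>G] finX] comp_closedD[OF H(1)] H(3) by blast
      also have "inv \<rho> \<circ> g2 = \<tau>"
        unfolding g2_def o_assoc permutes_inv_o(2)[OF G_permutes[OF \<rho>G]] by simp
      finally have \<tau>H: "\<tau> \<in> H" .
      have ALl: "A \<in> blevel s" "L \<in> blevel s" using AL by (auto simp: blevel_def)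
      have uH: "u \<in> H" using sw[OF ALl] by (simp add: u_def)
      have "transpose (u (u x)) (u (u y)) \<in> H"
        using transpose_image_in[OF H(1) uH G_permutes[OF uG] finX] \<tau>H by (simp add: \<tau>_def)
      then have tH: "transpose x y \<in> H" by (simp add: uu)
      have trA: "\<forall>x\<in>A. \<forall>y\<in>A. transpose x y \<in> H"
        using comp_closed_symmetric[OF H(1) cH G_permutes[OF cG] finX refl tH c(7)] by blast
      have "\<forall>x\<in>B. \<forall>y\<in>B. transpose x y \<in> H" if B: "B \<in> blevel s" for B
        using transpose_bswap_image[OF H(1) AL(1) _ _ sw[OF ALl(1) B] trA] B AL by (simp add: blevel_def)
      then show ?thesis unfolding generates_level_def using sw by blast
    qed
    show thesis
    proof (rule that[of "w \<circ> c" g2])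
      show "\<forall>z. z \<notin> level s \<longrightarrow> (w \<circ> c) z = z"
      proof (intro allI impI)
        fix z assume "z \<notin> level s"
        then have "z \<notin> A" "z \<notin> b 0" "z \<notin> b 1" using lev m3 by (auto simp: A_def)
        then show "(w \<circ> c) z = z" using wout permutes_not_in[OF c(4)] by simp
      qed
      show "w \<circ> c \<in> G" "g2 \<in> G" by (fact g1G, fact g2G)
    qed (use key in blast)
  qed
qed

text \<open>The supports of the factors of the group of units that are plain symmetric groups.\<close>

definition sym_factors :: "'a set set" where
  "sym_factors = {B\<in>P. card B \<in> big_sizes - multi} \<union> (if 1 \<in> multi then {level 1} else {})"

lemma level_one_in_P:
  assumes "B \<in> P" "card B = 1" shows "B \<subseteq> level 1"
  using assms block_subset blk_eq by (auto simp: level_def)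

text \<open>A size at least 2 that occurs once, and likewise the repeated size 1, contributes one to
  \<open>unit_rank\<close> and gives one symmetric factor. A repeated size at least 2 contributes
  two and gives a wreath factor.\<close>

lemma card_sym_factors: "finite sym_factors" "card sym_factors + 2 * card (big_sizes \<inter> multi) \<le> unit_rank"
proof -
  let ?S = "{B\<in>P. card B \<in> big_sizes - multi}"
  show "finite sym_factors" using finP by (simp add: sym_factors_def)
  have "inj_on card ?S"
  proof (rule inj_onI)
    fix B C assume BC: "B \<in> ?S" "C \<in> ?S" "card B = card C"
    then show "B = C" using multi_unique by blast
  qed
  then have S: "card ?S \<le> card (big_sizes - multi)"
    using finite_big_sizes by (intro card_inj_on_le[of card]) auto
  have b: "card big_sizes = card (big_sizes - multi) + card (big_sizes \<inter> multi)"
    using card_Int_Diff[OF finite_big_sizes, of multi] by simp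
  have mm: "card multi = card (multi - big_sizes) + card (big_sizes \<inter> multi)"
    using card_Int_Diff[OF finite_types(4), of big_sizes] by (simp add: Int_commute)
  have "card (if 1 \<in> multi then {level 1} else {}) \<le> card (multi - big_sizes)"
  proof (cases "1 \<in> multi")
    case True
    then have "{1} \<subseteq> multi - big_sizes" by (auto simp: big_sizes_def)
    then have "card {1::nat} \<le> card (multi - big_sizes)" using finite_types by (intro card_mono) auto
    then show ?thesis using True by simp
  qed simp
  moreover have "card sym_factors \<le> card ?S + card (if 1 \<in> multi then {level 1} else {})"
    unfolding sym_factors_def by (rule card_Un_le)
  ultimately show "card sym_factors + 2 * card (big_sizes \<inter> multi) \<le> unit_rank"
    using S b mm by (simp add: unit_rank_def)
qed

lemma sym_factor_props:
  assumes "Y \<in> sym_factors"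
  shows "Y \<subseteq> X" "card Y \<ge> 2" "\<And>x y. x \<in> Y \<Longrightarrow> y \<in> Y \<Longrightarrow> transpose x y \<in> G"
    "\<And>s. s \<in> big_sizes \<inter> multi \<Longrightarrow> Y \<inter> level s = {}"
proof -
  consider (1) "Y \<in> P" "card Y \<in> big_sizes - multi" | (2) "1 \<in> multi" "Y = level 1"
    using assms by (auto simp: sym_factors_def split: if_splits)
  then have "Y \<subseteq> X \<and> card Y \<ge> 2 \<and> (\<forall>x\<in>Y. \<forall>y\<in>Y. transpose x y \<in> G) \<and>
      (\<forall>s\<in>big_sizes \<inter> multi. Y \<inter> level s = {})"
  proof cases
    case 1
    then show ?thesis using block_subset transpose_G blk_eq by (auto simp: big_sizes_def level_def)
  next
    case 2
    obtain B C where BC: "B \<in> P" "C \<in> P" "B \<noteq> C" "card B = 1" "card C = 1" using 2 multiE by metis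
    obtain x y where xy: "B = {x}" "C = {y}" using BC card_1_singletonE by metis
    then have "{x, y} \<subseteq> Y" using level_one_in_P[OF BC(1,4)] level_one_in_P[OF BC(2,5)] 2 by auto
    then have "card {x, y} \<le> card Y" using 2 finX by (intro card_mono) (auto simp: level_def)
    then have "card Y \<ge> 2" using xy BC by auto
    then show ?thesis using 2 transpose_singletons_G by (auto simp: big_sizes_def level_def)
  qed
  then show "Y \<subseteq> X" "card Y \<ge> 2" "\<And>x y. x \<in> Y \<Longrightarrow> y \<in> Y \<Longrightarrow> transpose x y \<in> G"
    "\<And>s. s \<in> big_sizes \<inter> multi \<Longrightarrow> Y \<inter> level s = {}" by blast+
qed

lemma sym_factors_disjoint:
  assumes "Y \<in> sym_factors" "Z \<in> sym_factors" "x \<in> Y" "x \<in> Z" shows "Y = Z"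
proof -
  have *: "Y = blk x \<and> card (blk x) \<noteq> 1 \<or> Y = level 1 \<and> card (blk x) = 1" if "Y \<in> sym_factors" "x \<in> Y" for Y
    using that blk_eq by (auto simp: sym_factors_def big_sizes_def level_def split: if_splits)
  show ?thesis using *[OF assms(1,3)] *[OF assms(2,4)] by metis
qed

lemma G_subset_factors:
  assumes H: "comp_closed H" "id \<in> H"
    and sym: "\<And>Y x y. Y \<in> sym_factors \<Longrightarrow> x \<in> Y \<Longrightarrow> y \<in> Y \<Longrightarrow> transpose x y \<in> H"
    and wr: "\<And>s. s \<in> big_sizes \<inter> multi \<Longrightarrow> generates_level H s"
  shows "G \<subseteq> H"
proof (rule G_subset[OF H])
  fix B x y assume B: "B \<in> P" "x \<in> B" "y \<in> B"
  show "transpose x y \<in> H"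
  proof (cases "x = y")
    case False
    then have "card B \<ge> 2" using B block_card_ge_2 by blast
    then have big: "card B \<in> big_sizes" using B by (auto simp: big_sizes_def sizes_def)
    show ?thesis
    proof (cases "card B \<in> multi")
      case True
      then show ?thesis using wr[of "card B"] big B by (auto simp: blevel_def generates_level_def)
    next
      case False
      then have "B \<in> sym_factors" using B big by (simp add: sym_factors_def)
      then show ?thesis using sym B by blast
    qed
  qed (use H in simp)
next
  fix B C assume BC: "B \<in> P" "C \<in> P" "card B = card C" "B \<noteq> C"
  then have m: "card B \<in> multi" using multiI by blast
  show "bswap B C \<in> H"
  proof (cases "card B = 1")
    case True
    then obtain x y where xy: "B = {x}" "C = {y}" using BC by (metis card_1_singletonE)
    \<comment> \<open>Exchanging singletons is a transposition of points, so size 1 is handled by a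
      plain symmetric factor rather than a wreath product.\<close>
    have "bswap B C = transpose x y"
    proof
      fix z
      have "cpt B z = x" "cpt C z = y" using cpt_in[of B z] cpt_in[of C z] BC xy by auto
      then show "bswap B C z = transpose x y z"
        using xy by (auto simp: bswap_def transpose_def)
    qed
    moreover have "x \<in> level 1" "y \<in> level 1"
      using level_one_in_P[OF BC(1)] level_one_in_P[OF BC(2)] BC True xy by auto
    moreover have "level 1 \<in> sym_factors" using m True by (simp add: sym_factors_def)
    ultimately show ?thesis using sym by simp
  next
    case False
    then have "card B \<in> big_sizes" using BC block_card_pos[of B] by (auto simp: big_sizes_def sizes_def)
    then show ?thesis using wr[of "card B"] m BC by (auto simp: blevel_def generates_level_def)
  qed
qed

text \<open>Each symmetric factor pays only for its transposition, so its cycle must travel on some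
  other generator: on that of a wreath factor if there is one, otherwise on the transposition of
  another symmetric factor. With a single symmetric factor there is no carrier, and the cycle is a
  second generator.\<close>

lemma unit_generators_exist:
  obtains V where "V \<subseteq> G" "finite V" "card V \<le> max 2 unit_rank" "G \<subseteq> sgen V"
proof -
  note goal = that
  have "\<exists>a b c N. a \<in> Y \<and> b \<in> Y \<and> a \<noteq> b \<and> c permutes Y \<and> odd N \<and> c ^^ N = id \<and> cycle_connects c a b Y"
    if Y: "Y \<in> sym_factors" for Y
    using odd_cycle_exists[of Y] sym_factor_props(1,2)[OF Y] finX finite_subset by metis
  then obtain a b c N where abc: "\<And>Y. Y \<in> sym_factors \<Longrightarrow> a Y \<in> Y \<and> b Y \<in> Y \<and> a Y \<noteq> b Y \<and>
      c Y permutes Y \<and> odd (N Y :: nat) \<and> c Y ^^ N Y = id \<and> cycle_connects (c Y) (a Y) (b Y) Y"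
    by metis
  define \<tau> where "\<tau> Y = transpose (a Y) (b Y)" for Y
  have \<tau>G: "\<tau> Y \<in> G" if "Y \<in> sym_factors" for Y
    using abc[OF that] sym_factor_props(3)[OF that] by (simp add: \<tau>_def)
  have cY: "c Y x \<in> Y" if "Y \<in> sym_factors" "x \<in> Y" for Y x
    using permutes_in_image abc[OF that(1)] that(2) by metis
  have cnY: "c Y x = x" if "Y \<in> sym_factors" "x \<notin> Y" for Y x
    using permutes_not_in abc[OF that(1)] that(2) by metis
  have cG: "c Y \<in> G" if Y: "Y \<in> sym_factors" for Y
  proof (rule permutes_within_unit)
    show "c Y permutes X" using abc[OF Y] sym_factor_props(1)[OF Y] permutes_subset by blast
    fix x show "transpose x (c Y x) \<in> G"
      using cY[OF Y] cnY[OF Y] sym_factor_props(3)[OF Y] id_G by (cases "x \<in> Y") auto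
  qed
  have transposes: "\<forall>x\<in>Y. \<forall>y\<in>Y. transpose x y \<in> H"
    if "comp_closed H" "h \<in> H" "h \<in> G" "\<And>x. x \<in> Y \<Longrightarrow> h x = c Y x" "\<tau> Y \<in> H" "Y \<in> sym_factors" for H h Y
    using comp_closed_symmetric[OF that(1,2) G_permutes[OF that(3)] finX that(4)] that(5) abc[OF that(6)]
    unfolding \<tau>_def by blast
  show thesis
  proof (cases "big_sizes \<inter> multi = {}")
    case False
    then obtain s0 where s0: "s0 \<in> big_sizes \<inter> multi" by blast
    let ?W = "big_sizes \<inter> multi"
    have fW: "finite ?W" using finite_big_sizes by simp
    have "\<exists>g1 g2. g1 \<in> G \<and> g2 \<in> G \<and> (\<forall>x. x \<notin> level s \<longrightarrow> g1 x = x) \<and>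
      (\<forall>H. comp_closed H \<longrightarrow> g1 \<in> H \<longrightarrow> g2 \<in> H \<longrightarrow>
        generates_level H s)"
      if s: "s \<in> ?W" for s
    proof -
      obtain g1 g2 where "g1 \<in> G" "g2 \<in> G" "\<forall>x. x \<notin> level s \<longrightarrow> g1 x = x"
        "\<forall>H. comp_closed H \<longrightarrow> g1 \<in> H \<longrightarrow> g2 \<in> H \<longrightarrow> generates_level H s"
        by (rule wreath_generators[OF IntD1[OF s] IntD2[OF s]])
      then show ?thesis by (intro exI conjI)
    qed
    then obtain g1 g2 where g: "\<And>s. s \<in> ?W \<Longrightarrow> g1 s \<in> G \<and> g2 s \<in> G \<and> (\<forall>x. x \<notin> level s \<longrightarrow> g1 s x = x) \<and>
      (\<forall>H. comp_closed H \<longrightarrow> g1 s \<in> H \<longrightarrow> g2 s \<in> H \<longrightarrow>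
        generates_level H s)"
      by metis
    have g1G: "g1 s \<in> G" and g2G: "g2 s \<in> G" and gfix: "x \<notin> level s \<Longrightarrow> g1 s x = x"
      and ggen: "comp_closed H \<Longrightarrow> g1 s \<in> H \<Longrightarrow> g2 s \<in> H \<Longrightarrow> generates_level H s"
      if "s \<in> ?W" for s x H
      using g[OF that] by (elim conjE; simp)+
    \<comment> \<open>The product of all cycles. The choice is unambiguous, as the factors are
      disjoint.\<close>
    define c0 where "c0 x = (if \<exists>Y\<in>sym_factors. x \<in> Y then c (SOME Y. Y \<in> sym_factors \<and> x \<in> Y) x else x)" for x
    have c0Y: "c0 x = c Y x" if Y: "Y \<in> sym_factors" "x \<in> Y" for x Y
    proof -
      have "(SOME Y. Y \<in> sym_factors \<and> x \<in> Y) = Y"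
        using Y sym_factors_disjoint by (intro some_equality) auto
      then show ?thesis using Y by (auto simp: c0_def)
    qed
    have c0n: "c0 x = x" if "\<And>Y. Y \<in> sym_factors \<Longrightarrow> x \<notin> Y" for x using that by (auto simp: c0_def)
    have c0p: "c0 permutes X"
    proof (rule inj_imp_permutes)
      show "inj_on c0 X"
      proof (rule inj_onI)
        fix x y assume xy: "x \<in> X" "y \<in> X" "c0 x = c0 y"
        \<comment> \<open>No point enters or leaves a factor, so injectivity can be checked inside
          one factor.\<close>
        have *: "x' \<in> Y \<longleftrightarrow> c0 x' \<in> Y" if "Y \<in> sym_factors" for x' Y
        proof (cases "\<exists>Z\<in>sym_factors. x' \<in> Z")
          case True
          then obtain Z where Z: "Z \<in> sym_factors" "x' \<in> Z" by blast
          then have "c0 x' \<in> Z" using c0Y cY by simp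
          then show ?thesis using Z that sym_factors_disjoint by metis
        next
          case False
          then show ?thesis using c0n by metis
        qed
        show "x = y"
        proof (cases "\<exists>Y\<in>sym_factors. x \<in> Y")
          case True
          then obtain Y where Y: "Y \<in> sym_factors" "x \<in> Y" by blast
          then have "y \<in> Y" using * xy by metis
          then have "c Y x = c Y y" using c0Y Y xy by simp
          then show ?thesis using abc[OF Y(1)] permutes_inj by (metis injD)
        next
          case False
          then have "\<not> (\<exists>Y\<in>sym_factors. y \<in> Y)" using * xy by metis
          then show ?thesis using False c0n xy by metis
        qed
      qed
      show "c0 x \<in> X" if "x \<in> X" for x
      proof (cases "\<exists>Y\<in>sym_factors. x \<in> Y")
        case True
        then obtain Y where Y: "Y \<in> sym_factors" "x \<in> Y" by blast
        then have "c0 x \<in> Y" using c0Y cY by simp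
        then show ?thesis using sym_factor_props(1)[OF Y(1)] by blast
      next
        case False
        then have "c0 x = x" by (intro c0n) blast
        then show ?thesis using that by simp
      qed
      show "c0 x = x" if "x \<notin> X" for x
      proof (rule c0n)
        show "x \<notin> Y" if "Y \<in> sym_factors" for Y
          using sym_factor_props(1)[OF that] \<open>x \<notin> X\<close> by blast
      qed
    qed (rule finX)
    have c0cl: "transpose x (c0 x) \<in> H" if "\<And>Y. Y \<in> sym_factors \<Longrightarrow> \<forall>x\<in>Y. \<forall>y\<in>Y. transpose x y \<in> H" "id \<in> H" for H x
    proof (cases "\<exists>Y\<in>sym_factors. x \<in> Y")
      case True
      then obtain Y where Y: "Y \<in> sym_factors" "x \<in> Y" by blast
      then show ?thesis using that(1)[OF Y(1)] c0Y cY by simp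
    next
      case False
      then have "c0 x = x" by (intro c0n) blast
      then show ?thesis using that by simp
    qed
    have "transpose x (c0 x) \<in> G" for x
      by (rule c0cl[OF _ id_G]) (intro ballI sym_factor_props(3))
    then have c0G: "c0 \<in> G" by (rule permutes_within_unit[OF c0p])
    \<comment> \<open>All cycles ride on one wreath product generator. The transpositions \<open>\<tau> Y\<close> are generators, so
      conjugating them recovers the symmetric groups, hence \<open>c0\<close>, and finally \<open>g1 s0\<close>.\<close>
    define h where "h = g1 s0 \<circ> c0"
    have hG: "h \<in> G" unfolding h_def by (rule unit_comp[OF c0G g1G[OF s0]])
    define V where "V = insert h (g1 ` (?W - {s0}) \<union> g2 ` ?W \<union> \<tau> ` sym_factors)"
    have VG: "V \<subseteq> G" using g1G g2G \<tau>G hG by (auto simp: V_def)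
    have fV: "finite V" using fW card_sym_factors(1) by (simp add: V_def)
    have "card V \<le> Suc (card (g1 ` (?W - {s0}) \<union> g2 ` ?W \<union> \<tau> ` sym_factors))"
      unfolding V_def by (rule card_insert_le_m1[THEN order_trans]) auto
    also have "\<dots> \<le> Suc (card (?W - {s0}) + card ?W + card sym_factors)"
      using fW card_sym_factors(1)
      by (intro Suc_le_mono[THEN iffD2] order_trans[OF card_Un_le] add_mono card_image_le) auto
    also have "\<dots> = card sym_factors + 2 * card ?W" using card.remove[OF fW s0] by simp
    also have "\<dots> \<le> unit_rank" by (rule card_sym_factors)
    finally have cV: "card V \<le> max 2 unit_rank" by simp
    let ?H = "sgen V"
    have VH: "v \<in> ?H" if "v \<in> V" for v using that by (rule sgen.base)
    have H: "comp_closed ?H" by (rule comp_closed_sgen)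
    have hH: "h \<in> ?H" by (rule VH) (simp add: V_def)
    have idH: "id \<in> ?H" using comp_closed_inv(2)[OF H hH G_permutes[OF hG] finX] .
    have tr: "\<forall>x\<in>Y. \<forall>y\<in>Y. transpose x y \<in> ?H" if Y: "Y \<in> sym_factors" for Y
    proof (rule transposes[OF H hH hG _ VH Y])
      show "\<tau> Y \<in> V" using Y by (simp add: V_def)
      fix x assume x: "x \<in> Y"
      then have "c0 x = c Y x" "c Y x \<in> Y" using c0Y cY Y by auto
      moreover have "c Y x \<notin> level s0" using calculation sym_factor_props(4)[OF Y s0] by blast
      ultimately show "h x = c Y x" using gfix[OF s0] by (simp add: h_def)
    qed
    have "c0 \<in> ?H" using comp_closed_permutes[OF H idH finX c0p] c0cl[OF tr idH] by blast
    then have "h \<circ> inv c0 \<in> ?H"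
      using comp_closed_inv(1)[OF H _ c0p finX] comp_closedD[OF H hH] by blast
    also have "h \<circ> inv c0 = g1 s0"
      unfolding h_def comp_assoc permutes_inv_o(1)[OF c0p] by simp
    finally have g10: "g1 s0 \<in> ?H" .
    have "G \<subseteq> ?H"
    proof (rule G_subset_factors[OF H idH])
      show "transpose x y \<in> ?H" if "Y \<in> sym_factors" "x \<in> Y" "y \<in> Y" for Y x y using tr that by blast
      fix s assume s: "s \<in> ?W"
      have "g1 s \<in> ?H"
      proof (cases "s = s0")
        case False
        then show ?thesis using s by (intro VH) (simp add: V_def)
      qed (use g10 in simp)
      moreover have "g2 s \<in> ?H" using s by (intro VH) (simp add: V_def)
      ultimately show "generates_level ?H s" using ggen[OF s H] by blast
    qed
    then show thesis using goal[OF VG fV cV] by blast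
  next
    case W: True
    define q where "q = card sym_factors"
    have qr: "q \<le> unit_rank" using card_sym_factors(2) by (simp add: q_def)
    have fin: thesis if V: "V \<subseteq> G" "finite V" "card V \<le> max 2 unit_rank" "V \<noteq> {}"
      "\<And>Y. Y \<in> sym_factors \<Longrightarrow> \<exists>h\<in>sgen V. h \<in> G \<and> (\<forall>x\<in>Y. h x = c Y x)"
      "\<And>Y. Y \<in> sym_factors \<Longrightarrow> \<tau> Y \<in> sgen V" for V
    proof -
      obtain v where v: "v \<in> V" using V(4) by blast
      have H: "comp_closed (sgen V)" by (rule comp_closed_sgen)
      have idH: "id \<in> sgen V"
        using comp_closed_inv(2)[OF H sgen.base[OF v] G_permutes finX] v V(1) by blast
      have "G \<subseteq> sgen V"
      proof (rule G_subset_factors[OF H idH])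
        fix Y x y assume Y: "Y \<in> sym_factors" "x \<in> Y" "y \<in> Y"
        obtain h where h: "h \<in> sgen V" "h \<in> G" "\<forall>x\<in>Y. h x = c Y x" using V(5)[OF Y(1)] by blast
        show "transpose x y \<in> sgen V"
          using transposes[OF H h(1,2) _ V(6)[OF Y(1)] Y(1)] h(3) Y by blast
      qed (use W in blast)
      then show thesis using goal[OF V(1-3)] by blast
    qed
    consider (0) "q = 0" | (1) "q = 1" | (2) "q \<ge> 2" by linarith
    then show thesis
    proof cases
      case 0
      then have "sym_factors = {}" using card_sym_factors(1) by (simp add: q_def)
      \<comment> \<open>The group is trivial here, but an empty set generates nothing, so the
        identity itself has to be a generator.\<close>
      then show thesis using id_G by (intro fin[of "{id}"]) auto
    next
      case 1
      then obtain Y where Y: "sym_factors = {Y}" using card_1_singletonE q_def by metis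
      have "card {\<tau> Y, c Y} \<le> 2" by (simp add: card_insert_if)
      then show thesis using Y \<tau>G cG
        by (intro fin[of "{\<tau> Y, c Y}"]) (auto intro: sgen.base)
    next
      case 2
      obtain e where e: "bij_betw e {..<q} sym_factors"
        using ex_bij_betw_nat_finite[OF card_sym_factors(1)] by (auto simp: q_def atLeast0LessThan)
      have eS: "e i \<in> sym_factors" if "i < q" for i using e that by (auto simp: bij_betw_def)
      have eE: "\<exists>i<q. Y = e i" if "Y \<in> sym_factors" for Y using e that by (auto simp: bij_betw_def)
      have einj: "e i = e j \<longleftrightarrow> i = j" if "i < q" "j < q" for i j
        using e that by (auto simp: bij_betw_def dest: inj_onD)
      \<comment> \<open>The factors are arranged in a circle. Since \<open>q \<ge> 2\<close>, the
        successor differs from \<open>i\<close>, so the transposition and the cycle in one generator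
        have disjoint supports.\<close>
      define nx where "nx i = (if Suc i = q then 0 else Suc i)" for i
      have nx: "nx i < q" "nx i \<noteq> i" if "i < q" for i using that 2 by (auto simp: nx_def)
      \<comment> \<open>Taking the odd power \<open>N\<close> isolates \<open>\<tau>\<close>.\<close>
      define g where "g i = \<tau> (e i) \<circ> c (e (nx i))" for i
      have gG: "g i \<in> G" if "i < q" for i
        unfolding g_def using that nx eS \<tau>G cG by (intro unit_comp) auto
      have dis: "e i \<inter> e (nx i) = {}" if "i < q" for i
        using sym_factors_disjoint[OF eS eS] nx[OF that] that einj by blast
      have \<tau>n: "\<tau> Y x = x" if "Y \<in> sym_factors" "x \<notin> Y" for Y x
        using abc[OF that(1)] that(2) by (auto simp: \<tau>_def transpose_def)
      have \<tau>Y: "\<tau> Y x \<in> Y" if "Y \<in> sym_factors" "x \<in> Y" for Y x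
        using abc[OF that(1)] that(2) by (auto simp: \<tau>_def transpose_def)
      have pow: "g i ^^ N (e (nx i)) = \<tau> (e i)" if i: "i < q" for i
      proof -
        note Y = eS[OF i] and Z = eS[OF nx(1)[OF i]]
        have "\<tau> (e i) \<circ> c (e (nx i)) = c (e (nx i)) \<circ> \<tau> (e i)"
          using \<tau>Y[OF Y] \<tau>n[OF Y] cY[OF Z] cnY[OF Z] dis[OF i] by (rule disjoint_comp_commute)
        then show ?thesis unfolding g_def using abc[OF Z]
          by (intro odd_funpow_involution) (auto simp: \<tau>_def)
      qed
      have \<tau>H: "\<tau> (e i) \<in> sgen (g ` {..<q})" if i: "i < q" for i
      proof -
        have "N (e (nx i)) > 0" using abc[OF eS[OF nx(1)[OF i]]] by (cases "N (e (nx i))") auto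
        moreover have "g i \<in> sgen (g ` {..<q})" using i by (intro sgen.base) simp
        ultimately show ?thesis using funpow_in[OF comp_closed_sgen] pow[OF i] by metis
      qed
      show thesis
      proof (rule fin[of "g ` {..<q}"])
        show "g ` {..<q} \<subseteq> G" using gG by auto
        show "card (g ` {..<q}) \<le> max 2 unit_rank"
          using card_image_le[of "{..<q}" g] qr by simp
        show "g ` {..<q} \<noteq> {}" using 2 by (simp add: lessThan_empty_iff)
        fix Y assume "Y \<in> sym_factors"
        then obtain i where i: "i < q" "Y = e i" using eE by blast
        show "\<tau> Y \<in> sgen (g ` {..<q})" using \<tau>H i by simp
        \<comment> \<open>The predecessor of \<open>i\<close> on the circle: its generator carries
          the cycle of \<open>Y\<close>, and its transposition fixes \<open>Y\<close>
          pointwise.\<close>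
        define j where "j = (if i = 0 then q - 1 else i - 1)"
        have j: "j < q" "nx j = i" using i 2 by (auto simp: j_def nx_def)
        have "g j x = c Y x" if "x \<in> Y" for x
        proof -
          have "c Y x \<in> e (nx j)" using cY eS i j that by simp
          then have "c Y x \<notin> e j" using dis[OF j(1)] by blast
          then show ?thesis using \<tau>n[OF eS[OF j(1)]] i j by (simp add: g_def)
        qed
        then show "\<exists>h\<in>sgen (g ` {..<q}). h \<in> G \<and> (\<forall>x\<in>Y. h x = c Y x)"
          using gG[OF j(1)] j(1) by (intro bexI[of _ "g j"]) (auto intro: sgen.base)
      qed simp
    qed
  qed
qed

end

section \<open>The rank\<close>

lemma card_increasing_pairs:
  fixes A :: "'b::linorder set"
  assumes "finite A"
  shows "card {(x, y). x \<in> A \<and> y \<in> A \<and> x < y} = card A choose 2"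
proof -
  have "bij_betw (\<lambda>(x, y). {x, y}) {(x, y). x \<in> A \<and> y \<in> A \<and> x < y} {B. B \<subseteq> A \<and> card B = 2}"
  proof (rule bij_betw_imageI)
    show "inj_on (\<lambda>(x, y). {x, y}) {(x, y). x \<in> A \<and> y \<in> A \<and> x < y}"
      by (auto simp: inj_on_def doubleton_eq_iff)
    show "(\<lambda>(x, y). {x, y}) ` {(x, y). x \<in> A \<and> y \<in> A \<and> x < y} = {B. B \<subseteq> A \<and> card B = 2}"
    proof (intro equalityI subsetI)
      fix B assume B: "B \<in> {B. B \<subseteq> A \<and> card B = 2}"
      then obtain x y where xy: "B = {x, y}" "x \<noteq> y" by (auto simp: card_2_iff)
      show "B \<in> (\<lambda>(x, y). {x, y}) ` {(x, y). x \<in> A \<and> y \<in> A \<and> x < y}"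
      proof (cases "x < y")
        case True
        then show ?thesis using xy B by (intro image_eqI[of _ _ "(x, y)"]) auto
      next
        case False
        then show ?thesis using xy B by (intro image_eqI[of _ _ "(y, x)"]) auto
      qed
    qed auto
  qed
  then show ?thesis using n_subsets[OF assms, of 2] by (simp add: bij_betw_same_card)
qed

context partitioned
begin

lemma generators_exist:
  obtains U where "U \<subseteq> T" "finite U" "sgen U = T"
    "card U \<le> max 2 unit_rank + (card size_pairs + card nonmin_sizes + card gap_sizes)"
proof -
  obtain V where V: "V \<subseteq> G" "finite V" "card V \<le> max 2 unit_rank" "G \<subseteq> sgen V"
    by (rule unit_generators_exist)
  have "\<exists>B C. B \<in> P \<and> C \<in> P \<and> B \<noteq> C \<and> card B = fst p \<and> card C = snd p" if "p \<in> size_pairs" for p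
    using size_pairs_obtain[of "fst p" "snd p"] that by (metis prod.collapse)
  then obtain B1 C1 where c: "\<And>p. p \<in> size_pairs \<Longrightarrow> B1 p \<in> P \<and> C1 p \<in> P \<and> B1 p \<noteq> C1 p \<and>
      card (B1 p) = fst p \<and> card (C1 p) = snd p" by metis
  have "\<exists>B C. B \<in> P \<and> C \<in> P \<and> card B < card C \<and> card C = s \<and> \<not> (\<exists>M\<in>P. card B < card M \<and> card M < card C)"
    if "s \<in> nonmin_sizes" for s using nonmin_sizes_obtain[OF that] by metis
  then obtain B2 C2 where w: "\<And>s. s \<in> nonmin_sizes \<Longrightarrow> B2 s \<in> P \<and> C2 s \<in> P \<and> card (B2 s) < card (C2 s) \<and>
      card (C2 s) = s \<and> \<not> (\<exists>M\<in>P. card (B2 s) < card M \<and> card M < card (C2 s))" by metis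
  have "\<exists>B. B \<in> P \<and> card B = s \<and> s \<ge> 2" if "s \<in> gap_sizes" for s
    using that by (auto simp: gap_sizes_def sizes_def)
  then obtain B3 where d: "\<And>s. s \<in> gap_sizes \<Longrightarrow> B3 s \<in> P \<and> card (B3 s) = s \<and> s \<ge> 2" by metis
  define U where "U = V \<union> (\<lambda>p. collapse (B1 p) (C1 p)) ` size_pairs \<union>
    (\<lambda>s. bswap (B2 s) (C2 s)) ` nonmin_sizes \<union> (\<lambda>s. drop_top (B3 s)) ` gap_sizes"
  have fin: "finite U" using V finite_types by (simp add: U_def)
  have UT: "U \<subseteq> T"
    unfolding U_def
  proof (intro Un_least image_subsetI)
    show "V \<subseteq> T" using V(1) G_T by blast
    show "collapse (B1 p) (C1 p) \<in> T" if "p \<in> size_pairs" for p using c[OF that] collapse_T by simp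
    show "bswap (B2 s) (C2 s) \<in> T" if "s \<in> nonmin_sizes" for s using w[OF that] bswap_T by simp
    show "drop_top (B3 s) \<in> T" if "s \<in> gap_sizes" for s using d[OF that] drop_top_T(1) by simp
  qed
  have "card U \<le> card V + card size_pairs + card nonmin_sizes + card gap_sizes"
    unfolding U_def using finite_types
    by (intro order_trans[OF card_Un_le] add_mono card_image_le) simp_all
  then have cU: "card U \<le> max 2 unit_rank + (card size_pairs + card nonmin_sizes + card gap_sizes)"
    using V(3) by linarith
  have "T \<subseteq> sgen U"
  proof (rule T_subset_of_generators)
    show "comp_closed (sgen U)" by (rule comp_closed_sgen)
    have "sgen V \<subseteq> sgen U" by (rule sgen_least[OF comp_closed_sgen]) (auto simp: U_def intro: sgen.base)
    then show "G \<subseteq> sgen U" using V by blast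
  next
    fix R Q assume RQ: "R \<in> P" "Q \<in> P" "R \<noteq> Q" "card R \<le> card Q"
    have p: "(card R, card Q) \<in> size_pairs"
    proof (cases "card R = card Q")
      case True
      then have "card Q \<in> multi" using multiI[of Q R] RQ by auto
      then show ?thesis using True by (simp add: size_pairs_def)
    next
      case False
      then show ?thesis using RQ by (simp add: size_pairs_def sizes_def)
    qed
    have "collapse (B1 (card R, card Q)) (C1 (card R, card Q)) \<in> sgen U"
      using p by (intro sgen.base) (auto simp: U_def)
    then show "\<exists>R'\<in>P. \<exists>Q'\<in>P. R' \<noteq> Q' \<and> card R' = card R \<and> card Q' = card Q \<and> collapse R' Q' \<in> sgen U"
      using c[OF p] by (metis fst_conv snd_conv)
  next
    fix R Q assume RQ: "R \<in> P" "Q \<in> P" "card R < card Q" "\<not> (\<exists>M\<in>P. card R < card M \<and> card M < card Q)"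
    have s: "card Q \<in> nonmin_sizes" using RQ by (auto simp: nonmin_sizes_def sizes_def)
    have "bswap (B2 (card Q)) (C2 (card Q)) \<in> sgen U"
      using s by (intro sgen.base) (auto simp: U_def)
    \<comment> \<open>Both are the largest size below \<open>card Q\<close>, so the chosen
      representative has the required sizes.\<close>
    moreover have "card (B2 (card Q)) = card R"
      using w[OF s] RQ by (metis linorder_cases)
    ultimately show "\<exists>R'\<in>P. \<exists>Q'\<in>P. card R' = card R \<and> card Q' = card Q \<and> bswap R' Q' \<in> sgen U"
      using w[OF s] by metis
  next
    fix B assume B: "B \<in> P" "card B \<ge> 2" "\<not> (\<exists>C\<in>P. card C = card B - 1)"
    have s: "card B \<in> gap_sizes" using B by (auto simp: gap_sizes_def sizes_def)
    have "drop_top (B3 (card B)) \<in> sgen U" using s by (intro sgen.base) (auto simp: U_def)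
    then show "\<exists>B'\<in>P. card B' = card B \<and> drop_top B' \<in> sgen U" using d[OF s] by metis
  qed
  moreover have "sgen U \<subseteq> T" using sgen_least[OF comp_closed_T UT] .
  ultimately show thesis using that UT fin cU by blast
qed

lemma srank_T:
  assumes "card G \<ge> 3"
  shows "srank T = max 2 unit_rank + (card size_pairs + card nonmin_sizes + card gap_sizes)"
  unfolding srank_def
proof (rule Least_equality)
  obtain U where U: "U \<subseteq> T" "finite U" "sgen U = T"
    "card U \<le> max 2 unit_rank + (card size_pairs + card nonmin_sizes + card gap_sizes)"
    by (rule generators_exist)
  then have "card U = max 2 unit_rank + (card size_pairs + card nonmin_sizes + card gap_sizes)"
    using generators_bound[OF U(2,3) assms] by linarith
  then show "\<exists>U\<subseteq>T. finite U \<and> card U = max 2 unit_rank + (card size_pairs + card nonmin_sizes + card gap_sizes) \<and>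
      sgen U = T" using U by blast
next
  fix k assume "\<exists>U\<subseteq>T. finite U \<and> card U = k \<and> sgen U = T"
  then show "max 2 unit_rank + (card size_pairs + card nonmin_sizes + card gap_sizes) \<le> k"
    using generators_bound assms by blast
qed

lemma card_size_pairs: "card size_pairs = (card sizes choose 2) + card multi"
proof -
  have "card size_pairs = card {(s, s'). s \<in> sizes \<and> s' \<in> sizes \<and> s < s'} + card ((\<lambda>s. (s, s)) ` multi)"
    unfolding size_pairs_def
  proof (rule card_Un_disjoint)
    show "finite {(s, s'). s \<in> sizes \<and> s' \<in> sizes \<and> s < s'}"
      by (rule finite_subset[of _ "sizes \<times> sizes"]) (auto simp: finite_sizes)
  qed (auto simp: finite_types)
  also have "card ((\<lambda>s. (s, s)) ` multi) = card multi" by (rule card_image) (simp add: inj_on_def)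
  finally show ?thesis by (simp add: card_increasing_pairs finite_sizes)
qed

lemma card_nonmin_sizes:
  assumes "X \<noteq> {}" shows "card nonmin_sizes = card sizes - 1" "card sizes \<ge> 1"
proof -
  have ne: "sizes \<noteq> {}" using assms part by (auto simp: sizes_def partition_on_def)
  have "nonmin_sizes = {s \<in> sizes. Min sizes < s}"
    unfolding nonmin_sizes_def using Min_less_iff[OF finite_sizes ne] by blast
  also have "\<dots> = sizes - {Min sizes}"
    using Min_le[OF finite_sizes] by (fastforce simp: less_le)
  finally have "nonmin_sizes = sizes - {Min sizes}" .
  then show "card nonmin_sizes = card sizes - 1" using Min_in[OF finite_sizes ne] finite_sizes by simp
  show "card sizes \<ge> 1" using ne finite_sizes by (simp add: Suc_le_eq card_gt_0_iff)
qed

lemma lcount_gap_sizes: "lcount P = card gap_sizes"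
proof -
  have "(\<exists>B\<in>P. card B = s) \<longleftrightarrow> s \<in> sizes" for s by (auto simp: sizes_def)
  then show ?thesis by (simp add: lcount_def gap_sizes_def)
qed

end

theorem theorem1p1:
  fixes X :: "'a set" and P :: "'a set set"
    and p q t :: nat and m n ls :: "nat \<Rightarrow> nat"
  assumes "finite X" and "X \<noteq> {}"
    and "partition_on X P"
    and "\<forall>i<p. m i \<ge> 2 \<and> n i \<ge> 2 \<and> card {B\<in>P. card B = n i} = m i"
    and "inj_on n {..<p}"
    and "\<forall>j<q. ls j \<ge> 2 \<and> card {B\<in>P. card B = ls j} = 1"
    and "inj_on ls {..<q}"
    and "\<forall>i<p. \<forall>j<q. n i \<noteq> ls j"
    and "card {B\<in>P. card B = 1} = t"
    and "\<forall>B\<in>P. card B = 1 \<or> card B \<in> n ` {..<p} \<or> card B \<in> ls ` {..<q}"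
    and "card (SP X P) \<ge> 3"
  shows "srank (TP X P) = max 2 (2*p + q + gfun t) + ((p + q) choose 2) + 2*p + q + gfun' t - 1
           + lcount P + hfun p q t"
proof -
  interpret partitioned X P by unfold_locales (use assms in auto)
  let ?one = "if t \<ge> 1 then {1::nat} else {}"
  have occurs: "s \<in> sizes" if "card {B\<in>P. card B = s} \<ge> 1" for s
  proof -
    have "{B\<in>P. card B = s} \<noteq> {}" using that by (metis card.empty not_one_le_zero)
    then show ?thesis by (auto simp: sizes_def)
  qed
  have occ_n: "n i \<in> sizes" "n i \<in> multi" "n i \<ge> 2" if "i < p" for i
    using assms(4) that occurs[of "n i"] by (auto simp: multi_def)
  have occ_l: "ls j \<in> sizes" "ls j \<notin> multi" "ls j \<ge> 2" if "j < q" for j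
    using assms(6) that occurs[of "ls j"] by (auto simp: multi_def)
  have big: "big_sizes = n ` {..<p} \<union> ls ` {..<q}"
    using assms(10) occ_n occ_l by (auto simp: big_sizes_def sizes_def)
  have one: "1 \<in> sizes \<longleftrightarrow> t \<ge> 1"
  proof
    assume "1 \<in> sizes"
    then have "{B\<in>P. card B = 1} \<noteq> {}" by (auto simp: sizes_def)
    then show "t \<ge> 1" using assms(9) finP by (auto simp: Suc_le_eq card_gt_0_iff)
  qed (use assms(9) occurs[of 1] in simp)
  have "s = 1 \<or> s \<ge> 2" if "s \<in> sizes" for s
  proof -
    have "s \<noteq> 0" using that block_card_pos by (auto simp: sizes_def)
    then show ?thesis by linarith
  qed
  then have sizes: "sizes = big_sizes \<union> ?one"
    using one by (auto simp: big_sizes_def)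
  \<comment> \<open>Two or more singletons make 1 a repeated size; this is the origin of
    \<open>gfun\<close> in the rank of the units.\<close>
  have multi: "multi = n ` {..<p} \<union> (if t \<ge> 2 then {1} else {})"
  proof -
    have "1 \<in> multi \<longleftrightarrow> t \<ge> 2" using assms(9) by (simp add: multi_def)
    moreover have "multi \<subseteq> n ` {..<p} \<union> {1}"
      using multi_subset sizes big occ_l(2) by (auto split: if_splits)
    moreover have "n ` {..<p} \<subseteq> multi" using occ_n by auto
    ultimately show ?thesis by auto
  qed
  have cn: "card (n ` {..<p}) = p" and cl: "card (ls ` {..<q}) = q"
    using assms(5,7) by (simp_all add: card_image)
  have "n ` {..<p} \<inter> ls ` {..<q} = {}" using assms(8) by auto
  then have cbig: "card big_sizes = p + q" unfolding big by (simp add: card_Un_disjoint cn cl)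
  have n1: "1 \<notin> n ` {..<p}" using occ_n(3) by fastforce
  have cmulti: "card multi = p + gfun t" using n1 by (simp add: multi gfun_def cn)
  have "1 \<notin> big_sizes" by (simp add: big_sizes_def)
  then have csizes: "card sizes = p + q + gfun' t"
    using finite_big_sizes cbig by (simp add: sizes gfun'_def)
  have "srank T = max 2 (2*p + q + gfun t) + (((p + q + gfun' t) choose 2) + (p + gfun t) +
      (p + q + gfun' t - 1) + lcount P)"
    unfolding srank_T[OF assms(11)] unit_rank_def card_size_pairs card_nonmin_sizes(1)[OF assms(2)]
      lcount_gap_sizes cbig cmulti csizes by (simp add: algebra_simps)
  \<comment> \<open>At least one size occurs, so natural subtraction truncates nothing. If
    singletons are present there is one size more, which adds \<open>p + q\<close> to the binomial
    coefficient; together with the pair of two singletons for \<open>t \<ge> 2\<close> this gives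
    \<open>hfun\<close>.\<close>
  moreover have "p + q + gfun' t \<ge> 1" using card_nonmin_sizes(2)[OF assms(2)] csizes by simp
  moreover have "(Suc (p + q)) choose 2 = ((p + q) choose 2) + (p + q)"
    by (simp add: numeral_2_eq_2)
  ultimately show ?thesis
    by (auto simp: gfun_def gfun'_def hfun_def split: if_splits)
qed

end
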